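(* Let $n\ge1$, let $\Omega\subset\mathbb{R}^n$ be a bounded domain with Lipschitz boundary, $\Omega_e:=\mathbb{R}^n\setminus\overline\Omega$, $s\in(0,1)$, and let $W_1,W_2\subset\Omega_e$ be arbitrary nonempty open sets. For $j=1,2$ let $a_j^{(1)}\in C^0(\overline\Omega)$ be such that $0$ is not a Dirichlet eigenvalue of $(-\Delta)^s+a_j^{(1)}$ in $\Omega$, and let $F_j\in(\widetilde H^s(\Omega))^*$. Consider \[ \begin{cases}\big((-\Delta)^s+a_j^{(1)}\big)u_j=F_j & \text{in }\Omega,\\ u_j=g & \text{in }\Omega_e,\end{cases} \] whose unique solution in $H^s(\mathbb{R}^n)$ exists for each $g\in H^s(\mathbb{R}^n)$. Let $f\in\widetilde H^s(W_1)\setminus\{0\}$. If \[ \mathcal{C}^0_{a_1^{(1)},F_1}=\mathcal{C}^0_{a_2^{(1)},F_2}\quad\text{and}\quad \mathcal{C}^{W_1,W_2}_{a_1^{(1)},F_1}(f)=\mathcal{C}^{W_1,W_2}_{a_2^{(1)},F_2}(f), \] then $a_1^{(1)}=a_2^{(1)}$ and $F_1=F_2$ in $\Omega$.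
   Context: $(-\Delta)^s$ is the fractional Laplacian, $(-\Delta)^s u(x)=c_{n,s}\,\mathrm{P.V.}\int_{\mathbb{R}^n}\frac{u(x)-u(y)}{|x-y|^{n+2s}}dy$, $c_{n,s}=\frac{\Gamma(\frac n2+s)}{|\Gamma(-s)|}\frac{4^s}{\pi^{n/2}}$. $\widetilde H^s(U)$ is the closure of $C_c^\infty(U)$ in $H^s(\mathbb{R}^n)$. For exterior datum $g$ with solution $u$, the Cauchy data is $\mathcal{C}^{W_1,W_2}_{a,F}(g):=\big(g|_{W_1},(-\Delta)^s u|_{W_2}\big)$ and the passive measurement is $\mathcal{C}^0_{a,F}:=\mathcal{C}^{W_1,W_2}_{a,F}(0)$, i.e. $(-\Delta)^s u^{(0)}|_{W_2}$ for the solution $u^{(0)}$ with zero exterior value. *)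

theory Defs
  imports "HOL-Analysis.Analysis"
begin

definition lipschitz_domain :: "'a::euclidean_space set \<Rightarrow> bool" where
  "lipschitz_domain \<Omega> \<longleftrightarrow> \<Omega> \<noteq> {} \<and> open \<Omega> \<and> connected \<Omega> \<and> bounded \<Omega> \<and>
     (\<forall>p\<in>frontier \<Omega>. \<exists>e r L (\<gamma>::'a \<Rightarrow> real). norm e = 1 \<and> r > 0 \<and>
        L-lipschitz_on {x. x \<bullet> e = 0} \<gamma> \<and>
        \<Omega> \<inter> ball p r = {x \<in> ball p r. x \<bullet> e < \<gamma> (x - (x \<bullet> e) *\<^sub>R e)})"

fun iter_deriv :: "'a::euclidean_space list \<Rightarrow> ('a \<Rightarrow> real) \<Rightarrow> 'a \<Rightarrow> real" where
  "iter_deriv [] f = f"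
| "iter_deriv (v # vs) f = (\<lambda>x. frechet_derivative (iter_deriv vs f) (at x) v)"

definition smooth_fun :: "('a::euclidean_space \<Rightarrow> real) \<Rightarrow> bool" where
  "smooth_fun f \<longleftrightarrow> (\<forall>vs x. iter_deriv vs f differentiable (at x))"

definition tsupport :: "('a::euclidean_space \<Rightarrow> real) \<Rightarrow> 'a set" where
  "tsupport f = closure {x. f x \<noteq> 0}"

definition test_fun :: "'a::euclidean_space set \<Rightarrow> ('a \<Rightarrow> real) \<Rightarrow> bool" where
  "test_fun U \<phi> \<longleftrightarrow> smooth_fun \<phi> \<and> compact (tsupport \<phi>) \<and> tsupport \<phi> \<subseteq> U"

definition gag_kernel :: "real \<Rightarrow> ('a::euclidean_space \<Rightarrow> real) \<Rightarrow> ('a \<Rightarrow> real) \<Rightarrow> 'a \<times> 'a \<Rightarrow> real" where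
  "gag_kernel s u v = (\<lambda>(x,y). (u x - u y) * (v x - v y) / norm (x - y) powr (real DIM('a) + 2 * s))"

definition Hs :: "real \<Rightarrow> ('a::euclidean_space \<Rightarrow> real) set" where
  "Hs s = {u. u \<in> borel_measurable lborel \<and> integrable lborel (\<lambda>x. (u x)\<^sup>2) \<and>
              integrable (lborel \<Otimes>\<^sub>M lborel) (gag_kernel s u u)}"

definition Hs_norm :: "real \<Rightarrow> ('a::euclidean_space \<Rightarrow> real) \<Rightarrow> real" where
  "Hs_norm s u = sqrt ((\<integral>x. (u x)\<^sup>2 \<partial>lborel) + (\<integral>z. gag_kernel s u u z \<partial>(lborel \<Otimes>\<^sub>M lborel)))"

definition Hs_tilde :: "real \<Rightarrow> 'a::euclidean_space set \<Rightarrow> ('a \<Rightarrow> real) set" where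
  "Hs_tilde s U = {u \<in> Hs s. \<forall>\<epsilon>>0. \<exists>\<phi>. test_fun U \<phi> \<and> Hs_norm s (\<lambda>x. u x - \<phi> x) < \<epsilon>}"

text \<open>Zero element of H^s (functions are identified up to a.e. equality).\<close>
definition Hs_zero :: "('a::euclidean_space \<Rightarrow> real) \<Rightarrow> bool" where
  "Hs_zero u \<longleftrightarrow> (AE x in lborel. u x = 0)"

definition Hs_tilde_dual :: "real \<Rightarrow> 'a::euclidean_space set \<Rightarrow> (('a \<Rightarrow> real) \<Rightarrow> real) set" where
  "Hs_tilde_dual s U = {F.
     (\<forall>u\<in>Hs_tilde s U. \<forall>v\<in>Hs_tilde s U. F (\<lambda>x. u x + v x) = F u + F v) \<and>
     (\<forall>u\<in>Hs_tilde s U. \<forall>c. F (\<lambda>x. c * u x) = c * F u) \<and>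
     (\<exists>C. \<forall>u\<in>Hs_tilde s U. \<bar>F u\<bar> \<le> C * Hs_norm s u)}"

definition c_ns :: "nat \<Rightarrow> real \<Rightarrow> real" where
  "c_ns n s = Gamma (real n / 2 + s) / \<bar>Gamma (- s)\<bar> * 4 powr s / pi powr (real n / 2)"

text \<open>\<open>frac_form s u v\<close> = the pairing of (-Delta)^s u with v, for u, v in H^s.\<close>
definition frac_form :: "real \<Rightarrow> ('a::euclidean_space \<Rightarrow> real) \<Rightarrow> ('a \<Rightarrow> real) \<Rightarrow> real" where
  "frac_form s u v = c_ns DIM('a) s / 2 * (\<integral>z. gag_kernel s u v z \<partial>(lborel \<Otimes>\<^sub>M lborel))"

definition is_solution ::
  "real \<Rightarrow> 'a::euclidean_space set \<Rightarrow> ('a \<Rightarrow> real) \<Rightarrow> (('a \<Rightarrow> real) \<Rightarrow> real) \<Rightarrow> ('a \<Rightarrow> real) \<Rightarrow> ('a \<Rightarrow> real) \<Rightarrow> bool" where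
  "is_solution s \<Omega> a F g u \<longleftrightarrow> u \<in> Hs s \<and> (\<lambda>x. u x - g x) \<in> Hs_tilde s \<Omega> \<and>
     (\<forall>\<phi>\<in>Hs_tilde s \<Omega>. frac_form s u \<phi> + (LINT x:\<Omega>|lborel. a x * u x * \<phi> x) = F \<phi>)"

definition not_dirichlet_eigenvalue :: "real \<Rightarrow> 'a::euclidean_space set \<Rightarrow> ('a \<Rightarrow> real) \<Rightarrow> bool" where
  "not_dirichlet_eigenvalue s \<Omega> a \<longleftrightarrow>
     (\<forall>u\<in>Hs_tilde s \<Omega>. (\<forall>\<phi>\<in>Hs_tilde s \<Omega>. frac_form s u \<phi> + (LINT x:\<Omega>|lborel. a x * u x * \<phi> x) = 0)
        \<longrightarrow> Hs_zero u)"

text \<open>(-Delta)^s u restricted to W2 (as a distribution on W2) for the (unique) solution u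
  with exterior value g; functionals are recorded on test functions of W2 (0 elsewhere).\<close>
definition frac_lap_restr ::
  "real \<Rightarrow> 'a::euclidean_space set \<Rightarrow> ('a \<Rightarrow> real) \<Rightarrow> (('a \<Rightarrow> real) \<Rightarrow> real) \<Rightarrow> 'a set \<Rightarrow> ('a \<Rightarrow> real)
     \<Rightarrow> (('a \<Rightarrow> real) \<Rightarrow> real)" where
  "frac_lap_restr s \<Omega> a F W2 g = (THE \<Lambda>. \<exists>u. is_solution s \<Omega> a F g u \<and>
      \<Lambda> = (\<lambda>\<phi>. if test_fun W2 \<phi> then frac_form s u \<phi> else 0))"

definition cauchy_data ::
  "real \<Rightarrow> 'a::euclidean_space set \<Rightarrow> 'a set \<Rightarrow> 'a set \<Rightarrow> ('a \<Rightarrow> real) \<Rightarrow> (('a \<Rightarrow> real) \<Rightarrow> real)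
     \<Rightarrow> ('a \<Rightarrow> real) \<Rightarrow> ('a \<Rightarrow> real) \<times> (('a \<Rightarrow> real) \<Rightarrow> real)" where
  "cauchy_data s \<Omega> W1 W2 a F g = (restrict g W1, frac_lap_restr s \<Omega> a F W2 g)"

definition passive_data ::
  "real \<Rightarrow> 'a::euclidean_space set \<Rightarrow> 'a set \<Rightarrow> ('a \<Rightarrow> real) \<Rightarrow> (('a \<Rightarrow> real) \<Rightarrow> real)
     \<Rightarrow> (('a \<Rightarrow> real) \<Rightarrow> real)" where
  "passive_data s \<Omega> W2 a F = frac_lap_restr s \<Omega> a F W2 (\<lambda>_. 0)"

end

(*
  Two solutions of the exterior value problem with the same exterior value and the same
  (-Delta)^s u on W2 differ by a function w that vanishes outside Omega and satisfies
  (-Delta)^s w = 0 on W2, so w = 0 by unique continuation. Hence the passive data identify the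
  solutions u for exterior value 0, the active data identify the solutions v for exterior value f,
  and w = v - u solves the homogeneous equation for both potentials, which gives (a1 - a2) w = 0
  in Omega. If a1 and a2 differed at a point, w and therefore also (-Delta)^s w would vanish near
  it, so w = 0 and f = 0. The sources are then read off the equation.

  Unique continuation needs no extension problem. If u = 0 near x0 and (-Delta)^s u = 0 there, then
  int u(y) |x - y|^(-p) dy = 0 for all x near x0, where p = n + 2 s. Since
  Laplace |x|^(-q) = q (q + 2 - n) |x|^(-q-2) has a nonzero constant for q >= p, the same holds with
  p + 2 k instead of p, and further differentiation gives
  int u(y) f(x - y) |x - y|^(-p-2k) dy = 0 for homogeneous polynomials f of degree at most k.
  In the inverted variable z = (x0 - y) / |x0 - y|^2 the case k = deg f says that the finite
  measure u(y) |x0 - y|^(-p) dy, supported in a compact set of z, annihilates all polynomials, so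
  it vanishes by the Stone-Weierstrass theorem.

  The existence of solutions, without which the data are unspecified, is the Fredholm alternative.
*)
theory Submission
  imports Defs "HOL-Real_Asymp.Real_Asymp" "HOL-Complex_Analysis.Great_Picard"
begin

text \<open>Elements of H^s are functions, not classes, so every form is only semidefinite and null
  elements are never divided out: the Riesz and Fredholm theorems are proved for a complete
  semi-inner product on a set of functions, limits and solutions are determined only up to null
  elements, and injectivity means that the form vanishes. The equation is weak, whereas the argument
  for unique continuation differentiates pointwise identities. The passage is possible because u
  vanishes near x0: for x in a smaller ball and u(y) nonzero, |x - y| is bounded below, so the
  integral of u(y) |x - y|^(-p) is continuous in x and all differentiations under the integral share
  one integrable majorant, |u(y)| |x0 - y|^(-p) up to a constant. In the end only the values at x0
  are used, but the identities are kept on a ball so that they can be differentiated again. The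
  inversion sends y at infinity to z = 0, and a homogeneous f of degree k satisfies f(x0 - y) |x0 -
  y|^(-2k) = f(z). This is why a derivative may cost a factor |x - y|^(-2) while the degree grows by
  one only.\<close>

abbreviation (input) quad :: "('b \<Rightarrow> 'b \<Rightarrow> real) \<Rightarrow> 'b \<Rightarrow> real" where
  "quad B u \<equiv> B u u"

abbreviation (input) lborel2 :: "('a::euclidean_space \<times> 'b::euclidean_space) measure" where
  "lborel2 \<equiv> lborel \<Otimes>\<^sub>M lborel"

abbreviation (input) gag_form :: "real \<Rightarrow> ('a::euclidean_space \<Rightarrow> real) \<Rightarrow> ('a \<Rightarrow> real) \<Rightarrow> real" where
  "gag_form s u v \<equiv> \<integral>z. gag_kernel s u v z \<partial>lborel2"

section \<open>Quadratic forms on function spaces and the Fredholm alternative\<close>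

text \<open>The carrier is a set of functions and not a type, because the same form lives on H^s and
  on the closed subspace belonging to each open set. Linearity in the second argument comes from
  symmetry.\<close>

locale sym_form =
  fixes V :: "('x \<Rightarrow> real) set" and B :: "('x \<Rightarrow> real) \<Rightarrow> ('x \<Rightarrow> real) \<Rightarrow> real"
  assumes zero_mem: "(\<lambda>x. 0) \<in> V"
    and add_mem: "u \<in> V \<Longrightarrow> v \<in> V \<Longrightarrow> (\<lambda>x. u x + v x) \<in> V"
    and scale_mem: "u \<in> V \<Longrightarrow> (\<lambda>x. c * u x) \<in> V"
    and form_add: "u \<in> V \<Longrightarrow> v \<in> V \<Longrightarrow> w \<in> V \<Longrightarrow> B (\<lambda>x. u x + v x) w = B u w + B v w"
    and form_scale: "u \<in> V \<Longrightarrow> w \<in> V \<Longrightarrow> B (\<lambda>x. c * u x) w = c * B u w"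
    and form_sym: "u \<in> V \<Longrightarrow> v \<in> V \<Longrightarrow> B u v = B v u"
begin

lemma diff_mem: assumes "u \<in> V" "v \<in> V" shows "(\<lambda>x. u x - v x) \<in> V"
proof -
  have "(\<lambda>x. u x - v x) = (\<lambda>x. u x + (-1) * v x)" by simp
  then show ?thesis using add_mem[OF assms(1) scale_mem[OF assms(2), of "-1"]] by simp
qed

lemma form_diff:
  assumes "u \<in> V" "v \<in> V" "w \<in> V"
  shows "B (\<lambda>x. u x - v x) w = B u w - B v w"
proof -
  have "(\<lambda>x. u x - v x) = (\<lambda>x. u x + (-1) * v x)" by simp
  then have "B (\<lambda>x. u x - v x) w = B (\<lambda>x. u x + (-1) * v x) w" by (rule arg_cong)
  also have "\<dots> = B u w + (-1) * B v w"
    by (simp only: form_add[OF assms(1) scale_mem[OF assms(2)] assms(3)] form_scale[OF assms(2,3)])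
  finally show ?thesis by simp
qed

lemma form_add2:
  assumes "u \<in> V" "v \<in> V" "w \<in> V"
  shows "B w (\<lambda>x. u x + v x) = B w u + B w v"
  by (simp only: form_sym[OF assms(3) add_mem[OF assms(1,2)]] form_add[OF assms]
      form_sym[OF assms(3,1)] form_sym[OF assms(3,2)])

lemma form_diff2:
  assumes "u \<in> V" "v \<in> V" "w \<in> V"
  shows "B w (\<lambda>x. u x - v x) = B w u - B w v"
  by (simp only: form_sym[OF assms(3) diff_mem[OF assms(1,2)]] form_diff[OF assms]
      form_sym[OF assms(3,1)] form_sym[OF assms(3,2)])

lemma form_scale2:
  assumes "u \<in> V" "w \<in> V"
  shows "B w (\<lambda>x. c * u x) = c * B w u"
  by (simp only: form_sym[OF assms(2) scale_mem[OF assms(1)]] form_scale[OF assms]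
      form_sym[OF assms(2,1)])

lemma form_quad:
  assumes u: "u \<in> V" and v: "v \<in> V"
  shows "quad B (\<lambda>x. u x + t * v x) = B u u + 2 * t * B u v + t\<^sup>2 * B v v"
proof -
  note tv = scale_mem[OF v, of t]
  have "quad B (\<lambda>x. u x + t * v x) = B u u + t * B u v + (t * B v u + t * (t * B v v))"
    by (simp only: form_add[OF u tv add_mem[OF u tv]] form_add2[OF u tv u] form_add2[OF u tv tv]
        form_scale[OF v u] form_scale2[OF v u] form_scale[OF v tv] form_scale2[OF v v])
  then show ?thesis by (simp add: form_sym[OF v u] power2_eq_square algebra_simps)
qed

lemma form_diff_diff:
  assumes u: "u \<in> V" and v: "v \<in> V"
  shows "quad B (\<lambda>x. u x - v x) = B u u - 2 * B u v + B v v"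
  by (simp add: form_diff[OF u v diff_mem[OF u v]] form_diff2[OF u v u] form_diff2[OF u v v] form_sym[OF v u])

lemma form_add_add:
  assumes u: "u \<in> V" and v: "v \<in> V"
  shows "quad B (\<lambda>x. u x + v x) = B u u + 2 * B u v + B v v"
  by (simp add: form_add[OF u v add_mem[OF u v]] form_add2[OF u v u] form_add2[OF u v v] form_sym[OF v u])

end

locale semi_inner = sym_form +
  assumes form_nonneg: "u \<in> V \<Longrightarrow> 0 \<le> B u u"
begin

text \<open>The quadratic polynomial \<open>quad B (u + t v)\<close> in \<open>t\<close> is
  nonnegative. As \<open>B\<close> may be degenerate, \<open>B v v = 0\<close> is a case of its own:
  there the polynomial is affine in \<open>t\<close>, so its slope must vanish. Otherwise it is
  evaluated at its minimum.\<close>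

lemma cauchy_schwarz_sq: assumes u: "u \<in> V" and v: "v \<in> V" shows "(B u v)\<^sup>2 \<le> B u u * B v v"
proof -
  have q: "0 \<le> B u u + 2 * t * B u v + t\<^sup>2 * B v v" for t
    using form_nonneg[of "\<lambda>x. u x + t * v x"] form_quad[OF u v] add_mem[OF u scale_mem[OF v]] by simp
  show ?thesis
  proof (cases "B v v = 0")
    case True
    have "B u v = 0"
    proof (rule ccontr)
      assume n: "B u v \<noteq> 0"
      have "2 * (- (B u u + 1) / (2 * B u v)) * B u v = - (B u u + 1)" using n by (simp add: field_simps)
      with q[of "- (B u u + 1) / (2 * B u v)"] True show False by simp
    qed
    with True show ?thesis by simp
  next
    case False
    then have p: "B v v > 0" using form_nonneg[OF v] by simp
    have "0 \<le> B u u + 2 * (- B u v / B v v) * B u v + (- B u v / B v v)\<^sup>2 * B v v" by (rule q)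
    also have "\<dots> = B u u - (B u v)\<^sup>2 / B v v" using p by (simp add: field_simps power2_eq_square)
    finally show ?thesis using p by (simp add: field_simps)
  qed
qed

lemma cauchy_schwarz: "u \<in> V \<Longrightarrow> v \<in> V \<Longrightarrow> \<bar>B u v\<bar> \<le> sqrt (B u u) * sqrt (B v v)"
  using real_sqrt_le_mono[OF cauchy_schwarz_sq[of u v]] by (simp add: real_sqrt_mult)

lemma triangle: assumes u: "u \<in> V" and v: "v \<in> V"
  shows "sqrt (quad B (\<lambda>x. u x + v x)) \<le> sqrt (B u u) + sqrt (B v v)"
proof (rule real_le_lsqrt)
  have "quad B (\<lambda>x. u x + v x) = B u u + 2 * B u v + B v v"
    by (rule form_add_add[OF u v])
  also have "\<dots> \<le> (sqrt (B u u) + sqrt (B v v))\<^sup>2"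
    using cauchy_schwarz[OF u v] form_nonneg u v by (simp add: power2_sum)
  finally show "quad B (\<lambda>x. u x + v x) \<le> (sqrt (B u u) + sqrt (B v v))\<^sup>2" .
qed (use form_nonneg u v in auto)

lemma triangle_diff: assumes u: "u \<in> V" and v: "v \<in> V"
  shows "sqrt (quad B (\<lambda>x. u x - v x)) \<le> sqrt (B u u) + sqrt (B v v)"
proof (rule real_le_lsqrt)
  have "quad B (\<lambda>x. u x - v x) = B u u - 2 * B u v + B v v"
    by (rule form_diff_diff[OF u v])
  also have "\<dots> \<le> (sqrt (B u u) + sqrt (B v v))\<^sup>2"
    using cauchy_schwarz[OF u v] form_nonneg u v by (simp add: power2_sum)
  finally show "quad B (\<lambda>x. u x - v x) \<le> (sqrt (B u u) + sqrt (B v v))\<^sup>2" .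
qed (use form_nonneg u v in auto)

lemma parallelogram:
  assumes u: "u \<in> V" and v: "v \<in> V"
  shows "quad B (\<lambda>x. u x - v x) \<le> 2 * B u u + 2 * B v v"
  using form_nonneg[OF add_mem[OF u v]] unfolding form_diff_diff[OF u v] form_add_add[OF u v] by linarith

lemma tendsto_form:
  assumes X: "\<And>n. X n \<in> V" and u: "u \<in> V" and w: "w \<in> V"
    and lim: "(\<lambda>n. quad B (\<lambda>x. X n x - u x)) \<longlonglongrightarrow> 0"
  shows "(\<lambda>n. B (X n) w) \<longlonglongrightarrow> B u w"
proof -
  have "(\<lambda>n. B (X n) w - B u w) \<longlonglongrightarrow> 0"
  proof (rule Lim_null_comparison)
    have "norm (B (X n) w - B u w) \<le> sqrt (quad B (\<lambda>x. X n x - u x)) * sqrt (B w w)" for n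
      using cauchy_schwarz[OF diff_mem[OF X u] w, of n] unfolding form_diff[OF X u w] real_norm_def .
    then show "\<forall>\<^sub>F n in sequentially. norm (B (X n) w - B u w)
        \<le> sqrt (quad B (\<lambda>x. X n x - u x)) * sqrt (B w w)" by simp
    show "(\<lambda>n. sqrt (quad B (\<lambda>x. X n x - u x)) * sqrt (B w w)) \<longlonglongrightarrow> 0"
      using tendsto_mult_right[OF tendsto_real_sqrt[OF lim], of "sqrt (B w w)"] by simp
  qed
  then show ?thesis by (simp add: LIM_zero_iff)
qed

end

text \<open>Distances are measured by the quadratic form itself, without the square root. The limit
  is determined only up to elements on which the form vanishes.\<close>

definition complete_form :: "('x \<Rightarrow> real) set \<Rightarrow> (('x \<Rightarrow> real) \<Rightarrow> ('x \<Rightarrow> real) \<Rightarrow> real) \<Rightarrow> bool" where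
  "complete_form V B \<longleftrightarrow> (\<forall>X::nat \<Rightarrow> _. (\<forall>n. X n \<in> V) \<longrightarrow>
     (\<forall>e>0. \<exists>N. \<forall>m\<ge>N. \<forall>n\<ge>N. quad B (\<lambda>x. X m x - X n x) < e) \<longrightarrow>
     (\<exists>u\<in>V. (\<lambda>n. quad B (\<lambda>x. X n x - u x)) \<longlonglongrightarrow> 0))"

definition bounded_functional ::
  "('x \<Rightarrow> real) set \<Rightarrow> (('x \<Rightarrow> real) \<Rightarrow> ('x \<Rightarrow> real) \<Rightarrow> real) \<Rightarrow> (('x \<Rightarrow> real) \<Rightarrow> real) \<Rightarrow> bool" where
  "bounded_functional V B L \<longleftrightarrow>
     (\<forall>u\<in>V. \<forall>v\<in>V. L (\<lambda>x. u x + v x) = L u + L v) \<and>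
     (\<forall>u\<in>V. \<forall>c. L (\<lambda>x. c * u x) = c * L u) \<and>
     (\<exists>C. \<forall>u\<in>V. \<bar>L u\<bar> \<le> C * sqrt (B u u))"

lemma complete_formD:
  assumes "complete_form V B" and "\<And>n::nat. X n \<in> V"
    and "\<And>e. e > 0 \<Longrightarrow> \<exists>N. \<forall>m\<ge>N. \<forall>n\<ge>N. quad B (\<lambda>x. X m x - X n x) < e"
  obtains u where "u \<in> V" "(\<lambda>n. quad B (\<lambda>x. X n x - u x)) \<longlonglongrightarrow> 0"
  using assms unfolding complete_form_def by blast

context semi_inner
begin

text \<open>Direct method: the energy \<open>B u u - 2 * L u\<close> is bounded below, a minimising
  sequence is Cauchy, and its limit satisfies the Euler-Lagrange equation
  \<open>B w v = L v\<close>.\<close>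

theorem riesz:
  assumes complete: "complete_form V B" and L: "bounded_functional V B L"
  shows "\<exists>w\<in>V. \<forall>v\<in>V. B w v = L v"
proof -
  have L_add: "\<And>u v. u \<in> V \<Longrightarrow> v \<in> V \<Longrightarrow> L (\<lambda>x. u x + v x) = L u + L v"
    and L_scale: "\<And>u c. u \<in> V \<Longrightarrow> L (\<lambda>x. c * u x) = c * L u"
    using L by (auto simp: bounded_functional_def)
  obtain C where C: "\<And>u. u \<in> V \<Longrightarrow> \<bar>L u\<bar> \<le> C * sqrt (B u u)"
    using L unfolding bounded_functional_def by blast
  define J where "J u = B u u - 2 * L u" for u
  define d where "d = Inf (J ` V)"
  have bdd: "bdd_below (J ` V)"
  proof (rule bdd_belowI2)
    fix u assume u: "u \<in> V"
    have "0 \<le> (sqrt (B u u) - C)\<^sup>2" by simp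
    then have "2 * (C * sqrt (B u u)) \<le> B u u + C\<^sup>2"
      using form_nonneg[OF u] by (simp add: power2_diff algebra_simps)
    with C[OF u] show "- C\<^sup>2 \<le> J u" unfolding J_def by linarith
  qed
  have d_le: "d \<le> J u" if "u \<in> V" for u
    unfolding d_def using bdd that by (intro cINF_lower) auto
  have "\<exists>u\<in>V. J u < d + 1 / (real n + 1)" for n
    using cINF_less_iff[OF _ bdd, of "d + 1 / (real n + 1)"] zero_mem unfolding d_def by auto
  then obtain X where X: "\<And>n. X n \<in> V" and JX: "\<And>n. J (X n) < d + 1 / (real n + 1)" by metis
  have Jq: "J (\<lambda>x. u x + t * v x) = J u + 2 * t * (B u v - L v) + t\<^sup>2 * B v v" if "u \<in> V" "v \<in> V" for u v t
    unfolding J_def form_quad[OF that] L_add[OF that(1) scale_mem[OF that(2)]] L_scale[OF that(2)]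
    by (simp add: algebra_simps)
  \<comment> \<open>The energy of \<open>X n\<close> exceeds the infimum by at most
    \<open>1 / (n + 1)\<close>. So the quadratic in \<open>t\<close> with this constant term is
    nonnegative, and its discriminant bounds the first variation at \<open>X n\<close>.\<close>
  have res: "(B (X n) v - L v)\<^sup>2 \<le> B v v / (real n + 1)" if v: "v \<in> V" for n v
  proof -
    define e where "e = 1 / (real n + 1)"
    have e: "e > 0" by (simp add: e_def)
    have q: "0 \<le> e + 2 * t * (B (X n) v - L v) + t\<^sup>2 * B v v" for t
      using d_le[OF add_mem[OF X scale_mem[OF v]], of n t] Jq[OF X v, of n t] JX[of n] by (simp add: e_def)
    define b where "b = B (X n) v - L v"
    define a where "a = B v v"
    have qq: "0 \<le> e + 2 * t * b + t\<^sup>2 * a" for t using q by (simp add: a_def b_def)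
    have a: "a \<ge> 0" using form_nonneg[OF v] by (simp add: a_def)
    have "b\<^sup>2 \<le> a * e"
    proof (cases "a = 0")
      case True
      have "b = 0"
      proof (rule ccontr)
        assume n: "b \<noteq> 0"
        have "2 * (- e / b) * b = - 2 * e" using n by simp
        with qq[of "- e / b"] True e show False by simp
      qed
      with True show ?thesis by simp
    next
      case False
      have "0 \<le> e + 2 * (- b / a) * b + (- b / a)\<^sup>2 * a" by (rule qq)
      also have "\<dots> = e - b\<^sup>2 / a" using False by (simp add: field_simps power2_eq_square)
      finally show ?thesis using False a by (simp add: field_simps)
    qed
    then show ?thesis by (simp add: a_def b_def e_def)
  qed
  \<comment> \<open>The midpoint of \<open>X m\<close> and \<open>X n\<close> has energy at least
    \<open>d\<close>, and both ends are nearly minimal, so the parallelogram law leaves only the two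
    defects.\<close>
  have par: "quad B (\<lambda>x. X m x - X n x) \<le> 2 / (real m + 1) + 2 / (real n + 1)" for m n
  proof -
    have mid: "(\<lambda>x. (1/2) * (X m x + X n x)) \<in> V" using X add_mem scale_mem by blast
    have "quad B (\<lambda>x. X m x - X n x) =
      2 * J (X m) + 2 * J (X n) - 4 * J (\<lambda>x. (1/2) * (X m x + X n x))"
      unfolding J_def form_diff_diff[OF X X] form_scale[OF add_mem[OF X X] mid]
        form_scale2[OF add_mem[OF X X] add_mem[OF X X]] form_add_add[OF X X]
        L_scale[OF add_mem[OF X X]] L_add[OF X X]
      by (simp add: algebra_simps)
    with d_le[OF mid] JX[of m] JX[of n] show ?thesis by simp
  qed
  have "\<exists>N. \<forall>m\<ge>N. \<forall>n\<ge>N. quad B (\<lambda>x. X m x - X n x) < e" if e: "e > 0" for e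
  proof -
    obtain N where N: "inverse (real (Suc N)) < e / 4" using reals_Archimedean[of "e/4"] e by auto
    have "quad B (\<lambda>x. X m x - X n x) < e" if "m \<ge> N" "n \<ge> N" for m n
    proof -
      have "2 / (real m + 1) \<le> 2 * inverse (real (Suc N))" "2 / (real n + 1) \<le> 2 * inverse (real (Suc N))"
        using that by (auto simp: field_simps)
      with par[of m n] N show ?thesis by linarith
    qed
    then show ?thesis by blast
  qed
  then obtain w where w: "w \<in> V" and lim: "(\<lambda>n. quad B (\<lambda>x. X n x - w x)) \<longlonglongrightarrow> 0"
    by (rule complete_formD[of V B X, OF complete X])
  have "B w v = L v" if v: "v \<in> V" for v
  proof -
    have "(\<lambda>n. 1 / (real n + 1)) \<longlonglongrightarrow> 0" by real_asymp
    from tendsto_mult_left[OF this, of "B v v"] have "(\<lambda>n. B v v / (real n + 1)) \<longlonglongrightarrow> 0" by simp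
    then have "(\<lambda>n. (B (X n) v - L v)\<^sup>2) \<longlonglongrightarrow> 0"
      by (rule Lim_null_comparison[rotated]) (use res[OF v] in auto)
    from tendsto_real_sqrt[OF this] have "(\<lambda>n. B (X n) v - L v) \<longlonglongrightarrow> 0"
      by (simp add: tendsto_rabs_zero_iff)
    then have "(\<lambda>n. B (X n) v) \<longlonglongrightarrow> L v" by (simp add: LIM_zero_iff)
    with tendsto_form[OF X w v lim] show ?thesis using LIMSEQ_unique by blast
  qed
  with w show ?thesis by blast
qed

text \<open>By Riesz, \<open>A\<close> is represented by an operator \<open>T\<close> with
  \<open>B (T u) v = A u v\<close>. The Garding inequality, compactness and injectivity make
  \<open>T\<close> bounded below, and the symmetry of \<open>A\<close> then makes it onto. No
  spectral theory of compact operators is involved; \<open>q\<close> stands for the weaker quadratic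
  quantity in which bounded sequences have Cauchy subsequences.\<close>

theorem fredholm_alternative:
  assumes complete: "complete_form V B"
    and A: "sym_form V A"
    and A_bound: "\<And>u v. u \<in> V \<Longrightarrow> v \<in> V \<Longrightarrow> \<bar>A u v\<bar> \<le> M * sqrt (B u u) * sqrt (B v v)"
    and garding: "c > 0" "K \<ge> 0" "\<And>u. u \<in> V \<Longrightarrow> c * B u u \<le> A u u + K * q u"
    and compact: "\<And>X::nat \<Rightarrow> _. (\<And>n. X n \<in> V) \<Longrightarrow> (\<And>n. quad B (X n) \<le> 1) \<Longrightarrow>
        \<exists>r::nat \<Rightarrow> nat. strict_mono r \<and> (\<forall>e>0. \<exists>N. \<forall>m\<ge>N. \<forall>n\<ge>N. q (\<lambda>x. X (r m) x - X (r n) x) < e)"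
    and injective: "\<And>u. u \<in> V \<Longrightarrow> (\<And>v. v \<in> V \<Longrightarrow> A u v = 0) \<Longrightarrow> B u u = 0"
    and F: "bounded_functional V B F"
  shows "\<exists>w\<in>V. \<forall>v\<in>V. A w v = F v"
proof -
  interpret A: sym_form V A by (rule A)
  have "\<exists>w\<in>V. \<forall>v\<in>V. B w v = A u v" if u: "u \<in> V" for u
  proof (rule riesz[OF complete])
    show "bounded_functional V B (A u)" unfolding bounded_functional_def
      using A.form_add2 A.form_scale2 A_bound u by blast
  qed
  then obtain T where T: "\<And>u. u \<in> V \<Longrightarrow> T u \<in> V" and BT: "\<And>u v. u \<in> V \<Longrightarrow> v \<in> V \<Longrightarrow> B (T u) v = A u v"
    by metis
  have T_bound: "quad B (T u) \<le> M\<^sup>2 * B u u" if u: "u \<in> V" for u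
  proof -
    define a where "a = sqrt (quad B (T u))"
    define m where "m = M * sqrt (B u u)"
    have a: "a \<ge> 0" "a * a = quad B (T u)" using form_nonneg[OF T[OF u]] by (auto simp: a_def)
    have "a * a \<le> m * a"
      using A_bound[OF u T[OF u]] BT[OF u T[OF u]] unfolding a(2) by (simp add: a_def m_def)
    then have "a \<le> \<bar>m\<bar>"
      using a(1) by (cases "a = 0") (auto intro: order_trans[OF mult_right_le_imp_le[of a a m] abs_ge_self])
    then have "a * a \<le> \<bar>m\<bar> * \<bar>m\<bar>" using a(1) by (intro mult_mono) auto
    also have "\<bar>m\<bar> * \<bar>m\<bar> = M\<^sup>2 * B u u"
      using form_nonneg[OF u] by (simp add: m_def power2_eq_square abs_mult_self_eq mult_ac)
    finally show ?thesis by (simp add: a(2))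
  qed
  \<comment> \<open>Otherwise there are elements \<open>X n\<close> of form 1 with
    \<open>T (X n)\<close> tending to 0. A subsequence is Cauchy for \<open>q\<close>, hence for
    \<open>B\<close> by the Garding inequality; its limit is annihilated by \<open>A\<close> and
    would still have form 1.\<close>
  have "\<exists>\<delta>>0. \<forall>u\<in>V. \<delta> * B u u \<le> quad B (T u)"
  proof (rule ccontr)
    assume neg: "\<not> ?thesis"
    have "\<exists>u\<in>V. quad B (T u) < 1 / (real n + 1) * B u u" for n
    proof -
      have "1 / (real n + 1) > 0" by simp
      with neg have "\<not> (\<forall>u\<in>V. 1 / (real n + 1) * B u u \<le> quad B (T u))" by blast
      then show ?thesis by (simp add: not_le)
    qed
    then obtain u where u: "\<And>n. u n \<in> V" and Bu: "\<And>n. quad B (T (u n)) < 1 / (real n + 1) * quad B (u n)"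
      by metis
    have pos: "quad B (u n) > 0" for n
    proof -
      have "0 < 1 / (real n + 1) * quad B (u n)" using form_nonneg[OF T[OF u]] Bu[of n] by (meson le_less_trans)
      then show ?thesis by (simp add: zero_less_mult_iff zero_less_divide_iff)
    qed
    define X where "X n = (\<lambda>x. (1 / sqrt (quad B (u n))) * u n x)" for n
    have X: "X n \<in> V" for n unfolding X_def by (intro scale_mem u)
    have X1: "quad B (X n) = 1" for n
    proof -
      have "quad B (X n) = (1 / sqrt (quad B (u n))) * ((1 / sqrt (quad B (u n))) * quad B (u n))"
        unfolding X_def by (simp only: form_scale[OF u scale_mem[OF u]] form_scale2[OF u u])
      also have "\<dots> = quad B (u n) / (sqrt (quad B (u n)) * sqrt (quad B (u n)))" by simp
      also have "\<dots> = 1" using pos[of n] by (subst real_sqrt_mult_self) simp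
      finally show ?thesis .
    qed
    have AX: "\<bar>A (X n) v\<bar> \<le> sqrt (1 / (real n + 1)) * sqrt (B v v)" if v: "v \<in> V" for n v
    proof -
      have "(A (u n) v)\<^sup>2 \<le> quad B (T (u n)) * B v v"
        using cauchy_schwarz_sq[OF T[OF u] v, of n] BT[OF u v] by simp
      also have "\<dots> \<le> 1 / (real n + 1) * quad B (u n) * B v v"
        using Bu[of n] form_nonneg[OF v] by (intro mult_right_mono) auto
      finally have 1: "(A (u n) v)\<^sup>2 \<le> 1 / (real n + 1) * quad B (u n) * B v v" .
      have "(A (X n) v)\<^sup>2 = (A (u n) v)\<^sup>2 / quad B (u n)"
        unfolding X_def A.form_scale[OF u v] using pos[of n] by (simp add: power_mult_distrib power_divide)
      also have "\<dots> \<le> 1 / (real n + 1) * B v v" using 1 pos[of n] by (simp add: field_simps)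
      finally have "sqrt ((A (X n) v)\<^sup>2) \<le> sqrt (1 / (real n + 1) * B v v)" by (rule real_sqrt_le_mono)
      then show ?thesis by (simp add: real_sqrt_mult[symmetric])
    qed
    have "quad B (X n) \<le> 1" for n by (simp add: X1)
    from compact[of X, OF X this] obtain r :: "nat \<Rightarrow> nat" where
      rq: "strict_mono r \<and> (\<forall>e>0. \<exists>N. \<forall>m\<ge>N. \<forall>n\<ge>N. q (\<lambda>x. X (r m) x - X (r n) x) < e)" ..
    note r = conjunct1[OF rq] and qC = conjunct2[OF rq]
    define Y where "Y n = X (r n)" for n
    have Y: "Y n \<in> V" "quad B (Y n) = 1" for n by (auto simp: Y_def X X1)
    have AY: "\<bar>A (Y n) v\<bar> \<le> sqrt (1 / (real n + 1)) * sqrt (B v v)" if v: "v \<in> V" for n v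
    proof -
      have "\<bar>A (Y n) v\<bar> \<le> sqrt (1 / (real (r n) + 1)) * sqrt (B v v)" unfolding Y_def by (rule AX[OF v])
      also have "\<dots> \<le> sqrt (1 / (real n + 1)) * sqrt (B v v)"
        using seq_suble[OF r, of n] form_nonneg[OF v]
        by (intro mult_right_mono real_sqrt_le_mono divide_left_mono) auto
      finally show ?thesis .
    qed
    have "\<exists>N. \<forall>m\<ge>N. \<forall>n\<ge>N. quad B (\<lambda>x. Y m x - Y n x) < e" if e: "e > 0" for e
    proof -
      have "(\<lambda>n. sqrt (1 / (real n + 1))) \<longlonglongrightarrow> 0" by real_asymp
      moreover have "c * e / 8 > 0" using e garding by simp
      ultimately obtain N1 where N1: "\<And>n. n \<ge> N1 \<Longrightarrow> sqrt (1 / (real n + 1)) < c * e / 8"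
        unfolding LIMSEQ_iff real_norm_def by (metis abs_less_iff diff_zero)
      \<comment> \<open>The denominator has \<open>K + 1\<close> and not \<open>K\<close> because
        \<open>K = 0\<close> is allowed.\<close>
      obtain N2 where N2: "\<And>m n. m \<ge> N2 \<Longrightarrow> n \<ge> N2 \<Longrightarrow> q (\<lambda>x. Y m x - Y n x) < c * e / (2 * (K + 1))"
      proof -
        have "c * e / (2 * (K + 1)) > 0" using e garding by (intro divide_pos_pos) auto
        with qC show thesis using that unfolding Y_def by meson
      qed
      have "quad B (\<lambda>x. Y m x - Y n x) < e" if mn: "m \<ge> max N1 N2" "n \<ge> max N1 N2" for m n
      proof -
        let ?d = "\<lambda>x. Y m x - Y n x"
        have d: "?d \<in> V" using Y diff_mem by blast
        have "B ?d ?d \<le> 4" using parallelogram[OF Y(1) Y(1), of m n] Y by simp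
        then have s2: "sqrt (B ?d ?d) \<le> 2" by (intro real_le_lsqrt) auto
        \<comment> \<open>Both \<open>A (Y m)\<close> and \<open>A (Y n)\<close> are small as
          functionals, and \<open>?d\<close> has form at most 4, so \<open>A ?d ?d\<close> is small
          whatever the distance of \<open>Y m\<close> and \<open>Y n\<close>.\<close>
        have "A ?d ?d = A (Y m) ?d - A (Y n) ?d" by (rule A.form_diff[OF Y(1) Y(1) d])
        also have "\<dots> \<le> sqrt (1 / (real m + 1)) * sqrt (B ?d ?d) + sqrt (1 / (real n + 1)) * sqrt (B ?d ?d)"
          using AY[OF d, of m] AY[OF d, of n] by linarith
        also have "\<dots> \<le> sqrt (1 / (real m + 1)) * 2 + sqrt (1 / (real n + 1)) * 2"
          using s2 by (intro add_mono mult_left_mono) auto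
        also have "\<dots> < c * e / 2" using N1[of m] N1[of n] mn by simp
        finally have 1: "A ?d ?d < c * e / 2" .
        have "K * q ?d \<le> K * (c * e / (2 * (K + 1)))" using N2[of m n] mn garding by (intro mult_left_mono) auto
        also have "\<dots> \<le> c * e / 2" using garding e by (simp add: field_simps)
        finally have "c * B ?d ?d < c * e" using 1 garding(3)[OF d] by linarith
        then show ?thesis using garding by simp
      qed
      then show ?thesis by blast
    qed
    then obtain w where w: "w \<in> V" and lim: "(\<lambda>n. quad B (\<lambda>x. Y n x - w x)) \<longlonglongrightarrow> 0"
      by (rule complete_formD[of V B Y, OF complete Y(1)])
    have lw: "(\<lambda>n. B (Y n) v) \<longlonglongrightarrow> B w v" if "v \<in> V" for v by (rule tendsto_form[OF Y(1) w that lim])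
    \<comment> \<open>Symmetry of \<open>A\<close> moves \<open>T\<close> to the fixed argument,
      \<open>A y v = B y (T v)\<close>, where convergence of \<open>Y n\<close> in the form
      \<open>B\<close> can be used.\<close>
    have "A w v = 0" if v: "v \<in> V" for v
    proof -
      have "(\<lambda>n. A (Y n) v) \<longlonglongrightarrow> 0"
      proof (rule Lim_null_comparison)
        show "\<forall>\<^sub>F n in sequentially. norm (A (Y n) v) \<le> sqrt (1 / (real n + 1)) * sqrt (B v v)"
          using AY[OF v] by simp
        have "(\<lambda>n. sqrt (1 / (real n + 1))) \<longlonglongrightarrow> 0" by real_asymp
        from tendsto_mult_right[OF this, of "sqrt (B v v)"]
        show "(\<lambda>n. sqrt (1 / (real n + 1)) * sqrt (B v v)) \<longlonglongrightarrow> 0" by simp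
      qed
      moreover have "(\<lambda>n. B (Y n) (T v)) \<longlonglongrightarrow> B w (T v)" by (rule lw[OF T[OF v]])
      moreover have "B y (T v) = A y v" if "y \<in> V" for y
        using BT[OF v that] form_sym[OF that T[OF v]] A.form_sym[OF that v] by simp
      ultimately show ?thesis using Y(1) w LIMSEQ_unique by fastforce
    qed
    then have "B w w = 0" using injective w by blast
    \<comment> \<open>With \<open>B w w = 0\<close> this limit is 1, while \<open>w\<close> was
      chosen so that it is 0.\<close>
    moreover have "(\<lambda>n. quad B (\<lambda>x. Y n x - w x)) \<longlonglongrightarrow> 1 - 2 * B w w + B w w"
    proof -
      have "(\<lambda>n. 1 - 2 * B (Y n) w + B w w) \<longlonglongrightarrow> 1 - 2 * B w w + B w w" by (intro tendsto_intros lw w)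
      moreover have "quad B (\<lambda>x. Y n x - w x) = 1 - 2 * B (Y n) w + B w w" for n
        unfolding form_diff_diff[OF Y(1) w] Y(2) ..
      ultimately show ?thesis by simp
    qed
    ultimately show False using lim LIMSEQ_unique by fastforce
  qed
  then obtain \<delta> where \<delta>: "\<delta> > 0" "\<And>u. u \<in> V \<Longrightarrow> \<delta> * B u u \<le> quad B (T u)" by blast
  \<comment> \<open>\<open>D\<close> is an inner product equivalent to \<open>B\<close>; Riesz for \<open>D\<close> inverts \<open>T\<close>, as \<open>D w v = B f (T v)\<close> means \<open>A (T w - f) v = 0\<close>.\<close>
  define D where "D u v = A u (T v)" for u v
  have D_eq: "D u v = B (T u) (T v)" if "u \<in> V" "v \<in> V" for u v
    unfolding D_def using BT[OF that(1) T[OF that(2)]] by simp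
  interpret D: semi_inner V D
  proof
    fix u v assume "u \<in> V" "v \<in> V" then show "D u v = D v u" by (simp add: D_eq form_sym T)
  next
    fix u assume "u \<in> V" then show "0 \<le> D u u" by (simp add: D_eq form_nonneg T)
  qed (auto simp: D_def A.form_add A.form_scale T zero_mem add_mem scale_mem)
  have "complete_form V D" unfolding complete_form_def
  proof (intro allI impI)
    fix X :: "nat \<Rightarrow> _"
    assume X: "\<forall>n. X n \<in> V"
      and C: "\<forall>e>0. \<exists>N. \<forall>m\<ge>N. \<forall>n\<ge>N. quad D (\<lambda>x. X m x - X n x) < e"
    have "\<exists>N. \<forall>m\<ge>N. \<forall>n\<ge>N. quad B (\<lambda>x. X m x - X n x) < e" if e: "e > 0" for e
    proof -
      obtain N where N: "\<And>m n. m \<ge> N \<Longrightarrow> n \<ge> N \<Longrightarrow> quad D (\<lambda>x. X m x - X n x) < \<delta> * e"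
        using C e \<delta> by (meson mult_pos_pos)
      have "quad B (\<lambda>x. X m x - X n x) < e" if "m \<ge> N" "n \<ge> N" for m n
      proof -
        have d: "(\<lambda>x. X m x - X n x) \<in> V" using X diff_mem by blast
        have "\<delta> * quad B (\<lambda>x. X m x - X n x) < \<delta> * e"
          using \<delta>(2)[OF d] N[OF that] D_eq[OF d d] by simp
        then show ?thesis using \<delta> by simp
      qed
      then show ?thesis by blast
    qed
    then obtain w where w: "w \<in> V" and lim: "(\<lambda>n. quad B (\<lambda>x. X n x - w x)) \<longlonglongrightarrow> 0"
      by (rule complete_formD[of V B X, OF complete X[rule_format]])
    have "(\<lambda>n. quad D (\<lambda>x. X n x - w x)) \<longlonglongrightarrow> 0"
    proof (rule Lim_null_comparison)
      show "(\<lambda>n. M\<^sup>2 * quad B (\<lambda>x. X n x - w x)) \<longlonglongrightarrow> 0"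
        using tendsto_mult_left[OF lim, of "M\<^sup>2"] by simp
      have "norm (quad D (\<lambda>x. X n x - w x)) \<le> M\<^sup>2 * quad B (\<lambda>x. X n x - w x)" for n
      proof -
        have d: "(\<lambda>x. X n x - w x) \<in> V" using X w diff_mem by blast
        show ?thesis unfolding D_eq[OF d d] using T_bound[OF d] form_nonneg[OF T[OF d]] by simp
      qed
      then show "\<forall>\<^sub>F n in sequentially. norm (quad D (\<lambda>x. X n x - w x))
           \<le> M\<^sup>2 * quad B (\<lambda>x. X n x - w x)" by simp
    qed
    with w show "\<exists>u\<in>V. (\<lambda>n. quad D (\<lambda>x. X n x - u x)) \<longlonglongrightarrow> 0" by blast
  qed
  obtain f where f: "f \<in> V" "\<And>v. v \<in> V \<Longrightarrow> B f v = F v" using riesz[OF complete F] by blast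
  have "bounded_functional V D (\<lambda>v. A v f)" unfolding bounded_functional_def
  proof (intro conjI ballI allI exI)
    fix u assume u: "u \<in> V"
    have "\<bar>A u f\<bar> = \<bar>B (T u) f\<bar>" using BT[OF u f(1)] by simp
    also have "\<dots> \<le> sqrt (B f f) * sqrt (D u u)"
      using cauchy_schwarz[OF T[OF u] f(1)] D_eq[OF u u] by (simp add: mult.commute)
    finally show "\<bar>A u f\<bar> \<le> sqrt (B f f) * sqrt (D u u)" .
  qed (auto simp: A.form_add A.form_scale f)
  then obtain w where w: "w \<in> V" "\<And>v. v \<in> V \<Longrightarrow> D w v = A v f"
    using D.riesz \<open>complete_form V D\<close> by blast
  define g where "g = (\<lambda>x. T w x - f x)"
  have g: "g \<in> V" unfolding g_def using T w f diff_mem by blast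
  have "A g v = 0" if v: "v \<in> V" for v
  proof -
    have "A g v = A v (T w) - A v f" unfolding g_def
      using A.form_sym[OF v diff_mem[OF T[OF w(1)] f(1)]] A.form_diff2[OF T[OF w(1)] f(1) v] by simp
    also have "A v (T w) = D w v" using D.form_sym[OF w(1) v] by (simp add: D_def)
    finally show ?thesis using w v by simp
  qed
  then have g0: "B g g = 0" using injective g by blast
  have "A w v = F v" if v: "v \<in> V" for v
  proof -
    \<comment> \<open>\<open>g\<close> need not be the zero function, but an element of form 0 is
      orthogonal to everything, which is all that is needed.\<close>
    have "B g v = 0" using cauchy_schwarz_sq[OF g v] g0 by simp
    then have "B (T w) v = B f v" unfolding g_def form_diff[OF T[OF w(1)] f(1) v] by simp
    then show ?thesis using BT[OF w(1) v] f(2)[OF v] by simp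
  qed
  with w show ?thesis by blast
qed

end

section \<open>Integrability of powers of the norm\<close>

text \<open>\<open>f\<close> is dominated by the sum over \<open>k\<close> of \<open>a k\<close>
  times the indicator of the ball of radius \<open>R k\<close>. Each point needs to be served by one
  ball only, so the balls may overlap and no polar coordinates occur.\<close>

lemma integrable_dyadic:
  fixes f :: "'a::euclidean_space \<Rightarrow> real"
  assumes [measurable]: "f \<in> borel_measurable borel" and nonneg: "\<And>w. 0 \<le> f w"
    and a: "\<And>k::nat. 0 \<le> a k" and R: "\<And>k. 0 \<le> R k"
    and sum: "summable (\<lambda>k. a k * R k ^ DIM('a))"
    and bound: "\<And>w. f w \<noteq> 0 \<Longrightarrow> \<exists>k. norm w < R k \<and> f w \<le> a k"
  shows "integrable lborel f"
proof (rule integrableI_nonneg)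
  have [measurable]: "ball (0::'a) c \<in> sets borel" for c by (rule borel_open) simp
  have le: "ennreal (f w) \<le> (\<Sum>k. ennreal (a k) * indicator (ball 0 (R k)) w)" for w
  proof (cases "f w = 0")
    case False
    then obtain k where k: "norm w < R k" "f w \<le> a k" using bound by blast
    have "ennreal (f w) \<le> ennreal (a k) * indicator (ball 0 (R k)) w"
      using k a by (simp add: ennreal_leI)
    also have "\<dots> = (\<Sum>j\<in>{k}. ennreal (a j) * indicator (ball 0 (R j)) w)"
      by (simp only: sum.insert[OF finite.emptyI] sum.empty empty_iff not_False_eq_True add_0_right)
    also have "\<dots> \<le> (\<Sum>k. ennreal (a k) * indicator (ball 0 (R k)) w)"
      by (intro sum_le_suminf) auto
    finally show ?thesis .
  qed simp
  have "(\<integral>\<^sup>+w. ennreal (f w) \<partial>lborel) \<le> (\<integral>\<^sup>+w. (\<Sum>k. ennreal (a k) * indicator (ball 0 (R k)) (w::'a)) \<partial>lborel)"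
    by (intro nn_integral_mono le)
  also have "\<dots> = (\<Sum>k. \<integral>\<^sup>+w. ennreal (a k) * indicator (ball 0 (R k) :: 'a set) w \<partial>lborel)"
    by (intro nn_integral_suminf) measurable
  also have "\<dots> = (\<Sum>k. ennreal (unit_ball_vol (real DIM('a)) * (a k * R k ^ DIM('a))))"
  proof (intro suminf_cong)
    fix k
    have "(\<integral>\<^sup>+w. ennreal (a k) * indicator (ball 0 (R k) :: 'a set) w \<partial>lborel) = ennreal (a k) * emeasure lborel (ball (0::'a) (R k))"
      by (simp add: nn_integral_cmult_indicator)
    also have "\<dots> = ennreal (a k) * ennreal (unit_ball_vol (real DIM('a)) * R k ^ DIM('a))"
      using R[of k] by (simp add: emeasure_ball)
    also have "\<dots> = ennreal (a k * (unit_ball_vol (real DIM('a)) * R k ^ DIM('a)))"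
      using a R by (simp add: ennreal_mult unit_ball_vol_nonneg)
    finally show "(\<integral>\<^sup>+w. ennreal (a k) * indicator (ball 0 (R k) :: 'a set) w \<partial>lborel)
       = ennreal (unit_ball_vol (real DIM('a)) * (a k * R k ^ DIM('a)))" by (simp add: mult_ac)
  qed
  also have "\<dots> = ennreal (\<Sum>k. unit_ball_vol (real DIM('a)) * (a k * R k ^ DIM('a)))"
    using a R by (intro suminf_ennreal2 summable_mult sum mult_nonneg_nonneg unit_ball_vol_nonneg) auto
  also have "\<dots> < \<infinity>" by simp
  finally show "(\<integral>\<^sup>+w. ennreal (f w) \<partial>lborel) < \<infinity>" .
qed (use nonneg in auto)

lemma dyadic_bracket:
  fixes x :: real assumes "1 \<le> x" shows "\<exists>k::nat. 2 ^ k \<le> x \<and> x < 2 ^ (k + 1)"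
proof -
  obtain m :: nat where "x < 2 ^ m" using real_arch_pow[of 2 x] by auto
  then show ?thesis
  proof (induction m)
    case (Suc m) then show ?case by (cases "x < 2 ^ m") (auto simp: not_less)
  qed (use assms in auto)
qed

lemma powr_two_power: "(2 ^ k) powr (q::real) = (2 powr q) ^ k"
  by (simp add: powr_realpow[symmetric] powr_powr powr_power mult.commute)

text \<open>On the shell where \<open>|w| / r\<close> lies between \<open>2^k\<close> and
  \<open>2^(k+1)\<close> the integrand is at most \<open>(2^k * r) powr (-q)\<close>. The resulting
  series is geometric with ratio \<open>2 powr (n - q)\<close>, where \<open>n\<close> is the
  dimension.\<close>

lemma integrable_powr_tail:
  fixes q r :: real
  assumes q: "q > real DIM('a)" and r: "r > 0"
  shows "integrable lborel (\<lambda>w::'a::euclidean_space. indicator {w. r \<le> norm w} w * norm w powr (- q))"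
proof (rule integrable_dyadic[where a="\<lambda>k. (2 ^ k * r) powr (- q)" and R="\<lambda>k. 2 ^ (k + 1) * r"])
  let ?n = "DIM('a)"
  have "(2 ^ k * r) powr (- q) * (2 ^ (k + 1) * r) ^ ?n = r powr (- q) * (2 * r) ^ ?n * (2 powr (real ?n - q)) ^ k" for k
  proof -
    have "(2 ^ k * r) powr (- q) = r powr (- q) * (2 powr (- q)) ^ k"
      using r by (simp add: powr_mult powr_two_power)
    moreover have "(2 ^ (k + 1) * r) ^ ?n = (2 * r) ^ ?n * (2 powr real ?n) ^ k"
    proof -
      have "2 powr real ?n = 2 ^ ?n" by (simp add: powr_realpow)
      moreover have "(2 ^ (k + 1) * r) ^ ?n = (2 * r) ^ ?n * (2 ^ k) ^ ?n"
        by (simp add: power_mult_distrib)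
      moreover have "((2::real) ^ k) ^ ?n = (2 ^ ?n) ^ k" by (simp add: power_mult[symmetric] mult.commute)
      ultimately show ?thesis by simp
    qed
    moreover have "(2 powr (- q)) ^ k * (2 powr real ?n) ^ k = (2 powr (real ?n - q)) ^ k"
      by (simp add: power_mult_distrib[symmetric] powr_add[symmetric])
    ultimately show ?thesis by (simp add: mult_ac)
  qed
  moreover have "2 powr (real ?n - q) < 1" using q by (simp add: powr_less_one)
  ultimately show "summable (\<lambda>k. (2 ^ k * r) powr (- q) * (2 ^ (k + 1) * r) ^ ?n)"
    by (simp add: summable_mult summable_geometric)
  fix w :: 'a
  assume "indicator {w. r \<le> norm w} w * norm w powr (- q) \<noteq> 0"
  then have w: "r \<le> norm w" by (auto simp: indicator_def split: if_splits)
  then obtain k :: nat where k: "2 ^ k \<le> norm w / r" "norm w / r < 2 ^ (k + 1)"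
    using dyadic_bracket[of "norm w / r"] r by (auto simp: field_simps)
  have "norm w powr (- q) \<le> (2 ^ k * r) powr (- q)"
    using k r q by (intro powr_mono2') (auto simp: field_simps)
  then show "\<exists>k. norm w < 2 ^ (k + 1) * r \<and> indicator {w. r \<le> norm w} w * norm w powr - q \<le> (2 ^ k * r) powr - q"
    using k r w by (intro exI[of _ k]) (auto simp: field_simps)
qed (use r in auto)

text \<open>The shells now shrink to the origin and the ratio is \<open>2 powr (q - 2 - n)\<close>.
  The factor \<open>(norm w)\<^sup>2\<close> is the gain from the Lipschitz bound of a test
  function. The radii are \<open>2 / 2^k\<close>, twice the outer radius of the shell, because the
  dyadic lemma asks for a strict inequality.\<close>

lemma integrable_powr_near:
  fixes q :: real
  assumes q: "0 < q" "q < real DIM('a) + 2"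
  shows "integrable lborel (\<lambda>w::'a::euclidean_space. indicator (ball 0 1) w * ((norm w)\<^sup>2 * norm w powr (- q)))"
proof (rule integrable_dyadic[where a="\<lambda>k. (1 / 2 ^ k)\<^sup>2 * (1 / 2 ^ (k + 1)) powr (- q)" and R="\<lambda>k. 2 / 2 ^ k"])
  let ?n = "DIM('a)"
  have "((1 / 2 ^ k)\<^sup>2 * (1 / 2 ^ (k + 1)) powr (- q)) * (2 / 2 ^ k) ^ ?n
      = 2 powr q * 2 ^ ?n * (2 powr (q - 2 - real ?n)) ^ k" for k
  proof -
    have e: "(2::real) ^ m = 2 powr real m" for m by (simp add: powr_realpow)
    have "((1 / 2 ^ k)\<^sup>2 * (1 / 2 ^ (k + 1)) powr (- q)) * (2 / 2 ^ k) ^ ?n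
       = (2 powr (- 2 * real k) * 2 powr (q * (real k + 1))) * (2 powr ((1 - real k) * real ?n))"
    proof -
      have "(1 / 2 ^ k)\<^sup>2 = 2 powr (- 2 * real k)"
        by (simp add: e powr_minus_divide[symmetric] powr_power mult.commute)
      moreover have "(1 / 2 ^ (k + 1)) powr (- q) = 2 powr (q * (real k + 1))"
        unfolding e by (simp add: powr_minus_divide[symmetric] powr_powr algebra_simps)
      moreover have "(2 / 2 ^ k) ^ ?n = 2 powr ((1 - real k) * real ?n)"
      proof -
        have "(2::real) / 2 ^ k = 2 powr (1 - real k)" by (simp add: powr_diff e)
        then show ?thesis by (simp add: powr_power mult.commute)
      qed
      ultimately show ?thesis by simp
    qed
    also have "\<dots> = 2 powr (- 2 * real k + q * (real k + 1) + (1 - real k) * real ?n)"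
      by (simp only: powr_add)
    also have "\<dots> = 2 powr (q + real ?n + (q - 2 - real ?n) * real k)"
      by (rule arg_cong[where f="\<lambda>x. 2 powr x"]) (simp add: algebra_simps)
    also have "\<dots> = 2 powr q * 2 ^ ?n * (2 powr (q - 2 - real ?n)) ^ k"
      by (simp only: powr_add e powr_power) (simp add: mult.commute)
    finally show ?thesis .
  qed
  moreover have "2 powr (q - 2 - real ?n) < 1" using q by (simp add: powr_less_one)
  ultimately show "summable (\<lambda>k. ((1 / 2 ^ k)\<^sup>2 * (1 / 2 ^ (k + 1)) powr (- q)) * (2 / 2 ^ k) ^ ?n)"
    by (simp add: summable_mult summable_geometric)
  fix w :: 'a
  assume "indicator (ball 0 1) w * ((norm w)\<^sup>2 * norm w powr (- q)) \<noteq> 0"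
  then have w: "norm w < 1" "w \<noteq> 0" by (auto simp: indicator_def split: if_splits)
  then obtain k :: nat where k: "2 ^ k \<le> 1 / norm w" "1 / norm w < 2 ^ (k + 1)"
    using dyadic_bracket[of "1 / norm w"] by (auto simp: field_simps)
  have k': "norm w \<le> 1 / 2 ^ k" "1 / 2 ^ (k + 1) \<le> norm w" using k w by (auto simp: field_simps)
  have "norm w powr (- q) \<le> (1 / 2 ^ (k + 1)) powr (- q)"
    using k' q by (intro powr_mono2') auto
  moreover have "(norm w)\<^sup>2 \<le> (1 / 2 ^ k)\<^sup>2" using k' by (intro power_mono) auto
  ultimately have "(norm w)\<^sup>2 * norm w powr (- q) \<le> (1 / 2 ^ k)\<^sup>2 * (1 / 2 ^ (k + 1)) powr (- q)"
    by (intro mult_mono) auto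
  moreover have "norm w < 2 / 2 ^ k" using k'(1) w by (smt (verit) divide_strict_right_mono zero_less_power)
  ultimately show "\<exists>k. norm w < 2 / 2 ^ k \<and> indicator (ball 0 1) w * ((norm w)\<^sup>2 * norm w powr - q)
       \<le> (1 / 2 ^ k)\<^sup>2 * (1 / 2 ^ (k + 1)) powr - q"
    using w by (intro exI[of _ k]) auto
next
  have [measurable]: "ball (0::'a) 1 \<in> sets borel" by (rule borel_open) simp
  show "(\<lambda>w::'a. indicator (ball 0 1) w * ((norm w)\<^sup>2 * norm w powr - q)) \<in> borel_measurable borel"
    by measurable
qed auto

lemma nn_integral_lborel_reflect:
  fixes f :: "'a::euclidean_space \<Rightarrow> ennreal"
  assumes [measurable]: "f \<in> borel_measurable borel"
  shows "(\<integral>\<^sup>+y. f (x - y) \<partial>lborel) = (\<integral>\<^sup>+w. f w \<partial>lborel)"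
  by (subst (2) lborel_affine[of "-1" x]) (simp_all add: nn_integral_density nn_integral_distr)

lemma integrable_lborel_reflect:
  fixes f :: "'a::euclidean_space \<Rightarrow> real"
  assumes [measurable]: "f \<in> borel_measurable borel" and "integrable lborel f"
  shows "integrable lborel (\<lambda>y. f (x - y))"
  using assms(2) nn_integral_lborel_reflect[of "\<lambda>w. ennreal (norm (f w))" x]
  by (auto simp: integrable_iff_bounded)

section \<open>Smooth bump functions\<close>

text \<open>The powers of \<open>inverse t\<close> give a family closed under differentiation. The
  parameter \<open>c\<close> is kept free because the bumps tend to indicator functions as
  \<open>c\<close> tends to 0.\<close>

definition exp_recip :: "real \<Rightarrow> nat \<Rightarrow> real \<Rightarrow> real" where
  "exp_recip c k t = (if t > 0 then inverse t ^ k * exp (- c / t) else 0)"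

lemma exp_recip_deriv:
  assumes c: "c > 0"
  shows "(exp_recip c k has_real_derivative (c * exp_recip c (k + 2) t - real k * exp_recip c (k + 1) t)) (at t)"
proof -
  consider "t > 0" | "t < 0" | "t = 0" by linarith
  then show ?thesis
  proof cases
    case 1
    have "((\<lambda>t. inverse t ^ k * exp (- c / t)) has_real_derivative
        (c * exp_recip c (k + 2) t - real k * exp_recip c (k + 1) t)) (at t)"
      using 1 apply (auto intro!: derivative_eq_intros simp: exp_recip_def)
      by (cases k) (auto simp: field_simps power2_eq_square)
    moreover have "eventually (\<lambda>t. inverse t ^ k * exp (- c / t) = exp_recip c k t) (nhds t)"
      using eventually_nhds_in_open[of "{0<..}" t] 1 by (auto elim!: eventually_mono simp: exp_recip_def)
    ultimately show ?thesis by (subst DERIV_cong_ev[OF refl _ refl]) (auto elim: eventually_mono)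
  next
    case 2
    have "eventually (\<lambda>t. exp_recip c k t = 0) (nhds t)"
      using eventually_nhds_in_open[of "{..<0}" t] 2 by (auto elim!: eventually_mono simp: exp_recip_def)
    then have "(exp_recip c k has_real_derivative 0) (at t)"
      by (subst DERIV_cong_ev[OF refl _ refl]) auto
    then show ?thesis using 2 by (simp add: exp_recip_def)
  next
    case 3
    have "((\<lambda>h. exp_recip c k h / h) \<longlongrightarrow> 0) (at 0)"
    proof (rule filterlim_split_at)
      show "((\<lambda>h. exp_recip c k h / h) \<longlongrightarrow> 0) (at_left 0)"
        by (rule tendsto_eventually) (auto simp: eventually_at_filter exp_recip_def intro!: always_eventually)
      have "((\<lambda>h. inverse h ^ k * exp (- c / h) / h) \<longlongrightarrow> 0) (at_right 0)"
        using c by real_asymp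
      moreover have "eventually (\<lambda>h. inverse h ^ k * exp (- c / h) / h = exp_recip c k h / h) (at_right 0)"
        by (auto simp: eventually_at_filter exp_recip_def intro!: always_eventually)
      ultimately show "((\<lambda>h. exp_recip c k h / h) \<longlongrightarrow> 0) (at_right 0)"
        by (rule Lim_transform_eventually)
    qed
    with 3 show ?thesis by (simp add: DERIV_def exp_recip_def)
  qed
qed

text \<open>\<open>smooth_fun\<close> asks that all iterated directional derivatives be
  differentiable. A class that contains the directional derivatives of its members settles all
  orders by one induction, without formulas for higher derivatives.\<close>

inductive_set smooth_alg :: "('a::euclidean_space \<Rightarrow> real) set" where
  const: "(\<lambda>x. c) \<in> smooth_alg"
| inner: "(\<lambda>x. x \<bullet> v) \<in> smooth_alg"
| add: "f \<in> smooth_alg \<Longrightarrow> g \<in> smooth_alg \<Longrightarrow> (\<lambda>x. f x + g x) \<in> smooth_alg"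
| mult: "f \<in> smooth_alg \<Longrightarrow> g \<in> smooth_alg \<Longrightarrow> (\<lambda>x. f x * g x) \<in> smooth_alg"
| exp_recip: "f \<in> smooth_alg \<Longrightarrow> c > 0 \<Longrightarrow> (\<lambda>x. exp_recip c k (f x)) \<in> smooth_alg"

lemma smooth_alg_derivative:
  "f \<in> smooth_alg \<Longrightarrow> \<exists>f'. (\<forall>x. (f has_derivative f' x) (at x)) \<and> (\<forall>v. (\<lambda>x. f' x v) \<in> smooth_alg)"
proof (induction rule: smooth_alg.induct)
  case (const c)
  show ?case by (rule exI[of _ "\<lambda>x v. 0"]) (auto intro: smooth_alg.const)
next
  case (inner v)
  show ?case by (rule exI[of _ "\<lambda>x w. w \<bullet> v"]) (auto intro!: smooth_alg.const derivative_eq_intros)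
next
  case (add f g)
  then obtain f' g' where "\<And>x. (f has_derivative f' x) (at x)" "\<And>v. (\<lambda>x. f' x v) \<in> smooth_alg"
    "\<And>x. (g has_derivative g' x) (at x)" "\<And>v. (\<lambda>x. g' x v) \<in> smooth_alg" by blast
  then show ?case
    by (intro exI[of _ "\<lambda>x v. f' x v + g' x v"]) (auto intro: smooth_alg.add has_derivative_add)
next
  case (mult f g)
  then obtain f' g' where "\<And>x. (f has_derivative f' x) (at x)" "\<And>v. (\<lambda>x. f' x v) \<in> smooth_alg"
    "\<And>x. (g has_derivative g' x) (at x)" "\<And>v. (\<lambda>x. g' x v) \<in> smooth_alg" by blast
  then show ?case using mult.hyps
    by (intro exI[of _ "\<lambda>x v. f x * g' x v + f' x v * g x"])
       (auto intro!: smooth_alg.add smooth_alg.mult intro: has_derivative_mult)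
next
  case (exp_recip f c k)
  then obtain f' where f': "\<And>x. (f has_derivative f' x) (at x)" "\<And>v. (\<lambda>x. f' x v) \<in> smooth_alg" by blast
  have "((\<lambda>x. exp_recip c k (f x)) has_derivative
     (\<lambda>v. f' x v * (c * exp_recip c (k + 2) (f x) + (- real k) * exp_recip c (k + 1) (f x)))) (at x)" for x
    using has_derivative_compose[OF f'(1) exp_recip_deriv[OF \<open>c > 0\<close>, of k "f x", unfolded has_field_derivative_def]]
    by (simp add: mult.commute)
  then show ?case using exp_recip.hyps f'
    by (intro exI[of _ "\<lambda>x v. f' x v * (c * exp_recip c (k + 2) (f x) + (- real k) * exp_recip c (k + 1) (f x))"])
       (intro conjI allI smooth_alg.intros; blast intro: smooth_alg.intros)
qed

lemma smooth_alg_iter_deriv: "f \<in> smooth_alg \<Longrightarrow> iter_deriv vs f \<in> smooth_alg"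
proof (induction vs)
  case (Cons v vs)
  then obtain f' where "\<And>x. (iter_deriv vs f has_derivative f' x) (at x)" "\<And>v. (\<lambda>x. f' x v) \<in> smooth_alg"
    using smooth_alg_derivative by blast
  then show ?case by (simp add: frechet_derivative_at[symmetric, of "iter_deriv vs f" "f' x" x for x])
qed simp

lemma smooth_alg_smooth: "f \<in> smooth_alg \<Longrightarrow> smooth_fun f"
  unfolding smooth_fun_def using smooth_alg_iter_deriv smooth_alg_derivative
  by (metis differentiable_def)

lemma smooth_alg_prod:
  "(\<And>i. i \<in> A \<Longrightarrow> f i \<in> smooth_alg) \<Longrightarrow> (\<lambda>x. \<Prod>i\<in>A. f i x) \<in> smooth_alg"
  by (induction A rule: infinite_finite_induct) (auto intro: smooth_alg.intros)

text \<open>The factor for \<open>i\<close> is nonzero where \<open>x\<close> lies between the two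
  faces orthogonal to \<open>i\<close>. The product of the two differences is also positive if the
  faces are in the wrong order and \<open>x\<close> is between them, so the lemmas on support and
  limit require a nonempty box.\<close>

definition box_bump :: "real \<Rightarrow> 'a::euclidean_space \<Rightarrow> 'a \<Rightarrow> 'a \<Rightarrow> real" where
  "box_bump c a b x = (\<Prod>i\<in>Basis. exp_recip c 0 ((x \<bullet> i - a \<bullet> i) * (b \<bullet> i - x \<bullet> i)))"

lemma box_bump_smooth: "c > 0 \<Longrightarrow> smooth_fun (box_bump c a b)"
proof (rule smooth_alg_smooth)
  assume c: "c > 0"
  have "(\<lambda>x. (x \<bullet> i + (- (a \<bullet> i))) * (b \<bullet> i + (-1) * (x \<bullet> i))) \<in> smooth_alg" for i
    by (intro smooth_alg.intros)
  then have "(\<lambda>x. (x \<bullet> i - a \<bullet> i) * (b \<bullet> i - x \<bullet> i)) \<in> smooth_alg" for i by simp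
  then show "box_bump c a b \<in> smooth_alg"
    unfolding box_bump_def[abs_def] using c by (intro smooth_alg_prod smooth_alg.exp_recip)
qed

lemma exp_recip_0: "exp_recip c 0 t = (if t > 0 then exp (- c / t) else 0)"
  by (simp add: exp_recip_def)

lemma box_bump_range: "c > 0 \<Longrightarrow> 0 \<le> box_bump c a b x \<and> box_bump c a b x \<le> 1"
  unfolding box_bump_def by (auto intro!: prod_nonneg prod_le_1 simp: exp_recip_0)

lemma box_factor_pos:
  fixes a b x :: real assumes "a < b" shows "(x - a) * (b - x) > 0 \<longleftrightarrow> a < x \<and> x < b"
  using assms by (auto simp: zero_less_mult_iff)

lemma box_bump_outside:
  assumes "box a b \<noteq> {}" "x \<notin> box a b" shows "box_bump c a b x = 0"
proof -
  obtain i where i: "i \<in> Basis" "\<not> (a \<bullet> i < x \<bullet> i \<and> x \<bullet> i < b \<bullet> i)" using assms(2) by (auto simp: mem_box)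
  moreover have "a \<bullet> i < b \<bullet> i" using assms(1) i(1) by (simp add: box_ne_empty)
  ultimately have "exp_recip c 0 ((x \<bullet> i - a \<bullet> i) * (b \<bullet> i - x \<bullet> i)) = 0"
    using box_factor_pos[of "a \<bullet> i" "b \<bullet> i" "x \<bullet> i"] by (simp add: exp_recip_0)
  then show ?thesis unfolding box_bump_def using i(1) by (auto intro!: prod_zero)
qed

lemma box_bump_tendsto:
  assumes "box a b \<noteq> {}"
  shows "(\<lambda>n. box_bump (1 / (real n + 1)) a b x) \<longlonglongrightarrow> indicator (box a b) x"
proof (cases "x \<in> box a b")
  case True
  have "(\<lambda>n. \<Prod>i\<in>Basis. exp_recip (1 / (real n + 1)) 0 ((x \<bullet> i - a \<bullet> i) * (b \<bullet> i - x \<bullet> i))) \<longlonglongrightarrow> (\<Prod>i\<in>(Basis::'a set). 1)"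
  proof (rule tendsto_prod)
    fix i :: 'a assume "i \<in> Basis"
    then have pos: "(x \<bullet> i - a \<bullet> i) * (b \<bullet> i - x \<bullet> i) > 0" using True by (auto simp: mem_box)
    have "(\<lambda>n. 1 / (real n + 1)) \<longlonglongrightarrow> 0" by real_asymp
    then have "(\<lambda>n. exp (- (1 / (real n + 1)) / ((x \<bullet> i - a \<bullet> i) * (b \<bullet> i - x \<bullet> i)))) \<longlonglongrightarrow> exp (- 0 / ((x \<bullet> i - a \<bullet> i) * (b \<bullet> i - x \<bullet> i)))"
      using pos by (intro tendsto_intros) auto
    then show "(\<lambda>n. exp_recip (1 / (real n + 1)) 0 ((x \<bullet> i - a \<bullet> i) * (b \<bullet> i - x \<bullet> i))) \<longlonglongrightarrow> 1"
      using pos by (simp add: exp_recip_0)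
  qed
  then show ?thesis using True by (simp add: box_bump_def)
qed (simp add: box_bump_outside[OF assms])

lemma tsupport_subset_closed: "closed S \<Longrightarrow> (\<And>x. x \<notin> S \<Longrightarrow> f x = 0) \<Longrightarrow> tsupport f \<subseteq> S"
  unfolding tsupport_def by (intro closure_minimal) auto

lemma compact_tsupport: "compact K \<Longrightarrow> tsupport f \<subseteq> K \<Longrightarrow> compact (tsupport f)"
  by (auto simp: tsupport_def compact_eq_bounded_closed intro: bounded_subset)

lemma tsupport_outside: "x \<notin> tsupport f \<Longrightarrow> f x = 0"
  unfolding tsupport_def using closure_subset[of "{x. f x \<noteq> 0}"] by auto

lemma test_fun_outside: "test_fun U f \<Longrightarrow> x \<notin> U \<Longrightarrow> f x = 0"
  unfolding test_fun_def using tsupport_outside by blast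

lemma test_fun_box_bump:
  assumes "c > 0" "box a b \<noteq> {}" "cbox a b \<subseteq> U"
  shows "test_fun U (box_bump c a b)"
proof -
  have sub: "tsupport (box_bump c a b) \<subseteq> cbox a b"
    using box_bump_outside[OF assms(2)] box_subset_cbox by (intro tsupport_subset_closed) blast+
  have "compact (tsupport (box_bump c a b))" by (rule compact_tsupport[OF compact_cbox sub])
  then show ?thesis unfolding test_fun_def using box_bump_smooth assms sub by blast
qed

lemma smooth_fun_add:
  assumes f: "smooth_fun f" and g: "smooth_fun g" shows "smooth_fun (\<lambda>x. f x + g x)"
proof -
  have "iter_deriv vs (\<lambda>x. f x + g x) = (\<lambda>x. iter_deriv vs f x + iter_deriv vs g x)" for vs
  proof (induction vs)
    case (Cons v vs)
    have "frechet_derivative (\<lambda>x. iter_deriv vs f x + iter_deriv vs g x) (at x)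
        = (\<lambda>v. frechet_derivative (iter_deriv vs f) (at x) v + frechet_derivative (iter_deriv vs g) (at x) v)" for x
      using f g unfolding smooth_fun_def frechet_derivative_works
      by (intro frechet_derivative_at[symmetric] has_derivative_add) auto
    with Cons show ?case by simp
  qed simp
  then show ?thesis using f g unfolding smooth_fun_def by (auto intro: differentiable_add)
qed

lemma smooth_fun_scale:
  fixes f :: "'a::euclidean_space \<Rightarrow> real"
  assumes f: "smooth_fun f" shows "smooth_fun (\<lambda>x. c * f x)"
proof -
  have "iter_deriv vs (\<lambda>x. c * f x) = (\<lambda>x. c * iter_deriv vs f x)" for vs
  proof (induction vs)
    case (Cons v vs)
    have "frechet_derivative (\<lambda>x. c * iter_deriv vs f x) (at x) = (\<lambda>v. c * frechet_derivative (iter_deriv vs f) (at x) v)" for x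
      using f unfolding smooth_fun_def frechet_derivative_works
      by (intro frechet_derivative_at[symmetric] has_derivative_mult_right) auto
    with Cons show ?case by simp
  qed simp
  then show ?thesis using f unfolding smooth_fun_def
    by (simp add: differentiable_mult)
qed

lemma test_fun_add: "test_fun U f \<Longrightarrow> test_fun U g \<Longrightarrow> test_fun U (\<lambda>x. f x + g x)"
proof -
  assume f: "test_fun U f" and g: "test_fun U g"
  have "compact (tsupport f \<union> tsupport g)" using f g by (auto simp: test_fun_def)
  moreover have "tsupport (\<lambda>x. f x + g x) \<subseteq> tsupport f \<union> tsupport g"
    by (intro tsupport_subset_closed compact_imp_closed[OF calculation]) (auto simp: tsupport_outside)
  ultimately show ?thesis using f g unfolding test_fun_def
    by (auto intro: smooth_fun_add compact_tsupport)
qed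

lemma test_fun_scale: "test_fun U f \<Longrightarrow> test_fun U (\<lambda>x. c * f x)"
proof -
  assume f: "test_fun U f"
  have "compact (tsupport f)" using f by (auto simp: test_fun_def)
  moreover have "tsupport (\<lambda>x. c * f x) \<subseteq> tsupport f"
    by (intro tsupport_subset_closed compact_imp_closed[OF calculation]) (auto simp: tsupport_outside)
  ultimately show ?thesis using f unfolding test_fun_def
    by (auto intro: smooth_fun_scale compact_tsupport)
qed

lemma test_fun_zero: "test_fun U (\<lambda>x. 0)"
  using smooth_alg_smooth[OF smooth_alg.const[of 0]] by (simp add: test_fun_def tsupport_def)

lemma test_fun_mono: "test_fun U f \<Longrightarrow> U \<subseteq> V \<Longrightarrow> test_fun V f"
  by (auto simp: test_fun_def)

text \<open>Each directional derivative is continuous, since smoothness makes it differentiable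
  again, and vanishes off the compact support; hence it is bounded. The mean value inequality on the
  whole space then applies with the sum of the bounds over the basis.\<close>

lemma test_fun_lipschitz:
  fixes \<phi> :: "'a::euclidean_space \<Rightarrow> real"
  assumes \<phi>: "test_fun U \<phi>"
  shows "\<exists>L\<ge>0. \<forall>x y. \<bar>\<phi> x - \<phi> y\<bar> \<le> L * norm (x - y)"
proof -
  have d: "(\<phi> has_derivative frechet_derivative \<phi> (at x)) (at x)" for x
  proof -
    have "iter_deriv [] \<phi> differentiable (at x)" using \<phi> unfolding test_fun_def smooth_fun_def by blast
    then show ?thesis by (simp add: frechet_derivative_works)
  qed
  have "\<exists>M\<ge>0. \<forall>x. \<bar>frechet_derivative \<phi> (at x) v\<bar> \<le> M" for v
  proof -
    let ?g = "\<lambda>x. frechet_derivative \<phi> (at x) v"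
    have "iter_deriv [v] \<phi> differentiable (at x)" for x
      using \<phi> unfolding test_fun_def smooth_fun_def by blast
    then have "continuous_on UNIV ?g"
      by (intro continuous_at_imp_continuous_on ballI differentiable_imp_continuous_within) simp
    then have "compact (?g ` tsupport \<phi>)"
      using \<phi> by (intro compact_continuous_image) (auto simp: test_fun_def intro: continuous_on_subset)
    then have "bounded (?g ` tsupport \<phi>)" by (rule compact_imp_bounded)
    then obtain M where M: "\<And>x. x \<in> tsupport \<phi> \<Longrightarrow> \<bar>?g x\<bar> \<le> M"
      unfolding bounded_iff by auto
    have "\<bar>?g x\<bar> \<le> \<bar>M\<bar>" for x
    proof (cases "x \<in> tsupport \<phi>")
      case False
      have "open (- tsupport \<phi>)" by (simp add: tsupport_def open_Compl)
      then have "(\<phi> has_derivative (\<lambda>v. 0)) (at x)"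
      proof (rule has_derivative_transform_within_open[of "\<lambda>_. 0" "\<lambda>_. 0" x UNIV, rotated])
        show "x \<in> - tsupport \<phi>" using False by simp
        show "0 = \<phi> y" if "y \<in> - tsupport \<phi>" for y using tsupport_outside[of y \<phi>] that by simp
      qed simp
      then have "frechet_derivative \<phi> (at x) = (\<lambda>v. 0)" using frechet_derivative_at by metis
      then show ?thesis by simp
    qed (use M in force)
    then show ?thesis by (intro exI[of _ "\<bar>M\<bar>"]) auto
  qed
  then obtain M where M: "\<And>v. M v \<ge> 0" "\<And>v x. \<bar>frechet_derivative \<phi> (at x) v\<bar> \<le> M v" by metis
  define L where "L = (\<Sum>b\<in>(Basis::'a set). M b)"
  have "onorm (frechet_derivative \<phi> (at x)) \<le> L" for x
  proof (rule onorm_le)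
    fix v :: 'a
    have lin: "linear (frechet_derivative \<phi> (at x))" using d has_derivative_linear by blast
    have "frechet_derivative \<phi> (at x) v = frechet_derivative \<phi> (at x) (\<Sum>b\<in>Basis. (v \<bullet> b) *\<^sub>R b)"
      by (simp add: euclidean_representation)
    also have "\<dots> = (\<Sum>b\<in>Basis. (v \<bullet> b) * frechet_derivative \<phi> (at x) b)"
      using lin by (simp add: linear_sum linear_scale)
    also have "\<bar>\<dots>\<bar> \<le> (\<Sum>b\<in>Basis. \<bar>(v \<bullet> b) * frechet_derivative \<phi> (at x) b\<bar>)" by (rule sum_abs)
    also have "\<dots> \<le> (\<Sum>b\<in>Basis. norm v * M b)"
      using M by (intro sum_mono) (auto simp: abs_mult intro!: mult_mono Basis_le_norm)
    finally show "norm (frechet_derivative \<phi> (at x) v) \<le> L * norm v"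
      by (simp add: L_def sum_distrib_left mult.commute)
  qed
  then have "\<bar>\<phi> x - \<phi> y\<bar> \<le> L * norm (x - y)" for x y
    using differentiable_bound[of UNIV \<phi> "\<lambda>x. frechet_derivative \<phi> (at x)" L x y] d by auto
  moreover have "L \<ge> 0" unfolding L_def using M by (intro sum_nonneg) auto
  ultimately show ?thesis by blast
qed

lemma test_fun_continuous: "test_fun U \<phi> \<Longrightarrow> continuous_on UNIV \<phi>"
proof -
  assume "test_fun U \<phi>"
  then have "iter_deriv [] \<phi> differentiable (at x)" for x
    unfolding test_fun_def smooth_fun_def by blast
  then show ?thesis
    by (intro continuous_at_imp_continuous_on ballI differentiable_imp_continuous_within) simp
qed

lemma test_fun_bounded: assumes "test_fun U \<phi>" shows "\<exists>M\<ge>0. \<forall>x. \<bar>\<phi> x\<bar> \<le> M"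
proof -
  have "compact (\<phi> ` tsupport \<phi>)"
    using assms by (intro compact_continuous_image) (auto simp: test_fun_def intro: continuous_on_subset test_fun_continuous[OF assms])
  then have "bounded (\<phi> ` tsupport \<phi>)" by (rule compact_imp_bounded)
  then obtain M where M: "\<And>x. x \<in> tsupport \<phi> \<Longrightarrow> \<bar>\<phi> x\<bar> \<le> M"
    unfolding bounded_iff by auto
  have "\<bar>\<phi> x\<bar> \<le> \<bar>M\<bar>" for x using M[of x] by (cases "x \<in> tsupport \<phi>") (auto simp: tsupport_outside)
  then show ?thesis by (intro exI[of _ "\<bar>M\<bar>"]) auto
qed

section \<open>The Sobolev space\<close>

lemma abs_mult_le: "\<bar>a * b\<bar> \<le> a\<^sup>2 + (b::real)\<^sup>2"
proof -
  have "2 * (\<bar>a\<bar> * \<bar>b\<bar>) \<le> a\<^sup>2 + b\<^sup>2" using sum_squares_bound[of "\<bar>a\<bar>" "\<bar>b\<bar>"] by simp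
  moreover have "0 \<le> \<bar>a\<bar> * \<bar>b\<bar>" by simp
  ultimately show ?thesis unfolding abs_mult by linarith
qed

lemma integrable_mult_L2:
  fixes f g :: "'b \<Rightarrow> real"
  assumes [measurable]: "f \<in> borel_measurable M" "g \<in> borel_measurable M"
    and "integrable M (\<lambda>x. (f x)\<^sup>2)" "integrable M (\<lambda>x. (g x)\<^sup>2)"
  shows "integrable M (\<lambda>x. f x * g x)"
proof (rule Bochner_Integration.integrable_bound)
  show "integrable M (\<lambda>x. (f x)\<^sup>2 + (g x)\<^sup>2)" using assms by simp
  show "AE x in M. norm (f x * g x) \<le> norm ((f x)\<^sup>2 + (g x)\<^sup>2)" using abs_mult_le by simp
qed simp

lemma AE_lborel_fst:
  assumes "AE x in (lborel :: 'a::euclidean_space measure). P x"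
  shows "AE z in (lborel \<Otimes>\<^sub>M (lborel :: 'b::euclidean_space measure)). P (fst z)"
proof -
  obtain N where N: "N \<in> null_sets lborel" "{x. \<not> P x} \<subseteq> N" using assms by (auto elim!: AE_E simp: null_sets_def)
  have "N \<times> UNIV \<in> null_sets (lborel \<Otimes>\<^sub>M (lborel :: 'b measure))"
    using N(1) by (intro lborel.times_in_null_sets1) auto
  then show ?thesis by (rule AE_I') (use N(2) in force)
qed

lemma AE_lborel_snd:
  assumes "AE x in (lborel :: 'b::euclidean_space measure). P x"
  shows "AE z in ((lborel :: 'a::euclidean_space measure) \<Otimes>\<^sub>M lborel). P (snd z)"
proof -
  obtain N where N: "N \<in> null_sets lborel" "{x. \<not> P x} \<subseteq> N" using assms by (auto elim!: AE_E simp: null_sets_def)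
  have "UNIV \<times> N \<in> null_sets ((lborel :: 'a measure) \<Otimes>\<^sub>M lborel)"
    using N(1) by (intro lborel.times_in_null_sets2) auto
  then show ?thesis by (rule AE_I') (use N(2) in force)
qed

lemma gag_kernel_measurable [measurable]:
  fixes u v :: "'a::euclidean_space \<Rightarrow> real"
  assumes [measurable]: "u \<in> borel_measurable borel" "v \<in> borel_measurable borel"
  shows "gag_kernel s u v \<in> borel_measurable lborel2"
  unfolding gag_kernel_def by measurable

lemma gag_kernel_add: "gag_kernel s (\<lambda>x. u x + v x) w z = gag_kernel s u w z + gag_kernel s v w z"
  unfolding gag_kernel_def by (cases z) (simp add: add_divide_distrib[symmetric] algebra_simps)

lemma gag_kernel_scale: "gag_kernel s (\<lambda>x. c * u x) w z = c * gag_kernel s u w z"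
  unfolding gag_kernel_def by (cases z) (simp add: algebra_simps)

lemma gag_kernel_add2: "gag_kernel s w (\<lambda>x. u x + v x) z = gag_kernel s w u z + gag_kernel s w v z"
  unfolding gag_kernel_def by (cases z) (simp add: add_divide_distrib[symmetric] algebra_simps)

lemma gag_kernel_scale2: "gag_kernel s w (\<lambda>x. c * u x) z = c * gag_kernel s w u z"
  unfolding gag_kernel_def by (cases z) (simp add: algebra_simps)

lemma gag_kernel_sym: "gag_kernel s u v = gag_kernel s v u"
  unfolding gag_kernel_def by (auto simp: mult.commute)

lemma gag_kernel_nonneg: "0 \<le> gag_kernel s u u z"
  unfolding gag_kernel_def by (cases z) simp

lemma HsD:
  assumes "u \<in> Hs s"
  shows "u \<in> borel_measurable borel" "integrable lborel (\<lambda>x. (u x)\<^sup>2)"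
    "integrable lborel2 (gag_kernel s u u)"
  using assms by (auto simp: Hs_def)

lemma integrable_Hs_mult: "u \<in> Hs s \<Longrightarrow> v \<in> Hs s \<Longrightarrow> integrable lborel (\<lambda>x. u x * v x)"
  by (intro integrable_mult_L2) (simp_all add: HsD)

lemma integrable_gag:
  assumes u: "u \<in> Hs s" and v: "v \<in> Hs s"
  shows "integrable lborel2 (gag_kernel s u v)"
proof (rule Bochner_Integration.integrable_bound)
  have [measurable]: "u \<in> borel_measurable borel" "v \<in> borel_measurable borel" using u v by (simp_all add: HsD)
  show "integrable lborel2 (\<lambda>z. gag_kernel s u u z + gag_kernel s v v z)"
    using u v by (simp add: HsD)
  show "gag_kernel s u v \<in> borel_measurable lborel2" by measurable
  have "\<bar>a * b\<bar> \<le> a * a + b * b" for a b :: real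
    using abs_mult_le[of a b] by (simp add: power2_eq_square)
  then have "norm (gag_kernel s u v z) \<le> norm (gag_kernel s u u z + gag_kernel s v v z)" for z
    unfolding gag_kernel_def
    by (cases z) (simp add: add_divide_distrib[symmetric] divide_right_mono abs_mult)
  then show "AE z in lborel2. norm (gag_kernel s u v z) \<le> norm (gag_kernel s u u z + gag_kernel s v v z)"
    by simp
qed

text \<open>The bilinear form whose diagonal is the square of \<open>Hs_norm\<close>. It therefore
  carries no factor \<open>c_ns\<close>, unlike \<open>frac_form\<close>.\<close>

definition hs_form :: "real \<Rightarrow> ('a::euclidean_space \<Rightarrow> real) \<Rightarrow> ('a \<Rightarrow> real) \<Rightarrow> real" where
  "hs_form s u v = (\<integral>x. u x * v x \<partial>lborel) + gag_form s u v"

lemma Hs_norm_eq: "Hs_norm s u = sqrt (hs_form s u u)"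
  by (simp add: Hs_norm_def hs_form_def power2_eq_square)

lemma Hs_add: assumes u: "u \<in> Hs s" and v: "v \<in> Hs s" shows "(\<lambda>x. u x + v x) \<in> Hs s"
proof -
  have [measurable]: "u \<in> borel_measurable borel" "v \<in> borel_measurable borel" using u v by (simp_all add: HsD)
  have "integrable lborel (\<lambda>x. (u x + v x)\<^sup>2)"
    using HsD(2)[OF u] HsD(2)[OF v] integrable_Hs_mult[OF u v] by (simp add: power2_sum mult.assoc)
  moreover have "gag_kernel s (\<lambda>x. u x + v x) (\<lambda>x. u x + v x)
     = (\<lambda>z. gag_kernel s u u z + gag_kernel s u v z + (gag_kernel s v u z + gag_kernel s v v z))"
    by (simp add: fun_eq_iff gag_kernel_add gag_kernel_add2)
  ultimately show ?thesis
    unfolding Hs_def using integrable_gag[OF u v] integrable_gag[OF v u] integrable_gag[OF u u] integrable_gag[OF v v] by simp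
qed

lemma Hs_scale: assumes u: "u \<in> Hs s" shows "(\<lambda>x. c * u x) \<in> Hs s"
proof -
  have [measurable]: "u \<in> borel_measurable borel" using u by (rule HsD)
  have "gag_kernel s (\<lambda>x. c * u x) (\<lambda>x. c * u x) = (\<lambda>z. c * (c * gag_kernel s u u z))"
    by (simp add: fun_eq_iff gag_kernel_scale gag_kernel_scale2)
  then show ?thesis unfolding Hs_def using HsD(2,3)[OF u] by (simp add: power_mult_distrib)
qed

lemma Hs_zero_mem: "(\<lambda>x. 0) \<in> Hs s"
  by (simp add: Hs_def gag_kernel_def case_prod_unfold)

lemma sym_form_gag: "sym_form (Hs s :: ('a::euclidean_space \<Rightarrow> real) set) (gag_form s)"
proof
  fix u v w :: "'a \<Rightarrow> real" assume "u \<in> Hs s" "v \<in> Hs s" "w \<in> Hs s"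
  then show "gag_form s (\<lambda>x. u x + v x) w =
     gag_form s u w + gag_form s v w"
    by (simp add: gag_kernel_add[abs_def] integrable_gag)
next
  fix u v :: "'a \<Rightarrow> real"
  show "gag_form s u v = gag_form s v u"
    by (simp add: gag_kernel_sym[of s u v])
qed (auto simp: Hs_add Hs_scale Hs_zero_mem gag_kernel_scale[abs_def])

lemma semi_inner_Hs: "semi_inner (Hs s :: ('a::euclidean_space \<Rightarrow> real) set) (hs_form s)"
proof -
  interpret G: sym_form "Hs s :: ('a \<Rightarrow> real) set" "gag_form s" by (rule sym_form_gag)
  show ?thesis
  proof
    fix u v w :: "'a \<Rightarrow> real" assume "u \<in> Hs s" "v \<in> Hs s" "w \<in> Hs s"
    then show "hs_form s (\<lambda>x. u x + v x) w = hs_form s u w + hs_form s v w"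
      by (simp add: hs_form_def G.form_add integrable_Hs_mult distrib_right)
  next
    fix u w :: "'a \<Rightarrow> real" and c assume "u \<in> Hs s" "w \<in> Hs s"
    then show "hs_form s (\<lambda>x. c * u x) w = c * hs_form s u w"
      by (simp add: hs_form_def G.form_scale integrable_Hs_mult distrib_left mult.assoc)
  next
    fix u v :: "'a \<Rightarrow> real" assume "u \<in> Hs s" "v \<in> Hs s"
    then show "hs_form s u v = hs_form s v u"
      by (simp add: hs_form_def G.form_sym mult.commute)
  next
    fix u :: "'a \<Rightarrow> real"
    show "0 \<le> hs_form s u u"
      by (simp add: hs_form_def gag_kernel_nonneg)
  qed (auto simp: Hs_add Hs_scale Hs_zero_mem)
qed

interpretation Hs: semi_inner "Hs s" "hs_form s" for s by (rule semi_inner_Hs)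

text \<open>Fatou's lemma in the shape in which completeness uses it: a bound on the late members
  yields integrability of the limit together with the same bound.\<close>

lemma fatou_integrable:
  fixes f :: "nat \<Rightarrow> 'b \<Rightarrow> real"
  assumes [measurable]: "g \<in> borel_measurable M" and int: "\<And>k. integrable M (f k)"
    and nonneg: "\<And>k x. 0 \<le> f k x" and lim: "AE x in M. (\<lambda>k. f k x) \<longlonglongrightarrow> g x"
    and bound: "\<And>k. k \<ge> K \<Longrightarrow> integral\<^sup>L M (f k) \<le> c"
  shows "integrable M g \<and> integral\<^sup>L M g \<le> c"
proof -
  have [measurable]: "f k \<in> borel_measurable M" for k using int by blast
  have g0: "AE x in M. 0 \<le> g x"
    using lim by eventually_elim (auto intro: LIMSEQ_le_const simp: nonneg)
  have "0 \<le> (\<integral>x. f K x \<partial>M)" by (rule Bochner_Integration.integral_nonneg) (rule nonneg)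
  then have c0: "0 \<le> c" using bound[of K] by simp
  have "(\<integral>\<^sup>+x. ennreal (g x) \<partial>M) = (\<integral>\<^sup>+x. liminf (\<lambda>k. ennreal (f k x)) \<partial>M)"
  proof (intro nn_integral_cong_AE, use lim in eventually_elim)
    case (elim x)
    then have "(\<lambda>k. ennreal (f k x)) \<longlonglongrightarrow> ennreal (g x)" by (intro tendsto_ennrealI)
    then show ?case using lim_imp_Liminf[of sequentially "\<lambda>k. ennreal (f k x)"] by simp
  qed
  also have "\<dots> \<le> liminf (\<lambda>k. \<integral>\<^sup>+x. ennreal (f k x) \<partial>M)" by (intro nn_integral_liminf) simp
  also have "\<dots> \<le> liminf (\<lambda>k::nat. ennreal c)"
  proof (intro Liminf_mono eventually_sequentiallyI[of K])
    fix k assume "k \<ge> K"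
    then show "(\<integral>\<^sup>+x. ennreal (f k x) \<partial>M) \<le> ennreal c"
      using bound int nonneg by (subst nn_integral_eq_integral) (auto intro: ennreal_leI)
  qed
  also have "\<dots> = ennreal c" by (simp add: Liminf_const)
  finally have le: "(\<integral>\<^sup>+x. ennreal (g x) \<partial>M) \<le> ennreal c" .
  then have "integrable M g"
    using g0 by (intro integrableI_nonneg) (auto simp: le_less_trans[OF _ ennreal_less_top])
  moreover from this have "ennreal (integral\<^sup>L M g) \<le> ennreal c"
    using le g0 by (subst (asm) nn_integral_eq_integral) auto
  ultimately show ?thesis using c0 by simp
qed

text \<open>In a space of infinite measure an L2 bound gives no L1 bound on the increments, so their
  squares are summed with weights \<open>2^k\<close>. The integrals are at most \<open>4^-k\<close>;
  where the weighted sum is a finite \<open>C\<close>, the increments are at most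
  \<open>sqrt C * (1 / sqrt 2)^k\<close> and can be telescoped.\<close>

lemma AE_convergent_of_fast_L2:
  fixes Y :: "nat \<Rightarrow> 'b \<Rightarrow> real"
  assumes [measurable]: "\<And>k. Y k \<in> borel_measurable M"
    and int: "\<And>k. integrable M (\<lambda>x. (Y (Suc k) x - Y k x)\<^sup>2)"
    and bound: "\<And>k. (\<integral>x. (Y (Suc k) x - Y k x)\<^sup>2 \<partial>M) \<le> (1/8) ^ k"
  shows "AE x in M. convergent (\<lambda>k. Y k x)"
proof -
  let ?d = "\<lambda>k x. 2 ^ k * (Y (Suc k) x - Y k x)\<^sup>2"
  have "(\<integral>\<^sup>+x. (\<Sum>k. ennreal (?d k x)) \<partial>M) = (\<Sum>k. \<integral>\<^sup>+x. ennreal (?d k x) \<partial>M)"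
    by (intro nn_integral_suminf) simp
  also have "\<dots> \<le> (\<Sum>k. ennreal ((1/4) ^ k))"
  proof (intro suminf_le)
    fix k
    have "(\<integral>\<^sup>+x. ennreal (?d k x) \<partial>M) = ennreal (\<integral>x. ?d k x \<partial>M)"
      using int by (intro nn_integral_eq_integral) auto
    also have "\<dots> \<le> ennreal (2 ^ k * (1/8) ^ k)" using bound[of k] by (intro ennreal_leI) simp
    also have "\<dots> = ennreal ((1/4) ^ k)" by (simp add: power_mult_distrib[symmetric])
    finally show "(\<integral>\<^sup>+x. ennreal (?d k x) \<partial>M) \<le> ennreal ((1/4) ^ k)" .
  qed auto
  also have "\<dots> = ennreal (\<Sum>k. (1/4) ^ k)" by (intro suminf_ennreal2 summable_geometric) auto
  also have "\<dots> < \<infinity>" by simp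
  finally have fin: "(\<integral>\<^sup>+x. (\<Sum>k. ennreal (?d k x)) \<partial>M) \<noteq> \<infinity>" by simp
  have "AE x in M. (\<Sum>k. ennreal (?d k x)) \<noteq> \<infinity>" by (rule nn_integral_PInf_AE[OF _ fin]) simp
  then show ?thesis
  proof eventually_elim
    case (elim x)
    obtain C where C: "(\<Sum>k. ennreal (?d k x)) = ennreal C" "C \<ge> 0"
    proof -
      have "\<exists>C\<ge>0. S = ennreal C" if "S \<noteq> \<infinity>" for S using that by (cases S) auto
      from this[OF elim] show thesis using that by blast
    qed
    have "\<bar>Y (Suc k) x - Y k x\<bar> \<le> sqrt C * (1 / sqrt 2) ^ k" for k
    proof -
      have "ennreal (?d k x) = (\<Sum>j\<in>{k}. ennreal (?d j x))" by simp
      also have "\<dots> \<le> (\<Sum>k. ennreal (?d k x))" by (intro sum_le_suminf) auto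
      finally have "?d k x \<le> C" using C by simp
      then have "(Y (Suc k) x - Y k x)\<^sup>2 \<le> C / 2 ^ k" by (simp add: field_simps)
      then have "sqrt ((Y (Suc k) x - Y k x)\<^sup>2) \<le> sqrt (C / 2 ^ k)" by (rule real_sqrt_le_mono)
      then have "\<bar>Y (Suc k) x - Y k x\<bar> \<le> sqrt (C / 2 ^ k)" unfolding real_sqrt_abs .
      also have "sqrt (C / 2 ^ k) = sqrt C * (1 / sqrt 2) ^ k"
        by (simp add: real_sqrt_divide real_sqrt_power power_divide)
      finally show ?thesis .
    qed
    note le = this
    have "summable (\<lambda>k. sqrt C * (1 / sqrt 2) ^ k)"
      by (intro summable_mult summable_geometric) simp
    then have "summable (\<lambda>k. Y (Suc k) x - Y k x)"
      by (rule summable_comparison_test'[where N=0]) (simp only: real_norm_def le)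
    then have "convergent (\<lambda>n. (\<Sum>k<n. Y (Suc k) x - Y k x))" by (simp add: summable_iff_convergent)
    then have "convergent (\<lambda>n. Y n x - Y 0 x)" unfolding sum_lessThan_telescope[of "\<lambda>k. Y k x"] .
    then have "convergent (\<lambda>n. (Y n x - Y 0 x) + Y 0 x)" by (intro convergent_add convergent_const)
    then show ?case by simp
  qed
qed

lemma L2_le_hs_form: "(\<integral>x. (u x)\<^sup>2 \<partial>lborel) \<le> hs_form s u u"
  and gag_le_hs_form: "gag_form s u u \<le> hs_form s u u"
  by (simp_all add: hs_form_def gag_kernel_nonneg power2_eq_square)

text \<open>As for the Riesz-Fischer theorem, a fast subsequence converges almost everywhere, and
  Fatou's lemma estimates the distance of its limit from every late member of the original sequence.
  It is applied to the L2 part and to the Gagliardo part separately.\<close>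

lemma complete_Hs: "complete_form (Hs s) (hs_form s :: ('a::euclidean_space \<Rightarrow> real) \<Rightarrow> _)"
  unfolding complete_form_def
proof (intro allI impI)
  fix X :: "nat \<Rightarrow> 'a \<Rightarrow> real"
  let ?D = "\<lambda>m n x. X m x - X n x"
  assume XH: "\<forall>n. X n \<in> Hs s" and cauchy: "\<forall>e>0. \<exists>N. \<forall>m\<ge>N. \<forall>n\<ge>N. quad (hs_form s) (?D m n) < e"
  have X: "X n \<in> Hs s" for n using XH by blast
  have Xm [measurable]: "X n \<in> borel_measurable borel" for n using X by (rule HsD)
  have D: "?D m n \<in> Hs s" for m n using X Hs.diff_mem by blast
  have "\<exists>N. \<forall>m\<ge>N. \<forall>n\<ge>N. quad (hs_form s) (?D m n) < (1/8) ^ k" for k :: nat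
    using cauchy by simp
  then obtain N where N: "\<And>k m n. m \<ge> N k \<Longrightarrow> n \<ge> N k \<Longrightarrow> quad (hs_form s) (?D m n) < (1/8) ^ k" by metis
  \<comment> \<open>Summing the \<open>N j\<close> makes \<open>r\<close> monotone and at least
    \<open>N k\<close>; the summand \<open>k\<close> makes \<open>r k\<close> tend to
    infinity.\<close>
  define r where "r k = (\<Sum>j\<le>k. N j) + k" for k
  have rN: "r k \<ge> N k" for k
    unfolding r_def using member_le_sum[of k "{..k}" N] by simp
  have rk: "r k \<ge> k" for k by (simp add: r_def)
  have r_Suc: "r (Suc k) \<ge> r k" for k by (simp add: r_def)
  define Y where "Y k = X (r k)" for k
  have Ym [measurable]: "Y k \<in> borel_measurable borel" for k by (simp add: Y_def)
  have "AE x in lborel. convergent (\<lambda>k. Y k x)"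
  proof (rule AE_convergent_of_fast_L2)
    fix k
    show "integrable lborel (\<lambda>x. (Y (Suc k) x - Y k x)\<^sup>2)"
      using HsD(2)[OF D[of "r (Suc k)" "r k"]] by (simp add: Y_def)
    show "(\<integral>x. (Y (Suc k) x - Y k x)\<^sup>2 \<partial>lborel) \<le> (1/8) ^ k"
      using L2_le_hs_form[where s=s, of "?D (r (Suc k)) (r k)"] N[of k "r (Suc k)" "r k"] rN[of k] r_Suc[of k] by (simp add: Y_def)
  qed simp
  \<comment> \<open>Where the sequence diverges the value is unspecified, but the function is Borel
    measurable on the whole space.\<close>
  define u where "u x = lim (\<lambda>k. Y k x)" for x
  have [measurable]: "u \<in> borel_measurable borel" unfolding u_def by measurable
  have lim: "AE x in lborel. (\<lambda>k. Y k x) \<longlonglongrightarrow> u x"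
    using \<open>AE x in lborel. convergent (\<lambda>k. Y k x)\<close> by eventually_elim (simp add: u_def convergent_LIMSEQ_iff)
  \<comment> \<open>The factor 2 arises because each of the two parts of the form is bounded by
    \<open>e\<close>.\<close>
  have est: "(\<lambda>x. u x - X m x) \<in> Hs s \<and> quad (hs_form s) (\<lambda>x. u x - X m x) \<le> 2 * e"
    if K: "\<And>m n. m \<ge> K \<Longrightarrow> n \<ge> K \<Longrightarrow> quad (hs_form s) (?D m n) < e" and m: "m \<ge> K" for K e m
  proof -
    have le: "quad (hs_form s) (?D (r k) m) \<le> e" if "k \<ge> K" for k
      using K[of "r k" m] rk[of k] that m by simp
    have 1: "integrable lborel (\<lambda>x. (u x - X m x)\<^sup>2) \<and> (\<integral>x. (u x - X m x)\<^sup>2 \<partial>lborel) \<le> e"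
    proof (rule fatou_integrable[where f="\<lambda>k x. (Y k x - X m x)\<^sup>2" and K=K])
      show "integrable lborel (\<lambda>x. (Y k x - X m x)\<^sup>2)" for k
        using HsD(2)[OF D] unfolding Y_def by simp
      show "AE x in lborel. (\<lambda>k. (Y k x - X m x)\<^sup>2) \<longlonglongrightarrow> (u x - X m x)\<^sup>2"
        using lim by eventually_elim (intro tendsto_intros)
      show "(\<integral>x. (Y k x - X m x)\<^sup>2 \<partial>lborel) \<le> e" if "k \<ge> K" for k
        using le[OF that] L2_le_hs_form[where s=s, of "?D (r k) m"] by (simp add: Y_def)
    qed auto
    have 2: "integrable lborel2 (gag_kernel s (\<lambda>x. u x - X m x) (\<lambda>x. u x - X m x)) \<and>
        gag_form s (\<lambda>x. u x - X m x) (\<lambda>x. u x - X m x) \<le> e"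
    proof (rule fatou_integrable[where f="\<lambda>k. gag_kernel s (\<lambda>x. Y k x - X m x) (\<lambda>x. Y k x - X m x)" and K=K])
      show "integrable lborel2 (gag_kernel s (\<lambda>x. Y k x - X m x) (\<lambda>x. Y k x - X m x))" for k
        using HsD(3)[OF D] unfolding Y_def by simp
      show "AE z in lborel2. (\<lambda>k. gag_kernel s (\<lambda>x. Y k x - X m x) (\<lambda>x. Y k x - X m x) z)
           \<longlonglongrightarrow> gag_kernel s (\<lambda>x. u x - X m x) (\<lambda>x. u x - X m x) z"
        using AE_lborel_fst[OF lim] AE_lborel_snd[OF lim]
      proof eventually_elim
        case (elim z)
        then show ?case unfolding gag_kernel_def case_prod_unfold divide_inverse
          by (intro tendsto_intros)
      qed
      show "integral\<^sup>L lborel2 (gag_kernel s (\<lambda>x. Y k x - X m x) (\<lambda>x. Y k x - X m x)) \<le> e" if "k \<ge> K" for k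
        using le[OF that] gag_le_hs_form[of s "?D (r k) m"] by (simp add: Y_def)
    qed (auto simp: gag_kernel_nonneg)
    from 1 2 show ?thesis by (simp add: Hs_def hs_form_def power2_eq_square)
  qed
  have "u \<in> Hs s"
  proof -
    obtain K where "\<And>m n. m \<ge> K \<Longrightarrow> n \<ge> K \<Longrightarrow> quad (hs_form s) (?D m n) < 1" using cauchy zero_less_one by metis
    then have "(\<lambda>x. u x - X K x) \<in> Hs s" using est by blast
    from Hs_add[OF this X[of K]] show ?thesis by simp
  qed
  moreover have "(\<lambda>n. quad (hs_form s) (\<lambda>x. X n x - u x)) \<longlonglongrightarrow> 0"
  proof (rule LIMSEQ_I)
    fix e :: real assume e: "e > 0"
    then have "e / 3 > 0" by simp
    then obtain K where K: "\<And>m n. m \<ge> K \<Longrightarrow> n \<ge> K \<Longrightarrow> quad (hs_form s) (?D m n) < e / 3" using cauchy by metis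
    have "norm (quad (hs_form s) (\<lambda>x. X n x - u x) - 0) < e" if "n \<ge> K" for n
    proof -
      have "quad (hs_form s) (\<lambda>x. X n x - u x) = quad (hs_form s) (\<lambda>x. u x - X n x)"
        using Hs.form_diff_diff[OF \<open>u \<in> Hs s\<close> X[of n]] Hs.form_diff_diff[OF X[of n] \<open>u \<in> Hs s\<close>]
          Hs.form_sym[OF \<open>u \<in> Hs s\<close> X[of n]] by simp
      also have "\<dots> \<le> 2 * (e / 3)" using est[OF K that] by blast
      finally show ?thesis using Hs.form_nonneg[OF Hs.diff_mem[OF X[of n] \<open>u \<in> Hs s\<close>]] e by simp
    qed
    then show "\<exists>no. \<forall>n\<ge>no. norm (quad (hs_form s) (\<lambda>x. X n x - u x) - 0) < e" by blast
  qed
  ultimately show "\<exists>u\<in>Hs s. (\<lambda>n. quad (hs_form s) (\<lambda>x. X n x - u x)) \<longlonglongrightarrow> 0" by blast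
qed

section \<open>The closure of the test functions\<close>

text \<open>Near the origin the exponent is \<open>2 - n - 2 s\<close>, integrable because
  \<open>s < 1\<close>; at infinity it is \<open>- n - 2 s\<close>, integrable because
  \<open>s > 0\<close>. The function dominates the Gagliardo kernel of a bounded Lipschitz function,
  up to a constant.\<close>

lemma integrable_kernel_min:
  fixes s :: real
  assumes s: "0 < s" "s < 1"
  shows "integrable lborel (\<lambda>w::'a::euclidean_space. min 1 ((norm w)\<^sup>2) * norm w powr (- (real DIM('a) + 2 * s)))"
proof (rule Bochner_Integration.integrable_bound)
  let ?p = "real DIM('a) + 2 * s"
  show "integrable lborel (\<lambda>w::'a. indicator (ball 0 1) w * ((norm w)\<^sup>2 * norm w powr (- ?p)) +
      indicator {w. 1 \<le> norm w} w * norm w powr (- ?p))"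
    using s by (intro Bochner_Integration.integrable_add integrable_powr_near integrable_powr_tail) (auto intro: add_pos_pos)
  show "AE w::'a in lborel. norm (min 1 ((norm w)\<^sup>2) * norm w powr (- ?p)) \<le>
     norm (indicator (ball 0 1) w * ((norm w)\<^sup>2 * norm w powr (- ?p)) + indicator {w. 1 \<le> norm w} w * norm w powr (- ?p))"
    by (auto simp: indicator_def not_le mult_right_mono)
qed measurable

text \<open>The kernel vanishes unless one of the two points lies in the compact support. This cuts
  one variable down to a set of finite measure, and the other one is integrated over the whole space
  against an integrable function of \<open>x - y\<close>.\<close>

lemma test_fun_Hs:
  fixes \<phi> :: "'a::euclidean_space \<Rightarrow> real"
  assumes s: "0 < s" "s < 1" and \<phi>: "test_fun U \<phi>"
  shows "\<phi> \<in> Hs s"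
proof -
  let ?p = "real DIM('a) + 2 * s"
  define K where "K = tsupport \<phi>"
  have K: "compact K" using \<phi> by (simp add: test_fun_def K_def)
  have K_meas [measurable]: "K \<in> sets borel" using K by (rule borel_compact)
  have K_fin: "emeasure lborel K < \<infinity>" using K by (rule emeasure_compact_finite)
  have [measurable]: "\<phi> \<in> borel_measurable borel"
    by (rule borel_measurable_continuous_onI[OF test_fun_continuous[OF \<phi>]])
  obtain L where L: "L \<ge> 0" "\<And>x y. \<bar>\<phi> x - \<phi> y\<bar> \<le> L * norm (x - y)" using test_fun_lipschitz[OF \<phi>] by blast
  obtain M where M: "M \<ge> 0" "\<And>x. \<bar>\<phi> x\<bar> \<le> M" using test_fun_bounded[OF \<phi>] by blast
  have out: "\<phi> x = 0" if "x \<notin> K" for x using tsupport_outside[of x \<phi>] that by (simp add: K_def)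
  have 1: "integrable lborel (\<lambda>x. (\<phi> x)\<^sup>2)"
  proof (rule Bochner_Integration.integrable_bound)
    show "integrable lborel (\<lambda>x. M\<^sup>2 * indicator K x :: real)" using K_fin by simp
    have "(\<phi> x)\<^sup>2 \<le> M\<^sup>2 * indicator K x" for x
      using power_mono[OF M(2)[of x], of 2] out[of x] by (auto simp: indicator_def)
    then show "AE x in lborel. norm ((\<phi> x)\<^sup>2) \<le> norm (M\<^sup>2 * indicator K x)" by simp
  qed measurable
  define k where "k w = min 1 ((norm w)\<^sup>2) * norm w powr (- ?p)" for w :: 'a
  have k_int: "integrable lborel k" unfolding k_def using s by (rule integrable_kernel_min)
  have [measurable]: "k \<in> borel_measurable borel" unfolding k_def by measurable
  have k0: "0 \<le> k w" for w by (simp add: k_def)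
  \<comment> \<open>\<open>L\<^sup>2\<close> covers distances below 1 by the Lipschitz bound,
    \<open>4 * M\<^sup>2\<close> the others by the bound \<open>2 * M\<close> on differences of
    values.\<close>
  define C where "C = L\<^sup>2 + 4 * M\<^sup>2"
  have bound: "gag_kernel s \<phi> \<phi> (x, y) \<le> C * (indicator K x * k (x - y) + indicator K y * k (x - y))" for x y
  proof (cases "x \<in> K \<or> y \<in> K")
    case False
    then show ?thesis by (simp add: gag_kernel_def out)
  next
    case True
    have a: "(\<phi> x - \<phi> y)\<^sup>2 \<le> L\<^sup>2 * (norm (x - y))\<^sup>2"
      using power_mono[OF L(2)[of x y], of 2] by (simp add: power_mult_distrib)
    have "\<bar>\<phi> x - \<phi> y\<bar> \<le> 2 * M" using M(2)[of x] M(2)[of y] by linarith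
    then have b: "(\<phi> x - \<phi> y)\<^sup>2 \<le> 4 * M\<^sup>2" using power_mono[of "\<bar>\<phi> x - \<phi> y\<bar>" "2 * M" 2] by (simp add: power_mult_distrib)
    have "(\<phi> x - \<phi> y)\<^sup>2 \<le> C * min 1 ((norm (x - y))\<^sup>2)"
    proof (cases "1 \<le> (norm (x - y))\<^sup>2")
      case True
      then show ?thesis using b by (simp add: C_def add_increasing)
    next
      case False
      then show ?thesis using a by (simp add: C_def distrib_right min_def add_increasing2)
    qed
    then have "(\<phi> x - \<phi> y)\<^sup>2 * norm (x - y) powr (- ?p) \<le> C * min 1 ((norm (x - y))\<^sup>2) * norm (x - y) powr (- ?p)"
      by (intro mult_right_mono) auto
    then have "gag_kernel s \<phi> \<phi> (x, y) \<le> C * k (x - y)"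
      by (simp only: gag_kernel_def k_def power2_eq_square powr_minus divide_inverse mult.assoc prod.case)
    also have "\<dots> \<le> C * (indicator K x * k (x - y) + indicator K y * k (x - y))"
      using True k0[of "x - y"] by (intro mult_left_mono) (auto simp: C_def indicator_def)
    finally show ?thesis .
  qed
  have i1: "integrable lborel2 (\<lambda>z. indicator K (fst z) * k (fst z - snd z))"
  proof (rule integrableI_nonneg)
    have "(\<integral>\<^sup>+z. ennreal (indicator K (fst z) * k (fst z - snd z)) \<partial>lborel2)
        = (\<integral>\<^sup>+x. \<integral>\<^sup>+y. ennreal (indicator K x * k (x - y)) \<partial>lborel \<partial>lborel)"
      by (subst lborel.nn_integral_fst[symmetric]) auto
    also have "\<dots> = (\<integral>\<^sup>+x. indicator K x * (\<integral>\<^sup>+w. ennreal (k w) \<partial>lborel) \<partial>lborel)"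
    proof (intro nn_integral_cong)
      fix x
      have "(\<integral>\<^sup>+y. ennreal (indicator K x * k (x - y)) \<partial>lborel) = (\<integral>\<^sup>+y. indicator K x * ennreal (k (x - y)) \<partial>lborel)"
        by (intro nn_integral_cong) (auto simp: indicator_def)
      also have "\<dots> = indicator K x * (\<integral>\<^sup>+y. ennreal (k (x - y)) \<partial>lborel)" by (intro nn_integral_cmult) measurable
      also have "(\<integral>\<^sup>+y. ennreal (k (x - y)) \<partial>lborel) = (\<integral>\<^sup>+w. ennreal (k w) \<partial>lborel)"
        by (rule nn_integral_lborel_reflect) measurable
      finally show "(\<integral>\<^sup>+y. ennreal (indicator K x * k (x - y)) \<partial>lborel) = indicator K x * (\<integral>\<^sup>+w. ennreal (k w) \<partial>lborel)" .
    qed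
    also have "\<dots> = emeasure lborel K * (\<integral>\<^sup>+w. ennreal (k w) \<partial>lborel)"
      by (subst nn_integral_multc) auto
    also have "\<dots> < \<infinity>"
      using K_fin k_int k0 by (simp add: nn_integral_eq_integral ennreal_mult_less_top less_top)
    finally show "(\<integral>\<^sup>+z. ennreal (indicator K (fst z) * k (fst z - snd z)) \<partial>lborel2) < \<infinity>" .
  qed (auto simp: k0)
  have k_sym: "k (x - y) = k (y - x)" for x y by (simp add: k_def norm_minus_commute)
  have i2: "integrable lborel2 (\<lambda>z. indicator K (snd z) * k (fst z - snd z))"
    using lborel_pair.integrable_product_swap[OF i1] by (simp add: case_prod_unfold k_sym)
  have 2: "integrable lborel2 (gag_kernel s \<phi> \<phi>)"
  proof (rule Bochner_Integration.integrable_bound)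
    show "integrable lborel2 (\<lambda>z. C * (indicator K (fst z) * k (fst z - snd z) + indicator K (snd z) * k (fst z - snd z)))"
      using i1 i2 by simp
    show "AE z in lborel2. norm (gag_kernel s \<phi> \<phi> z) \<le>
       norm (C * (indicator K (fst z) * k (fst z - snd z) + indicator K (snd z) * k (fst z - snd z)))"
      using bound gag_kernel_nonneg[of s \<phi>] by (auto intro!: order_trans[OF _ abs_ge_self])
  qed measurable
  from 1 2 show ?thesis by (simp add: Hs_def)
qed

lemma Hs_tildeD: "u \<in> Hs_tilde s U \<Longrightarrow> u \<in> Hs s"
  by (simp add: Hs_tilde_def)

lemma Hs_tilde_approx:
  assumes "u \<in> Hs_tilde s U" "e > 0"
  obtains \<phi> where "test_fun U \<phi>" "sqrt (quad (hs_form s) (\<lambda>x. u x - \<phi> x)) < e"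
  using assms unfolding Hs_tilde_def Hs_norm_eq by blast

lemma Hs_tildeI:
  assumes "u \<in> Hs s" "\<And>e. e > 0 \<Longrightarrow> \<exists>\<phi>. test_fun U \<phi> \<and> sqrt (quad (hs_form s) (\<lambda>x. u x - \<phi> x)) < e"
  shows "u \<in> Hs_tilde s U"
  using assms unfolding Hs_tilde_def Hs_norm_eq by blast

context
  fixes s :: real
  assumes s: "0 < s" "s < 1"
begin

lemma test_fun_Hs_tilde: "test_fun U \<phi> \<Longrightarrow> \<phi> \<in> Hs_tilde s U"
proof (rule Hs_tildeI)
  assume \<phi>: "test_fun U \<phi>"
  then show "\<phi> \<in> Hs s" by (rule test_fun_Hs[OF s])
  fix e :: real assume "e > 0"
  with \<phi> show "\<exists>\<psi>. test_fun U \<psi> \<and> sqrt (quad (hs_form s) (\<lambda>x. \<phi> x - \<psi> x)) < e"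
    by (intro exI[of _ \<phi>]) (simp add: hs_form_def gag_kernel_def case_prod_unfold)
qed

lemma Hs_tilde_add: assumes u: "u \<in> Hs_tilde s U" and v: "v \<in> Hs_tilde s U" shows "(\<lambda>x. u x + v x) \<in> Hs_tilde s U"
proof (rule Hs_tildeI)
  show "(\<lambda>x. u x + v x) \<in> Hs s" using u v Hs_add Hs_tildeD by blast
  fix e :: real assume "e > 0"
  then have e: "e / 2 > 0" by simp
  obtain f where f: "test_fun U f" "sqrt (quad (hs_form s) (\<lambda>x. u x - f x)) < e / 2"
    by (rule Hs_tilde_approx[OF u e])
  obtain g where g: "test_fun U g" "sqrt (quad (hs_form s) (\<lambda>x. v x - g x)) < e / 2"
    by (rule Hs_tilde_approx[OF v e])
  have m: "(\<lambda>x. u x - f x) \<in> Hs s" "(\<lambda>x. v x - g x) \<in> Hs s"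
    using u v f g Hs_tildeD test_fun_Hs[OF s] Hs.diff_mem by blast+
  have eq: "(\<lambda>x. (u x - f x) + (v x - g x)) = (\<lambda>x. (u x + v x) - (f x + g x))" by auto
  have "sqrt (quad (hs_form s) (\<lambda>x. (u x + v x) - (f x + g x))) < e"
    using Hs.triangle[OF m] f(2) g(2) unfolding eq by linarith
  with test_fun_add[OF f(1) g(1)]
  show "\<exists>\<phi>. test_fun U \<phi> \<and> sqrt (quad (hs_form s) (\<lambda>x. (u x + v x) - \<phi> x)) < e"
    by (intro exI[of _ "\<lambda>x. f x + g x"] conjI)
qed

lemma Hs_tilde_scale: assumes u: "u \<in> Hs_tilde s U" shows "(\<lambda>x. c * u x) \<in> Hs_tilde s U"
proof (rule Hs_tildeI)
  show "(\<lambda>x. c * u x) \<in> Hs s" using u Hs_scale Hs_tildeD by blast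
  fix e :: real assume e: "e > 0"
  then have e': "e / (\<bar>c\<bar> + 1) > 0" by (simp add: divide_pos_pos)
  obtain f where f: "test_fun U f" "sqrt (quad (hs_form s) (\<lambda>x. u x - f x)) < e / (\<bar>c\<bar> + 1)"
    by (rule Hs_tilde_approx[OF u e'])
  have m: "(\<lambda>x. u x - f x) \<in> Hs s" using u f Hs_tildeD test_fun_Hs[OF s] Hs.diff_mem by blast
  have eq: "(\<lambda>x. c * (u x - f x)) = (\<lambda>x. c * u x - c * f x)" by (simp add: right_diff_distrib)
  have "quad (hs_form s) (\<lambda>x. c * (u x - f x)) = c * (c * quad (hs_form s) (\<lambda>x. u x - f x))"
    by (simp only: Hs.form_scale[OF m Hs.scale_mem[OF m]] Hs.form_scale2[OF m m])
  then have "sqrt (quad (hs_form s) (\<lambda>x. c * u x - c * f x))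
      = \<bar>c\<bar> * sqrt (quad (hs_form s) (\<lambda>x. u x - f x))"
    unfolding eq by (simp add: real_sqrt_mult mult.assoc[symmetric])
  also have "\<dots> \<le> (\<bar>c\<bar> + 1) * sqrt (quad (hs_form s) (\<lambda>x. u x - f x))"
    using Hs.form_nonneg[OF m] by (intro mult_right_mono) auto
  also have "\<dots> < e" using f(2) by (simp add: field_simps)
  finally show "\<exists>\<phi>. test_fun U \<phi> \<and> sqrt (quad (hs_form s) (\<lambda>x. c * u x - \<phi> x)) < e"
    using test_fun_scale[OF f(1), of c] by (intro exI[of _ "\<lambda>x. c * f x"] conjI)
qed

lemma Hs_tilde_zero: "(\<lambda>x. 0) \<in> Hs_tilde s U"
  by (rule test_fun_Hs_tilde[OF test_fun_zero])

lemma semi_inner_Hs_tilde: "semi_inner (Hs_tilde s U) (hs_form s)"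
proof
  fix u v assume "u \<in> Hs_tilde s U" "v \<in> Hs_tilde s U"
  then show "hs_form s u v = hs_form s v u" by (intro Hs.form_sym Hs_tildeD)
qed (auto simp: Hs_tilde_zero Hs_tilde_add Hs_tilde_scale
      intro: Hs.form_add Hs.form_scale Hs.form_nonneg dest: Hs_tildeD)

lemma complete_Hs_tilde: "complete_form (Hs_tilde s U) (hs_form s)"
  unfolding complete_form_def
proof (intro allI impI)
  fix X :: "nat \<Rightarrow> 'a \<Rightarrow> real"
  assume X: "\<forall>n. X n \<in> Hs_tilde s U"
    and cauchy: "\<forall>e>0. \<exists>N. \<forall>m\<ge>N. \<forall>n\<ge>N. quad (hs_form s) (\<lambda>x. X m x - X n x) < e"
  have XH: "X n \<in> Hs s" for n using X Hs_tildeD by blast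
  obtain u where u: "u \<in> Hs s" and lim: "(\<lambda>n. quad (hs_form s) (\<lambda>x. X n x - u x)) \<longlonglongrightarrow> 0"
    using cauchy by (rule_tac complete_formD[of "Hs s" "hs_form s" X, OF complete_Hs XH]) blast
  have "u \<in> Hs_tilde s U"
  proof (rule Hs_tildeI[OF u])
    fix e :: real assume "e > 0"
    then have e: "e / 2 > 0" by simp
    have "(\<lambda>n. sqrt (quad (hs_form s) (\<lambda>x. X n x - u x))) \<longlonglongrightarrow> 0"
      using tendsto_real_sqrt[OF lim] by simp
    then have "eventually (\<lambda>n. sqrt (quad (hs_form s) (\<lambda>x. X n x - u x)) < e / 2) sequentially"
      using e by (rule order_tendstoD(2))
    then obtain n where n: "sqrt (quad (hs_form s) (\<lambda>x. X n x - u x)) < e / 2"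
      by (auto simp: eventually_sequentially)
    obtain f where f: "test_fun U f" "sqrt (quad (hs_form s) (\<lambda>x. X n x - f x)) < e / 2"
      by (rule Hs_tilde_approx[OF X[rule_format, of n] e])
    have m: "(\<lambda>x. X n x - f x) \<in> Hs s" "(\<lambda>x. X n x - u x) \<in> Hs s"
      using XH u f test_fun_Hs[OF s] Hs.diff_mem by blast+
    have eq: "(\<lambda>x. (X n x - f x) - (X n x - u x)) = (\<lambda>x. u x - f x)" by auto
    have "sqrt (quad (hs_form s) (\<lambda>x. u x - f x)) < e"
      using Hs.triangle_diff[OF m] n f(2) unfolding eq by linarith
    with f(1) show "\<exists>\<phi>. test_fun U \<phi> \<and> sqrt (quad (hs_form s) (\<lambda>x. u x - \<phi> x)) < e" by blast
  qed
  with lim show "\<exists>u\<in>Hs_tilde s U. (\<lambda>n. quad (hs_form s) (\<lambda>x. X n x - u x)) \<longlonglongrightarrow> 0" by blast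
qed

text \<open>Test functions vanish outside \<open>U\<close>, so the L2 norm of \<open>u\<close> there
  is at most its distance to any of them, which is arbitrarily small.\<close>

lemma Hs_tilde_AE_outside:
  assumes u: "u \<in> Hs_tilde s U" and U [measurable]: "U \<in> sets borel"
  shows "AE x in lborel. x \<notin> U \<longrightarrow> u x = 0"
proof -
  have [measurable]: "u \<in> borel_measurable borel" using HsD(1)[OF Hs_tildeD[OF u]] .
  have int: "integrable lborel (\<lambda>x. indicator (- U) x * (u x)\<^sup>2)"
    using integrable_mult_indicator[OF _ HsD(2)[OF Hs_tildeD[OF u]], of "- U"] by simp
  have "(\<integral>x. indicator (- U) x * (u x)\<^sup>2 \<partial>lborel) \<le> e" if e: "e > 0" for e
  proof -
    obtain f where f: "test_fun U f" "sqrt (quad (hs_form s) (\<lambda>x. u x - f x)) < sqrt e"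
    proof -
      have "sqrt e > 0" using e by simp
      from Hs_tilde_approx[OF u this] show thesis using that by blast
    qed
    have d: "(\<lambda>x. u x - f x) \<in> Hs s" using u f Hs_tildeD test_fun_Hs[OF s] Hs.diff_mem by blast
    have "(\<integral>x. indicator (- U) x * (u x)\<^sup>2 \<partial>lborel) \<le> (\<integral>x. (u x - f x)\<^sup>2 \<partial>lborel)"
    proof (intro integral_mono int HsD(2)[OF d])
      fix x show "indicator (- U) x * (u x)\<^sup>2 \<le> (u x - f x)\<^sup>2"
        using test_fun_outside[OF f(1), of x] by (cases "x \<in> U") simp_all
    qed
    also have "\<dots> \<le> e" using L2_le_hs_form[of "\<lambda>x. u x - f x" s] f(2) by simp
    finally show ?thesis .
  qed
  then have "(\<integral>x. indicator (- U) x * (u x)\<^sup>2 \<partial>lborel) \<le> 0"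
    by (rule dense_ge) simp
  moreover have "(\<integral>x. indicator (- U) x * (u x)\<^sup>2 \<partial>lborel) \<ge> 0" by (intro Bochner_Integration.integral_nonneg) auto
  ultimately have "(\<integral>x. indicator (- U) x * (u x)\<^sup>2 \<partial>lborel) = 0" by simp
  then have "AE x in lborel. indicator (- U) x * (u x)\<^sup>2 = 0"
    using int by (subst (asm) integral_nonneg_eq_0_iff_AE) auto
  then show ?thesis by eventually_elim (auto simp: indicator_def split: if_splits)
qed

end

section \<open>Compact embedding into square-integrable functions\<close>

text \<open>The half-open cube of side \<open>h\<close> that contains \<open>x\<close> in the grid
  of multiples of \<open>h\<close>. Labelling by floors makes the cells a partition for
  \<open>h > 0\<close>.\<close>

definition cell :: "real \<Rightarrow> 'a::euclidean_space \<Rightarrow> 'a set" where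
  "cell h x = {y. \<forall>b\<in>Basis. \<lfloor>(y \<bullet> b) / h\<rfloor> = \<lfloor>(x \<bullet> b) / h\<rfloor>}"

lemma cell_measurable [measurable]: "cell h x \<in> sets borel"
proof -
  have "cell h x = {y \<in> space borel. \<forall>b\<in>Basis. \<lfloor>(y \<bullet> b) / h\<rfloor> = \<lfloor>(x \<bullet> b) / h\<rfloor>}" by (simp add: cell_def)
  also have "\<dots> \<in> sets borel" by measurable
  finally show ?thesis .
qed

lemma cell_pair_measurable [measurable]:
  "Measurable.pred (borel \<Otimes>\<^sub>M borel) (\<lambda>z::'a::euclidean_space \<times> 'a. snd z \<in> cell h (fst z))"
  unfolding cell_def mem_Collect_eq by measurable

lemma emeasure_cell:
  fixes x :: "'a::euclidean_space"
  assumes h: "h > 0" shows "emeasure lborel (cell h x) = ennreal (h ^ DIM('a))"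
proof -
  define c where "c = (\<Sum>b\<in>Basis. (h * \<lfloor>(x \<bullet> b) / h\<rfloor>) *\<^sub>R b)"
  define d where "d = (\<Sum>b\<in>Basis. (h * \<lfloor>(x \<bullet> b) / h\<rfloor> + h) *\<^sub>R b)"
  have cd: "c \<bullet> b = h * \<lfloor>(x \<bullet> b) / h\<rfloor>" "d \<bullet> b = h * \<lfloor>(x \<bullet> b) / h\<rfloor> + h" if "b \<in> Basis" for b
    using that by (simp_all add: c_def d_def)
  have fl: "\<lfloor>t / h\<rfloor> = k \<longleftrightarrow> h * real_of_int k \<le> t \<and> t < h * real_of_int k + h" for t k
    using h by (simp add: floor_eq_iff field_simps)
  have "box c d \<subseteq> cell h x" "cell h x \<subseteq> cbox c d"
    unfolding cell_def fl using cd by (fastforce simp: mem_box)+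
  then have "emeasure lborel (box c d) \<le> emeasure lborel (cell h x)" "emeasure lborel (cell h x) \<le> emeasure lborel (cbox c d)"
    by (auto intro!: emeasure_mono)
  moreover have "emeasure lborel (box c d) = ennreal (h ^ DIM('a))" "emeasure lborel (cbox c d) = ennreal (h ^ DIM('a))"
  proof -
    have le: "c \<bullet> b \<le> d \<bullet> b" if "b \<in> Basis" for b using cd[OF that] h by simp
    have "(\<Prod>b\<in>Basis. (d - c) \<bullet> b) = (\<Prod>b\<in>(Basis::'a set). h)"
      by (intro prod.cong) (simp_all add: inner_diff_left cd)
    then show "emeasure lborel (box c d) = ennreal (h ^ DIM('a))" "emeasure lborel (cbox c d) = ennreal (h ^ DIM('a))"
      using le by (simp_all add: emeasure_lborel_box emeasure_lborel_cbox)
  qed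
  ultimately show ?thesis by (simp add: order_antisym)
qed

lemma cell_norm_le:
  fixes x y :: "'a::euclidean_space"
  assumes h: "h > 0" and y: "y \<in> cell h x" shows "norm (x - y) \<le> real DIM('a) * h"
proof -
  have "norm (x - y) \<le> (\<Sum>b\<in>Basis. \<bar>(x - y) \<bullet> b\<bar>)" by (rule norm_le_l1)
  also have "\<dots> \<le> (\<Sum>b\<in>(Basis::'a set). h)"
  proof (rule sum_mono)
    fix b :: 'a assume "b \<in> Basis"
    then have "\<lfloor>(y \<bullet> b) / h\<rfloor> = \<lfloor>(x \<bullet> b) / h\<rfloor>" using y by (simp add: cell_def)
    then have "\<bar>(x \<bullet> b) / h - (y \<bullet> b) / h\<bar> < 1"
      using floor_correct[of "(x \<bullet> b) / h"] floor_correct[of "(y \<bullet> b) / h"] by linarith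
    then have "\<bar>((x - y) \<bullet> b) / h\<bar> < 1" by (simp add: inner_diff_left diff_divide_distrib)
    then show "\<bar>(x - y) \<bullet> b\<bar> \<le> h" using h by (simp add: abs_divide)
  qed
  finally show ?thesis by simp
qed

text \<open>Countability permits one diagonal subsequence along which the integrals over all cells
  of countably many grids converge.\<close>

lemma countable_cells: "countable (range (cell h :: 'a::euclidean_space \<Rightarrow> _))"
proof -
  have "range (cell h) \<subseteq> (\<lambda>k. {y::'a. \<forall>b\<in>Basis. \<lfloor>(y \<bullet> b) / h\<rfloor> = k b}) ` (PiE Basis (\<lambda>_. UNIV :: int set))"
  proof
    fix Q :: "'a set" assume "Q \<in> range (cell h)"
    then obtain x where "Q = cell h x" by blast
    then have "Q = {y::'a. \<forall>b\<in>Basis. \<lfloor>(y \<bullet> b) / h\<rfloor> = restrict (\<lambda>b. \<lfloor>(x \<bullet> b) / h\<rfloor>) Basis b}"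
      by (auto simp: cell_def)
    then show "Q \<in> (\<lambda>k. {y::'a. \<forall>b\<in>Basis. \<lfloor>(y \<bullet> b) / h\<rfloor> = k b}) ` (PiE Basis (\<lambda>_. UNIV :: int set))"
      by (intro image_eqI[where x="restrict (\<lambda>b. \<lfloor>(x \<bullet> b) / h\<rfloor>) Basis"]) auto
  qed
  moreover have "countable (PiE (Basis :: 'a set) (\<lambda>_. UNIV :: int set))"
    by (intro countable_PiE) auto
  ultimately show ?thesis by (meson countable_image countable_subset)
qed

text \<open>Cauchy-Schwarz against the indicator of \<open>Q\<close>, proved by expanding the
  nonnegative integral of \<open>(g - I / m)\<^sup>2\<close> over \<open>Q\<close>, where
  \<open>I / m\<close> is the mean of \<open>g\<close>.\<close>

lemma integral_indicator_square_le:
  fixes g :: "'b \<Rightarrow> real"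
  assumes [measurable]: "g \<in> borel_measurable M" "Q \<in> sets M" and fin: "emeasure M Q = ennreal m" and m: "m > 0"
    and int: "integrable M (\<lambda>y. indicator Q y * (g y)\<^sup>2)"
  shows "integrable M (\<lambda>y. indicator Q y * g y)"
    and "(\<integral>y. indicator Q y * g y \<partial>M)\<^sup>2 \<le> m * (\<integral>y. indicator Q y * (g y)\<^sup>2 \<partial>M)"
proof -
  have i1: "integrable M (\<lambda>y. indicator Q y :: real)" using fin by simp
  have mq: "measure M Q = m" using fin m by (simp add: measure_def)
  show i2: "integrable M (\<lambda>y. indicator Q y * g y)"
  proof (rule Bochner_Integration.integrable_bound)
    show "integrable M (\<lambda>y. indicator Q y + indicator Q y * (g y)\<^sup>2)" using i1 int by simp
    have "\<bar>t\<bar> \<le> 1 + t\<^sup>2" for t :: real using abs_mult_le[of 1 t] by simp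
    then show "AE y in M. norm (indicator Q y * g y) \<le> norm (indicator Q y + indicator Q y * (g y)\<^sup>2 :: real)"
      by (auto simp: indicator_def)
  qed measurable
  define I where "I = (\<integral>y. indicator Q y * g y \<partial>M)"
  have "0 \<le> (\<integral>y. indicator Q y * (g y - I / m)\<^sup>2 \<partial>M)" by (intro Bochner_Integration.integral_nonneg) simp
  also have "(\<lambda>y. indicator Q y * (g y - I / m)\<^sup>2) = (\<lambda>y. indicator Q y * (g y)\<^sup>2 - (2 * I / m) * (indicator Q y * g y) + (I / m)\<^sup>2 * indicator Q y)"
    by (auto simp: fun_eq_iff power2_diff algebra_simps)
  also have "(\<integral>y. indicator Q y * (g y)\<^sup>2 - (2 * I / m) * (indicator Q y * g y) + (I / m)\<^sup>2 * indicator Q y \<partial>M)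
      = (\<integral>y. indicator Q y * (g y)\<^sup>2 \<partial>M) - (2 * I / m) * I + (I / m)\<^sup>2 * m"
    using int i1 i2 by (simp add: I_def mq)
  also have "\<dots> = (\<integral>y. indicator Q y * (g y)\<^sup>2 \<partial>M) - I\<^sup>2 / m" using m by (simp add: field_simps power2_eq_square)
  finally show "(\<integral>y. indicator Q y * g y \<partial>M)\<^sup>2 \<le> m * (\<integral>y. indicator Q y * (g y)\<^sup>2 \<partial>M)"
    using m by (simp add: I_def field_simps)
qed

definition cell_avg :: "real \<Rightarrow> ('a::euclidean_space \<Rightarrow> real) \<Rightarrow> 'a \<Rightarrow> real" where
  "cell_avg h u x = (\<integral>y. indicator (cell h x) y * u y \<partial>lborel) / h ^ DIM('a)"

lemma cell_avg_measurable [measurable]: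
  fixes u :: "'a::euclidean_space \<Rightarrow> real"
  assumes [measurable]: "u \<in> borel_measurable borel"
  shows "cell_avg h u \<in> borel_measurable borel"
proof -
  have "(\<lambda>z::'a \<times> 'a. if snd z \<in> cell h (fst z) then u (snd z) else 0) \<in> borel_measurable (borel \<Otimes>\<^sub>M lborel)"
    by measurable
  then have "(\<lambda>x. \<integral>y. (if y \<in> cell h x then u y else 0) \<partial>lborel) \<in> borel_measurable borel"
    by (intro lborel.borel_measurable_lebesgue_integral) (simp add: case_prod_unfold)
  moreover have "cell_avg h u = (\<lambda>x. (\<integral>y. (if y \<in> cell h x then u y else 0) \<partial>lborel) / h ^ DIM('a))"
    unfolding cell_avg_def[abs_def]
    by (intro ext arg_cong[where f="\<lambda>t. t / _"] Bochner_Integration.integral_cong) (auto simp: indicator_def)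
  ultimately show ?thesis by simp
qed

lemma integrable_cell:
  assumes h: "h > 0" and u: "(u :: 'a::euclidean_space \<Rightarrow> real) \<in> borel_measurable borel" "integrable lborel (\<lambda>x. (u x)\<^sup>2)"
  shows "integrable lborel (\<lambda>y. indicator (cell h x) y * u y)"
proof (rule integral_indicator_square_le(1)[OF _ _ emeasure_cell[OF h]])
  show "integrable lborel (\<lambda>y. indicator (cell h x) y * (u y)\<^sup>2)"
    using integrable_mult_indicator[OF _ u(2), of "cell h x"] by simp
qed (use u h in auto)

lemma cell_avg_bound:
  assumes h: "h > 0" and u: "(u :: 'a::euclidean_space \<Rightarrow> real) \<in> borel_measurable borel" "integrable lborel (\<lambda>x. (u x)\<^sup>2)"
  shows "(\<integral>y. indicator (cell h x) y * u y \<partial>lborel)\<^sup>2 \<le> h ^ DIM('a) * (\<integral>y. (u y)\<^sup>2 \<partial>lborel)"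
proof -
  have i: "integrable lborel (\<lambda>y. indicator (cell h x) y * (u y)\<^sup>2)"
    using integrable_mult_indicator[OF _ u(2), of "cell h x"] by simp
  have "(\<integral>y. indicator (cell h x) y * u y \<partial>lborel)\<^sup>2 \<le> h ^ DIM('a) * (\<integral>y. indicator (cell h x) y * (u y)\<^sup>2 \<partial>lborel)"
    using u h by (intro integral_indicator_square_le(2)[OF _ _ emeasure_cell[OF h]] i) auto
  also have "\<dots> \<le> h ^ DIM('a) * (\<integral>y. (u y)\<^sup>2 \<partial>lborel)"
    using h by (intro mult_left_mono integral_mono i u) (auto simp: indicator_def)
  finally show ?thesis .
qed

text \<open>Two points of a grid cell are at distance at most \<open>n h\<close>, so there \<open>1\<close> is bounded by
  \<open>(n h / |x - y|) powr (n + 2 s)\<close>, which turns the oscillation on the cell into the Gagliardo kernel.\<close>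

lemma cell_avg_approx:
  fixes u :: "'a::euclidean_space \<Rightarrow> real"
  assumes s: "0 < s" and h: "h > 0" and u: "u \<in> Hs s"
  shows "integrable lborel (\<lambda>x. (u x - cell_avg h u x)\<^sup>2)"
    and "(\<integral>x. (u x - cell_avg h u x)\<^sup>2 \<partial>lborel)
      \<le> real DIM('a) powr (real DIM('a) + 2 * s) * h powr (2 * s) * hs_form s u u"
proof -
  let ?n = "DIM('a)"
  let ?p = "real ?n + 2 * s"
  have [measurable]: "u \<in> borel_measurable borel" by (rule HsD(1)[OF u])
  have hn: "h ^ ?n > 0" using h by simp
  \<comment> \<open>The power of the diameter bound divided by the volume of a cell. What remains is
    \<open>h powr (2 * s)\<close> up to a constant, and this tends to 0 with the mesh because
    \<open>s > 0\<close>.\<close>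
  define c where "c = (real ?n * h) powr ?p / h ^ ?n"
  have c0: "c \<ge> 0" using hn by (simp add: c_def)
  have ce: "c = real ?n powr ?p * h powr (2 * s)"
    using h by (simp add: c_def powr_mult powr_add powr_realpow)
  have pt: "ennreal ((u x - cell_avg h u x)\<^sup>2) \<le> (\<integral>\<^sup>+y. ennreal (c * gag_kernel s u u (x, y)) \<partial>lborel)" for x
  proof -
    have iu: "integrable lborel (\<lambda>y. indicator (cell h x) y * u y)"
      by (rule integrable_cell[OF h _ HsD(2)[OF u]]) measurable
    have i1: "integrable lborel (\<lambda>y. indicator (cell h x) y :: real)" using emeasure_cell[OF h, of x] by simp
    have mq: "measure lborel (cell h x) = h ^ ?n"
      using emeasure_cell[OF h, of x] hn by (simp add: measure_def)
    have i2: "integrable lborel (\<lambda>y. indicator (cell h x) y * (u x - u y)\<^sup>2)"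
    proof -
      have "integrable lborel (\<lambda>y. indicator (cell h x) y * (u y)\<^sup>2)"
        using integrable_mult_indicator[OF _ HsD(2)[OF u], of "cell h x"] by simp
      then have "integrable lborel (\<lambda>y. (u x)\<^sup>2 * indicator (cell h x) y - (2 * u x) * (indicator (cell h x) y * u y) + indicator (cell h x) y * (u y)\<^sup>2)"
        using iu i1 by (intro Bochner_Integration.integrable_add Bochner_Integration.integrable_diff integrable_mult_right) auto
      then show ?thesis by (rule Bochner_Integration.integrable_cong[OF refl, THEN iffD1, rotated]) (simp add: power2_diff algebra_simps)
    qed
    have "u x - cell_avg h u x = (\<integral>y. indicator (cell h x) y * (u x - u y) \<partial>lborel) / h ^ ?n"
    proof -
      have "(\<integral>y. indicator (cell h x) y * (u x - u y) \<partial>lborel) = (\<integral>y. u x * indicator (cell h x) y - indicator (cell h x) y * u y \<partial>lborel)"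
        by (intro Bochner_Integration.integral_cong) (auto simp: algebra_simps)
      also have "\<dots> = u x * h ^ ?n - (\<integral>y. indicator (cell h x) y * u y \<partial>lborel)"
        using iu i1 by (simp add: mq)
      finally show ?thesis using h by (simp add: cell_avg_def diff_divide_distrib)
    qed
    then have "(u x - cell_avg h u x)\<^sup>2 = (\<integral>y. indicator (cell h x) y * (u x - u y) \<partial>lborel)\<^sup>2 / (h ^ ?n)\<^sup>2"
      by (simp add: power_divide)
    also have "\<dots> \<le> (h ^ ?n * (\<integral>y. indicator (cell h x) y * (u x - u y)\<^sup>2 \<partial>lborel)) / (h ^ ?n)\<^sup>2"
      using hn by (intro divide_right_mono integral_indicator_square_le(2)[OF _ _ emeasure_cell[OF h]] i2) auto
    also have "\<dots> = (\<integral>y. indicator (cell h x) y * (u x - u y)\<^sup>2 \<partial>lborel) / h ^ ?n"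
      using hn by (simp add: power2_eq_square)
    also have "\<dots> = (\<integral>y. indicator (cell h x) y * (u x - u y)\<^sup>2 / h ^ ?n \<partial>lborel)" by simp
    finally have "ennreal ((u x - cell_avg h u x)\<^sup>2) \<le> ennreal (\<integral>y. indicator (cell h x) y * (u x - u y)\<^sup>2 / h ^ ?n \<partial>lborel)"
      by (rule ennreal_leI)
    also have "\<dots> = (\<integral>\<^sup>+y. ennreal (indicator (cell h x) y * (u x - u y)\<^sup>2 / h ^ ?n) \<partial>lborel)"
      using i2 hn by (intro nn_integral_eq_integral[symmetric]) (auto intro!: divide_nonneg_pos)
    also have "\<dots> \<le> (\<integral>\<^sup>+y. ennreal (c * gag_kernel s u u (x, y)) \<partial>lborel)"
    proof (intro nn_integral_mono ennreal_leI)
      fix y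
      show "indicator (cell h x) y * (u x - u y)\<^sup>2 / h ^ ?n \<le> c * gag_kernel s u u (x, y)"
      proof (cases "y \<in> cell h x \<and> x \<noteq> y")
        case False
        then show ?thesis using c0 gag_kernel_nonneg[of s u "(x, y)"] by (auto simp: indicator_def)
      next
        case True
        then have "norm (x - y) powr ?p \<le> (real ?n * h) powr ?p"
          using s cell_norm_le[OF h, of y x] by (intro powr_mono2) auto
        moreover have pos: "norm (x - y) powr ?p > 0" using True by simp
        ultimately have "1 \<le> (real ?n * h) powr ?p / norm (x - y) powr ?p" by simp
        then have "(u x - u y)\<^sup>2 / h ^ ?n * 1 \<le> (u x - u y)\<^sup>2 / h ^ ?n * ((real ?n * h) powr ?p / norm (x - y) powr ?p)"
          using hn by (intro mult_left_mono) auto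
        then show ?thesis using True by (simp add: gag_kernel_def c_def power2_eq_square mult_ac)
      qed
    qed
    finally show ?thesis .
  qed
  have fin: "(\<integral>\<^sup>+x. ennreal ((u x - cell_avg h u x)\<^sup>2) \<partial>lborel)
       \<le> ennreal (c * gag_form s u u)"
  proof -
    have "(\<integral>\<^sup>+x. ennreal ((u x - cell_avg h u x)\<^sup>2) \<partial>lborel) \<le> (\<integral>\<^sup>+x. \<integral>\<^sup>+y. ennreal (c * gag_kernel s u u (x, y)) \<partial>lborel \<partial>lborel)"
      by (intro nn_integral_mono pt)
    also have "\<dots> = (\<integral>\<^sup>+z. ennreal (c * gag_kernel s u u z) \<partial>lborel2)"
      by (subst lborel.nn_integral_fst) auto
    also have "\<dots> = ennreal (\<integral>z. c * gag_kernel s u u z \<partial>lborel2)"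
      using HsD(3)[OF u] c0 by (intro nn_integral_eq_integral) (auto simp: gag_kernel_nonneg)
    finally show ?thesis by simp
  qed
  show int: "integrable lborel (\<lambda>x. (u x - cell_avg h u x)\<^sup>2)"
    by (rule integrableI_nonneg) (use le_less_trans[OF fin ennreal_less_top] in auto)
  have "ennreal (\<integral>x. (u x - cell_avg h u x)\<^sup>2 \<partial>lborel) \<le> ennreal (c * gag_form s u u)"
    using fin int by (subst (asm) nn_integral_eq_integral) auto
  then have "(\<integral>x. (u x - cell_avg h u x)\<^sup>2 \<partial>lborel) \<le> c * gag_form s u u"
    using c0 by (subst (asm) ennreal_le_iff) (auto intro!: mult_nonneg_nonneg simp: gag_kernel_nonneg)
  also have "\<dots> \<le> c * hs_form s u u" using c0 gag_le_hs_form by (rule mult_left_mono[rotated])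
  finally show "(\<integral>x. (u x - cell_avg h u x)\<^sup>2 \<partial>lborel) \<le> real ?n powr ?p * h powr (2 * s) * hs_form s u u"
    by (simp add: ce)
qed

text \<open>Rellich's theorem by averaging over grids. A fine mesh brings every difference of
  members close to its cell averages in L2, uniformly since the form is bounded; for that fixed mesh
  the averages converge pointwise and boundedly on the bounded set \<open>U\<close>, hence in L2 of
  \<open>U\<close>. The subsequence is chosen before the mesh, and so serves all meshes.\<close>

lemma compact_embedding:
  fixes X :: "nat \<Rightarrow> 'a::euclidean_space \<Rightarrow> real"
  assumes s: "0 < s" "s < 1" and U: "open U" "bounded U"
    and X: "\<And>n. X n \<in> Hs_tilde s U" and X1: "\<And>n. quad (hs_form s) (X n) \<le> 1"
  shows "\<exists>r::nat \<Rightarrow> nat. strict_mono r \<and>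
    (\<forall>e>0. \<exists>N. \<forall>m\<ge>N. \<forall>n\<ge>N. (\<integral>x. (X (r m) x - X (r n) x)\<^sup>2 \<partial>lborel) < e)"
proof -
  let ?n = "DIM('a)"
  let ?p = "real ?n + 2 * s"
  interpret semi_inner "Hs_tilde s U" "hs_form s" by (rule semi_inner_Hs_tilde[OF s])
  have XH: "X n \<in> Hs s" for n using X by (rule Hs_tildeD)
  have Xm [measurable]: "X n \<in> borel_measurable borel" for n by (rule HsD(1)[OF XH])
  have U_meas [measurable]: "U \<in> sets borel" using U by simp
  have U_fin: "emeasure lborel U < \<infinity>" using U by (intro emeasure_bounded_finite)
  have X2: "(\<integral>x. (X n x)\<^sup>2 \<partial>lborel) \<le> 1" for n using L2_le_hs_form[of "X n" s] X1[of n] by simp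
  have cb: "(\<integral>y. indicator (cell h x) y * X n y \<partial>lborel)\<^sup>2 \<le> h ^ ?n" if "h > 0" for h x n
  proof -
    have "(\<integral>y. indicator (cell h x) y * X n y \<partial>lborel)\<^sup>2 \<le> h ^ ?n * (\<integral>y. (X n y)\<^sup>2 \<partial>lborel)"
      by (rule cell_avg_bound[OF that HsD(1,2)[OF XH]])
    also have "\<dots> \<le> h ^ ?n * 1" using that X2 by (intro mult_left_mono) auto
    finally show ?thesis by simp
  qed
  define S where "S = (\<Union>m::nat. range (cell (1 / (real m + 1)) :: 'a \<Rightarrow> _))"
  have cnt: "countable S" unfolding S_def by (intro countable_UN countable_cells) auto
  have bnd: "norm (\<integral>y. indicator Q y * X n y \<partial>lborel) \<le> 1" if Q: "Q \<in> S" for Q n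
  proof -
    obtain m :: nat and x where Q: "Q = cell (1 / (real m + 1)) x" using Q by (auto simp: S_def)
    have "(\<integral>y. indicator Q y * X n y \<partial>lborel)\<^sup>2 \<le> (1 / (real m + 1)) ^ ?n" unfolding Q by (intro cb) simp
    also have "\<dots> \<le> 1" by (intro power_le_one) auto
    finally show ?thesis by (simp add: abs_square_le_1)
  qed
  have "\<exists>r::nat \<Rightarrow> nat. strict_mono r \<and> (\<forall>Q\<in>S. \<exists>l. (\<lambda>n. \<integral>y. indicator Q y * X (r n) y \<partial>lborel) \<longlonglongrightarrow> l)"
    by (rule function_convergent_subsequence[where f="\<lambda>n Q. \<integral>y. indicator Q y * X n y \<partial>lborel" and M=1 and S=S],
        rule cnt, erule bnd, blast)
  then obtain r :: "nat \<Rightarrow> nat" where r: "strict_mono r"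
    and lim: "\<And>Q. Q \<in> S \<Longrightarrow> \<exists>l. (\<lambda>n. \<integral>y. indicator Q y * X (r n) y \<partial>lborel) \<longlonglongrightarrow> l"
    by blast
  have "\<exists>N. \<forall>m\<ge>N. \<forall>n\<ge>N. (\<integral>x. (X (r m) x - X (r n) x)\<^sup>2 \<partial>lborel) < e" if e: "e > 0" for e
  proof -
    define C where "C = real ?n powr ?p"
    have "(\<lambda>m. (1 / (real m + 1)) powr (2 * s)) \<longlonglongrightarrow> 0" using s by real_asymp
    \<comment> \<open>A difference of two members has form at most 4, and the averaging error
      \<open>4 * C * h powr (2 * s)\<close> is to be below \<open>e / 4\<close>.\<close>
    from tendsto_mult_left[OF this, of "8 * C"] have "(\<lambda>m. 8 * C * (1 / (real m + 1)) powr (2 * s)) \<longlonglongrightarrow> 0" by simp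
    moreover have "e / 2 > 0" using e by simp
    ultimately have "eventually (\<lambda>m. 8 * C * (1 / (real m + 1)) powr (2 * s) < e / 2) sequentially"
      by (rule order_tendstoD(2))
    then obtain m0 :: nat where m0: "8 * C * (1 / (real m0 + 1)) powr (2 * s) < e / 2"
      by (auto simp: eventually_sequentially)
    define h where "h = 1 / (real m0 + 1)"
    have h: "h > 0" by (simp add: h_def)
    have hn: "h ^ ?n > 0" using h by simp
    define A where "A n = cell_avg h (X (r n))" for n
    have [measurable]: "A n \<in> borel_measurable borel" for n unfolding A_def by measurable
    define g where "g x = lim (\<lambda>n. A n x)" for x
    have [measurable]: "g \<in> borel_measurable borel" unfolding g_def by measurable
    have Ag: "(\<lambda>n. A n x) \<longlonglongrightarrow> g x" for x
    proof -
      have "cell h x \<in> S" by (auto simp: S_def h_def)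
      then obtain l where "(\<lambda>n. \<integral>y. indicator (cell h x) y * X (r n) y \<partial>lborel) \<longlonglongrightarrow> l" using lim by blast
      then have "(\<lambda>n. A n x) \<longlonglongrightarrow> l / h ^ ?n"
        unfolding A_def cell_avg_def using h by (intro tendsto_divide tendsto_const) auto
      then show ?thesis unfolding g_def by (simp add: limI)
    qed
    \<comment> \<open>The estimate is on the square of the average, and
      \<open>\<bar>t\<bar> \<le> 1 + t\<^sup>2\<close> avoids a root. The bound depends on
      \<open>h\<close>, which is fixed when dominated convergence is used.\<close>
    define M where "M = 1 + 1 / h ^ ?n"
    have M: "M \<ge> 0" using hn by (simp add: M_def)
    have A_bound: "\<bar>A n x\<bar> \<le> M" for n x
    proof -
      have "(A n x)\<^sup>2 \<le> h ^ ?n / (h ^ ?n)\<^sup>2"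
        unfolding A_def cell_avg_def power_divide using hn by (intro divide_right_mono cb h) auto
      also have "\<dots> = 1 / h ^ ?n" using hn by (simp add: power2_eq_square)
      finally have "(A n x)\<^sup>2 \<le> 1 / h ^ ?n" .
      moreover have "\<bar>A n x\<bar> \<le> 1 + (A n x)\<^sup>2" using abs_mult_le[of 1 "A n x"] by simp
      ultimately show ?thesis by (simp add: M_def)
    qed
    have g_bound: "\<bar>g x\<bar> \<le> M" for x
      using tendsto_rabs[OF Ag[of x]] by (rule LIMSEQ_le_const2) (use A_bound in auto)
    have iM: "integrable lborel (\<lambda>x. (2 * M)\<^sup>2 * indicator U x)" using U_fin by simp
    have dom: "(a - b)\<^sup>2 \<le> (2 * M)\<^sup>2" if "\<bar>a\<bar> \<le> M" "\<bar>b\<bar> \<le> M" for a b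
      using that by (intro power2_le_iff_abs_le[THEN iffD2]) auto
    have iAg: "integrable lborel (\<lambda>x. indicator U x * (A n x - g x)\<^sup>2)"
      and iAA: "integrable lborel (\<lambda>x. indicator U x * (A n x - A m x)\<^sup>2)" for n m
      by (rule Bochner_Integration.integrable_bound[OF iM];
          use dom A_bound g_bound in \<open>auto simp: indicator_def\<close>)+
    have "(\<lambda>n. \<integral>x. indicator U x * (A n x - g x)\<^sup>2 \<partial>lborel) \<longlonglongrightarrow> (\<integral>x. 0 \<partial>(lborel :: 'a measure))"
    proof (rule integral_dominated_convergence[OF _ _ iM])
      show "AE x in lborel. (\<lambda>n. indicator U x * (A n x - g x)\<^sup>2) \<longlonglongrightarrow> 0"
      proof (intro always_eventually allI)
        fix x
        have "(\<lambda>n. indicator U x * (A n x - g x)\<^sup>2) \<longlonglongrightarrow> indicator U x * (g x - g x)\<^sup>2"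
          by (intro tendsto_intros Ag)
        then show "(\<lambda>n. indicator U x * (A n x - g x)\<^sup>2) \<longlonglongrightarrow> 0" by simp
      qed
      show "AE x in lborel. norm (indicator U x * (A n x - g x)\<^sup>2) \<le> (2 * M)\<^sup>2 * indicator U x" for n
        using dom A_bound g_bound by (auto simp: indicator_def)
    qed auto
    then have lim0: "(\<lambda>n. \<integral>x. indicator U x * (A n x - g x)\<^sup>2 \<partial>lborel) \<longlonglongrightarrow> 0" by simp
    have "e / 16 > 0" using e by simp
    then obtain N where N: "\<And>n. n \<ge> N \<Longrightarrow> (\<integral>x. indicator U x * (A n x - g x)\<^sup>2 \<partial>lborel) < e / 16"
      using order_tendstoD(2)[OF lim0] unfolding eventually_sequentially by blast
    have "(\<integral>x. (X (r m) x - X (r n) x)\<^sup>2 \<partial>lborel) < e" if mn: "m \<ge> N" "n \<ge> N" for m n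
    proof -
      define D where "D x = X (r m) x - X (r n) x" for x
      have D: "D \<in> Hs_tilde s U" unfolding D_def[abs_def] using X diff_mem by blast
      have DH: "D \<in> Hs s" using D by (rule Hs_tildeD)
      have [measurable]: "D \<in> borel_measurable borel" by (rule HsD(1)[OF DH])
      have D4: "hs_form s D D \<le> 4"
        using parallelogram[OF X X, of "r m" "r n"] X1[of "r m"] X1[of "r n"] by (simp add: D_def[abs_def])
      have AD: "cell_avg h D x = A m x - A n x" for x
      proof -
        have i: "integrable lborel (\<lambda>y. indicator (cell h x) y * X k y)" for k
          by (rule integrable_cell[OF h HsD(1,2)[OF XH]])
        show ?thesis unfolding A_def cell_avg_def D_def
          using i[of "r m"] i[of "r n"] by (simp add: right_diff_distrib diff_divide_distrib)
      qed
      have 1: "(\<integral>x. (D x - cell_avg h D x)\<^sup>2 \<partial>lborel) < e / 4"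
      proof -
        have "(\<integral>x. (D x - cell_avg h D x)\<^sup>2 \<partial>lborel) \<le> C * h powr (2 * s) * hs_form s D D"
          unfolding C_def by (rule cell_avg_approx(2)[OF s(1) h DH])
        also have "\<dots> \<le> C * h powr (2 * s) * 4" using D4 by (intro mult_left_mono) (auto simp: C_def)
        also have "\<dots> < e / 4" using m0 by (simp add: h_def)
        finally show ?thesis .
      qed
      have 2: "(\<integral>x. indicator U x * (A m x - A n x)\<^sup>2 \<partial>lborel) \<le> e / 4"
      proof -
        have "(\<integral>x. indicator U x * (A m x - A n x)\<^sup>2 \<partial>lborel)
           \<le> (\<integral>x. 2 * (indicator U x * (A m x - g x)\<^sup>2) + 2 * (indicator U x * (A n x - g x)\<^sup>2) \<partial>lborel)"
        proof (intro integral_mono iAA)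
          fix x
          have "(a - b)\<^sup>2 \<le> 2 * (a - c)\<^sup>2 + 2 * (b - c)\<^sup>2" for a b c :: real
            using zero_le_power2[of "(a - c) + (b - c)"] by (simp add: power2_eq_square algebra_simps)
          then show "indicator U x * (A m x - A n x)\<^sup>2 \<le> 2 * (indicator U x * (A m x - g x)\<^sup>2) + 2 * (indicator U x * (A n x - g x)\<^sup>2)"
            by (simp add: indicator_def)
        qed (use iAg in simp)
        also have "\<dots> = 2 * (\<integral>x. indicator U x * (A m x - g x)\<^sup>2 \<partial>lborel) + 2 * (\<integral>x. indicator U x * (A n x - g x)\<^sup>2 \<partial>lborel)"
          using iAg by simp
        also have "\<dots> \<le> e / 4" using N[OF mn(1)] N[OF mn(2)] by simp
        finally show ?thesis .
      qed
      have "(\<integral>x. (D x)\<^sup>2 \<partial>lborel) \<le> (\<integral>x. 2 * (D x - cell_avg h D x)\<^sup>2 + 2 * (indicator U x * (A m x - A n x)\<^sup>2) \<partial>lborel)"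
      proof (rule integral_mono_AE)
        show "integrable lborel (\<lambda>x. 2 * (D x - cell_avg h D x)\<^sup>2 + 2 * (indicator U x * (A m x - A n x)\<^sup>2))"
          using cell_avg_approx(1)[OF s(1) h DH] iAA by simp
        \<comment> \<open>Averages over cells that meet the boundary spill over into the complement
          of \<open>U\<close>. There \<open>D\<close> itself vanishes almost everywhere, so the
          averages are needed on \<open>U\<close> only.\<close>
        show "AE x in lborel. (D x)\<^sup>2 \<le> 2 * (D x - cell_avg h D x)\<^sup>2 + 2 * (indicator U x * (A m x - A n x)\<^sup>2)"
          using Hs_tilde_AE_outside[OF s D U_meas]
        proof eventually_elim
          case (elim x)
          have "a\<^sup>2 \<le> 2 * (a - b)\<^sup>2 + 2 * b\<^sup>2" for a b :: real
            using zero_le_power2[of "a - 2 * b"] by (simp add: power2_eq_square algebra_simps)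
          from this[of "D x" "cell_avg h D x"] elim show ?case by (cases "x \<in> U") (auto simp: AD)
        qed
      qed (rule HsD(2)[OF DH])
      also have "\<dots> = 2 * (\<integral>x. (D x - cell_avg h D x)\<^sup>2 \<partial>lborel) + 2 * (\<integral>x. indicator U x * (A m x - A n x)\<^sup>2 \<partial>lborel)"
        using cell_avg_approx(1)[OF s(1) h DH] iAA by simp
      also have "\<dots> < e" using 1 2 by simp
      finally show ?thesis by (simp add: D_def)
    qed
    then show ?thesis by blast
  qed
  with r show ?thesis by blast
qed

section \<open>Vanishing of functions with vanishing integrals\<close>

text \<open>The positive and negative parts of \<open>h\<close> are densities of two finite measures
  that agree on boxes. Boxes are stable under intersection and generate the Borel sets, so the
  measures agree, and then so do the densities almost everywhere.\<close>

lemma AE_zero_if_box_integrals_zero: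
  fixes h :: "'a::euclidean_space \<Rightarrow> real"
  assumes int: "integrable lborel h"
    and zero: "\<And>a b. (\<integral>x. indicator (box a b) x * h x \<partial>lborel) = 0"
  shows "AE x in lborel. h x = 0"
proof -
  have [measurable]: "h \<in> borel_measurable borel" using borel_measurable_integrable[OF int] by simp
  define P where "P x = max 0 (h x)" for x
  define Q where "Q x = max 0 (- h x)" for x
  have [measurable]: "P \<in> borel_measurable borel" "Q \<in> borel_measurable borel"
    unfolding P_def Q_def by measurable
  have iP: "integrable lborel P" and iQ: "integrable lborel Q"
    unfolding P_def Q_def using int by simp_all
  have box_meas [measurable]: "box a b \<in> sets borel" for a b :: 'a by simp
  have em: "emeasure (density lborel (\<lambda>x. ennreal (R x))) (box a b) = ennreal (\<integral>x. indicator (box a b) x * R x \<partial>lborel)"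
    if R: "integrable lborel R" and R0: "\<And>x. 0 \<le> R x" for R :: "'a \<Rightarrow> real" and a b
  proof -
    have [measurable]: "R \<in> borel_measurable borel" using borel_measurable_integrable[OF R] by simp
    have i: "integrable lborel (\<lambda>x. indicator (box a b) x * R x)"
      using integrable_mult_indicator[OF _ R, of "box a b"] by simp
    have "emeasure (density lborel (\<lambda>x. ennreal (R x))) (box a b) = (\<integral>\<^sup>+x. ennreal (R x) * indicator (box a b) x \<partial>lborel)"
      by (subst emeasure_density) auto
    also have "\<dots> = (\<integral>\<^sup>+x. ennreal (indicator (box a b) x * R x) \<partial>lborel)"
      by (intro nn_integral_cong) (auto simp: indicator_def)
    also have "\<dots> = ennreal (\<integral>x. indicator (box a b) x * R x \<partial>lborel)"
      using R0 by (intro nn_integral_eq_integral i) auto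
    finally show ?thesis .
  qed
  have "density lborel (\<lambda>x. ennreal (P x)) = density lborel (\<lambda>x. ennreal (Q x))"
  proof (rule measure_eqI_generator_eq[where E="range (\<lambda>(a, b). box a b)" and \<Omega>=UNIV and A="\<lambda>n. box (- real n *\<^sub>R One) (real n *\<^sub>R One)"])
    show "Int_stable (range (\<lambda>(a, b). box a b :: 'a set))"
      unfolding Int_stable_def by (force simp: box_Int_box)
    fix X :: "'a set" assume "X \<in> range (\<lambda>(a, b). box a b)"
    then obtain a b where X: "X = box a b" by auto
    have "(\<integral>x. indicator (box a b) x * P x \<partial>lborel) - (\<integral>x. indicator (box a b) x * Q x \<partial>lborel)
        = (\<integral>x. indicator (box a b) x * P x - indicator (box a b) x * Q x \<partial>lborel)"
      using integrable_mult_indicator[OF _ iP, of "box a b"] integrable_mult_indicator[OF _ iQ, of "box a b"]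
      by (intro Bochner_Integration.integral_diff[symmetric]) auto
    also have "(\<lambda>x. indicator (box a b) x * P x - indicator (box a b) x * Q x) = (\<lambda>x. indicator (box a b) x * h x)"
      by (auto simp: P_def Q_def fun_eq_iff max_def indicator_def)
    finally show "emeasure (density lborel (\<lambda>x. ennreal (P x))) X = emeasure (density lborel (\<lambda>x. ennreal (Q x))) X"
      unfolding X using zero[of a b] by (subst (1 2) em) (auto simp: iP iQ P_def Q_def)
  next
    show "sets (density lborel (\<lambda>x. ennreal (P x))) = sigma_sets UNIV (range (\<lambda>(a, b). box a b))"
      by (simp add: borel_eq_box)
    show "sets (density lborel (\<lambda>x. ennreal (Q x))) = sigma_sets UNIV (range (\<lambda>(a, b). box a b))"
      by (simp add: borel_eq_box)
    show "(\<Union>i::nat. box (- real i *\<^sub>R One) (real i *\<^sub>R One)) = (UNIV :: 'a set)"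
    proof (rule UNIV_eq_I[symmetric])
      fix x :: 'a
      obtain n :: nat where "norm x < real n" using reals_Archimedean2 by blast
      have "x \<in> box (- real n *\<^sub>R One) (real n *\<^sub>R One)"
        unfolding mem_box
      proof (rule ballI)
        fix i :: 'a assume i: "i \<in> Basis"
        then have "\<bar>x \<bullet> i\<bar> < real n" using Basis_le_norm[of i x] \<open>norm x < real n\<close> by linarith
        then show "(- real n *\<^sub>R One) \<bullet> i < x \<bullet> i \<and> x \<bullet> i < (real n *\<^sub>R One) \<bullet> i"
          using i by (simp add: abs_less_iff)
      qed
      then show "x \<in> (\<Union>i::nat. box (- real i *\<^sub>R One) (real i *\<^sub>R One))" by blast
    qed
    show "emeasure (density lborel (\<lambda>x. ennreal (P x))) (box (- real i *\<^sub>R One) (real i *\<^sub>R One)) \<noteq> \<infinity>" for i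
      by (subst em) (auto simp: iP P_def)
  qed auto
  then have "AE x in lborel. ennreal (P x) = ennreal (Q x)"
    by (intro sigma_finite_measure.density_unique[OF lborel.sigma_finite_measure_axioms]) auto
  then show ?thesis by eventually_elim (auto simp: P_def Q_def max_def split: if_splits)
qed

text \<open>The fundamental lemma of the calculus of variations with explicit test functions: as
  \<open>c\<close> tends to 0 the bumps tend boundedly to the indicators of boxes.\<close>

lemma AE_zero_if_bump_integrals_zero:
  fixes h :: "'a::euclidean_space \<Rightarrow> real"
  assumes int: "integrable lborel h"
    and zero: "\<And>e f c. box e f \<noteq> {} \<Longrightarrow> cbox e f \<subseteq> cbox a b \<Longrightarrow> c > 0 \<Longrightarrow>
        (\<integral>x. box_bump c e f x * h x \<partial>lborel) = 0"
  shows "AE x in lborel. x \<in> box a b \<longrightarrow> h x = 0"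
proof -
  have [measurable]: "h \<in> borel_measurable borel" using borel_measurable_integrable[OF int] by simp
  have box_meas [measurable]: "box a b \<in> sets borel" for a b :: 'a by simp
  have "AE x in lborel. indicator (box a b) x * h x = 0"
  proof (rule AE_zero_if_box_integrals_zero)
    show "integrable lborel (\<lambda>x. indicator (box a b) x * h x)"
      using integrable_mult_indicator[OF _ int, of "box a b"] by simp
    fix c d :: 'a
    \<comment> \<open>The intersection of two boxes is a box, so cutting \<open>h\<close> off to
      \<open>box a b\<close> reduces the local statement to the global one.\<close>
    obtain e f :: 'a where ef: "box c d \<inter> box a b = box e f"
      using that[OF box_Int_box] .
    have eq: "indicator (box c d) x * (indicator (box a b) x * h x) = indicator (box e f) x * h x" for x
      using ef by (auto simp: indicator_def split: if_splits)
    show "(\<integral>x. indicator (box c d) x * (indicator (box a b) x * h x) \<partial>lborel) = 0"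
    proof (cases "box e f = {}")
      case True
      then show ?thesis unfolding eq by simp
    next
      case False
      have "cbox e f \<subseteq> closure (box a b)"
        using closure_mono[of "box e f" "box a b"] closure_box[OF False] ef by auto
      also have "\<dots> \<subseteq> cbox a b" by (intro closure_minimal box_subset_cbox closed_cbox)
      finally have sub: "cbox e f \<subseteq> cbox a b" .
      have bump_meas [measurable]: "box_bump (1 / (real n + 1)) e f \<in> borel_measurable borel" for n
        by (rule borel_measurable_continuous_onI[OF test_fun_continuous[OF test_fun_box_bump[OF _ False order_refl]]]) simp
      have "(\<lambda>n. \<integral>x. box_bump (1 / (real n + 1)) e f x * h x \<partial>lborel) \<longlonglongrightarrow> (\<integral>x. indicator (box e f) x * h x \<partial>lborel)"
      proof (rule integral_dominated_convergence[where w="\<lambda>x. \<bar>h x\<bar>"])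
        show "AE x in lborel. (\<lambda>n. box_bump (1 / (real n + 1)) e f x * h x) \<longlonglongrightarrow> indicator (box e f) x * h x"
          using box_bump_tendsto[OF False] by (intro always_eventually allI tendsto_mult tendsto_const)
        show "AE x in lborel. norm (box_bump (1 / (real n + 1)) e f x * h x) \<le> \<bar>h x\<bar>" for n
          using box_bump_range[of "1 / (real n + 1)" e f] by (simp add: abs_mult mult_left_le_one_le)
      qed (use int in auto)
      moreover have "(\<integral>x. box_bump (1 / (real n + 1)) e f x * h x \<partial>lborel) = 0" for n
        by (rule zero[OF False sub]) simp
      ultimately show ?thesis unfolding eq using LIMSEQ_unique[OF tendsto_const] by fastforce
    qed
  qed
  then show ?thesis by eventually_elim (auto simp: indicator_def)
qed

section \<open>The Dirichlet problem\<close>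

text \<open>The diagonal bound makes \<open>K * B + A\<close> positive semidefinite although
  \<open>A\<close> need not be, so Cauchy-Schwarz applies to it. Its diagonal is at most
  \<open>2 * K * B\<close>, and subtracting \<open>K * B\<close> again accounts for the factor
  3.\<close>

lemma (in semi_inner) form_bound:
  assumes A: "sym_form V A" and diag: "\<And>u. u \<in> V \<Longrightarrow> \<bar>A u u\<bar> \<le> K * B u u" and K: "K \<ge> 0"
    and u: "u \<in> V" and v: "v \<in> V"
  shows "\<bar>A u v\<bar> \<le> 3 * K * sqrt (B u u) * sqrt (B v v)"
proof -
  interpret A: sym_form V A by (rule A)
  define N where "N u v = K * B u v + A u v" for u v
  interpret N: semi_inner V N
  proof
    show "0 \<le> N u u" if "u \<in> V" for u using diag[OF that] by (simp add: N_def abs_le_iff)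
  qed (auto simp: N_def form_add form_scale A.form_add A.form_scale algebra_simps zero_mem add_mem scale_mem
      form_sym A.form_sym)
  have diagN: "N w w \<le> 2 * K * B w w" if "w \<in> V" for w using diag[OF that] by (simp add: N_def abs_le_iff)
  have "\<bar>N u v\<bar> \<le> sqrt (N u u) * sqrt (N v v)" by (rule N.cauchy_schwarz[OF u v])
  also have "\<dots> \<le> sqrt (2 * K * B u u) * sqrt (2 * K * B v v)"
    using diagN[OF u] diagN[OF v] N.form_nonneg[OF v] form_nonneg[OF u] K by (intro mult_mono real_sqrt_le_mono) auto
  also have "\<dots> = 2 * K * (sqrt (B u u) * sqrt (B v v))"
  proof -
    have "sqrt (2 * K * B u u) * sqrt (2 * K * B v v) = (sqrt (2 * K) * sqrt (2 * K)) * (sqrt (B u u) * sqrt (B v v))"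
      unfolding real_sqrt_mult[of "2 * K"] by (simp only: mult_ac)
    then show ?thesis using K by simp
  qed
  finally have 1: "\<bar>N u v\<bar> \<le> 2 * K * (sqrt (B u u) * sqrt (B v v))" .
  have "\<bar>K * B u v\<bar> \<le> K * (sqrt (B u u) * sqrt (B v v))"
    using cauchy_schwarz[OF u v] K by (simp add: abs_mult mult_left_mono)
  moreover have "A u v = N u v - K * B u v" by (simp add: N_def)
  ultimately show ?thesis using 1 by (simp add: algebra_simps)
qed

text \<open>\<open>Gamma\<close> takes the value 0 exactly at its poles, the nonpositive integers,
  and \<open>- s\<close> lies strictly between two integers. At a pole the quotient, and with it the
  operator, would be 0.\<close>

lemma c_ns_pos:
  assumes "0 < s" "s < 1" shows "c_ns n s > 0"
proof -
  have "Gamma (- s) \<noteq> 0"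
  proof
    assume "Gamma (- s) = 0"
    then obtain k :: int where "- s = real_of_int k" unfolding Gamma_eq_zero_iff by (auto elim!: nonpos_Ints_cases)
    with assms have "- 1 < k" "k < 0" by linarith+
    then show False by simp
  qed
  then show ?thesis using assms unfolding c_ns_def by (intro mult_pos_pos divide_pos_pos) auto
qed

locale potential =
  fixes s :: real and \<Omega> :: "'a::euclidean_space set" and a :: "'a \<Rightarrow> real"
  assumes s: "0 < s" "s < 1" and dom: "open \<Omega>" "bounded \<Omega>" and cont: "continuous_on (closure \<Omega>) a"
begin

text \<open>The potential is known to be continuous on the closure of \<open>\<Omega>\<close> only
  and may be anything elsewhere. Its extension by 0 is a bounded Borel function on the whole
  space.\<close>

definition pot :: "'a \<Rightarrow> real" where "pot x = indicator \<Omega> x * a x"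

lemma pot_measurable [measurable]: "pot \<in> borel_measurable borel"
proof -
  have "(\<lambda>x. indicator \<Omega> x *\<^sub>R a x) \<in> borel_measurable borel"
    using dom by (intro borel_measurable_continuous_on_indicator continuous_on_subset[OF cont] closure_subset) auto
  then show ?thesis by (simp add: pot_def[abs_def])
qed

lemma pot_bounded: "\<exists>M\<ge>0. \<forall>x. \<bar>pot x\<bar> \<le> M"
proof -
  have "compact (closure \<Omega>)" using dom by simp
  then have "bounded (a ` closure \<Omega>)" by (intro compact_imp_bounded compact_continuous_image cont)
  then obtain M where M: "\<And>x. x \<in> closure \<Omega> \<Longrightarrow> \<bar>a x\<bar> \<le> M" unfolding bounded_iff by auto
  have "\<bar>pot x\<bar> \<le> \<bar>M\<bar>" for x
  proof (cases "x \<in> \<Omega>")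
    case True
    then have "\<bar>a x\<bar> \<le> M" by (intro M) (use closure_subset in blast)
    then show ?thesis by (simp add: pot_def True)
  qed (simp add: pot_def)
  then show ?thesis by (intro exI[of _ "\<bar>M\<bar>"]) auto
qed

lemma pot_integral: "(LINT x:\<Omega>|lborel. a x * u x * v x) = (\<integral>x. pot x * (u x * v x) \<partial>lborel)"
  unfolding set_lebesgue_integral_def pot_def by (intro Bochner_Integration.integral_cong) (auto simp: mult.assoc)

lemma pot_integrable: assumes "u \<in> Hs s" "v \<in> Hs s" shows "integrable lborel (\<lambda>x. pot x * (u x * v x))"
proof -
  obtain M where M: "M \<ge> 0" "\<And>x. \<bar>pot x\<bar> \<le> M" using pot_bounded by blast
  have [measurable]: "u \<in> borel_measurable borel" "v \<in> borel_measurable borel" using assms by (simp_all add: HsD)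
  show ?thesis
  proof (rule Bochner_Integration.integrable_bound)
    show "integrable lborel (\<lambda>x. M * \<bar>u x * v x\<bar>)" using integrable_Hs_mult[OF assms] by simp
    show "AE x in lborel. norm (pot x * (u x * v x)) \<le> norm (M * \<bar>u x * v x\<bar>)"
      using M by (auto simp: abs_mult intro!: mult_right_mono always_eventually)
  qed measurable
qed

definition bform :: "('a \<Rightarrow> real) \<Rightarrow> ('a \<Rightarrow> real) \<Rightarrow> real" where
  "bform u v = frac_form s u v + (LINT x:\<Omega>|lborel. a x * u x * v x)"

sublocale bf: sym_form "Hs s" bform
proof -
  interpret G: sym_form "Hs s :: ('a \<Rightarrow> real) set" "gag_form s" by (rule sym_form_gag)
  show "sym_form (Hs s) bform"
  proof
    fix u v w :: "'a \<Rightarrow> real" assume h: "u \<in> Hs s" "v \<in> Hs s" "w \<in> Hs s"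
    have "(\<integral>x. pot x * ((u x + v x) * w x) \<partial>lborel) = (\<integral>x. pot x * (u x * w x) + pot x * (v x * w x) \<partial>lborel)"
      by (intro Bochner_Integration.integral_cong) (auto simp: algebra_simps)
    then show "bform (\<lambda>x. u x + v x) w = bform u w + bform v w"
      unfolding bform_def pot_integral frac_form_def G.form_add[OF h]
      by (simp add: distrib_left pot_integrable h)
  next
    fix u w :: "'a \<Rightarrow> real" and c assume h: "u \<in> Hs s" "w \<in> Hs s"
    have "(\<integral>x. pot x * ((c * u x) * w x) \<partial>lborel) = (\<integral>x. c * (pot x * (u x * w x)) \<partial>lborel)"
      by (intro Bochner_Integration.integral_cong) (auto simp: algebra_simps)
    then show "bform (\<lambda>x. c * u x) w = c * bform u w"
      unfolding bform_def pot_integral frac_form_def G.form_scale[OF h]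
      by (simp add: distrib_left)
  next
    fix u v :: "'a \<Rightarrow> real" assume h: "u \<in> Hs s" "v \<in> Hs s"
    then show "bform u v = bform v u"
      unfolding bform_def pot_integral frac_form_def G.form_sym[OF h] by (simp add: mult.commute)
  qed (auto simp: Hs_add Hs_scale Hs_zero_mem)
qed

lemma pot_diag: assumes M: "\<And>x. \<bar>pot x\<bar> \<le> M" and u: "u \<in> Hs s"
  shows "\<bar>\<integral>x. pot x * (u x * u x) \<partial>lborel\<bar> \<le> M * (\<integral>x. (u x)\<^sup>2 \<partial>lborel)"
proof -
  have "norm (\<integral>x. pot x * (u x * u x) \<partial>lborel) \<le> (\<integral>x. M * (u x)\<^sup>2 \<partial>lborel)"
  proof (rule order_trans[OF integral_norm_bound integral_mono])
    show "norm (pot x * (u x * u x)) \<le> M * (u x)\<^sup>2" for x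
      using M[of x] by (simp add: abs_mult power2_eq_square mult_right_mono)
  qed (use pot_integrable[OF u u] HsD(2)[OF u] in auto)
  then show ?thesis by simp
qed

lemma bform_bound: "\<exists>K\<ge>0. \<forall>u\<in>Hs s. \<forall>v\<in>Hs s. \<bar>bform u v\<bar> \<le> K * sqrt (hs_form s u u) * sqrt (hs_form s v v)"
proof -
  obtain M where M: "M \<ge> 0" "\<And>x. \<bar>pot x\<bar> \<le> M" using pot_bounded by blast
  define k where "k = c_ns DIM('a) s / 2"
  have k: "k > 0" using c_ns_pos[OF s] by (simp add: k_def)
  have diag: "\<bar>bform u u\<bar> \<le> (k + M) * hs_form s u u" if u: "u \<in> Hs s" for u
  proof -
    let ?G = "\<integral>z. gag_kernel s u u z \<partial>lborel2"
    have "\<bar>bform u u\<bar> \<le> \<bar>k * ?G\<bar> + M * (\<integral>x. (u x)\<^sup>2 \<partial>lborel)"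
      unfolding bform_def pot_integral frac_form_def k_def[symmetric] using pot_diag[OF M(2) u] by linarith
    also have "\<bar>k * ?G\<bar> = k * ?G" using k by (simp add: gag_kernel_nonneg)
    also have "k * ?G + M * (\<integral>x. (u x)\<^sup>2 \<partial>lborel) \<le> k * hs_form s u u + M * hs_form s u u"
      using k M L2_le_hs_form[of u s] gag_le_hs_form[of s u] by (intro add_mono mult_left_mono) auto
    finally show ?thesis by (simp add: distrib_right)
  qed
  have "\<bar>bform u v\<bar> \<le> 3 * (k + M) * sqrt (hs_form s u u) * sqrt (hs_form s v v)" if "u \<in> Hs s" "v \<in> Hs s" for u v
    using that k M by (intro Hs.form_bound bf.sym_form_axioms diag) auto
  then show ?thesis using k M by (intro exI[of _ "3 * (k + M)"]) auto
qed

text \<open>The form contains the Gagliardo part with the positive factor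
  \<open>k = c_ns / 2\<close>. The multiple \<open>K = k + M\<close> of the L2 norm supplies the
  missing L2 part of the norm and absorbs a potential that may be negative.\<close>

lemma bform_garding: "\<exists>c>0. \<exists>K\<ge>0. \<forall>u\<in>Hs s. c * hs_form s u u \<le> bform u u + K * (\<integral>x. (u x)\<^sup>2 \<partial>lborel)"
proof -
  obtain M where M: "M \<ge> 0" "\<And>x. \<bar>pot x\<bar> \<le> M" using pot_bounded by blast
  define k where "k = c_ns DIM('a) s / 2"
  have k: "k > 0" using c_ns_pos[OF s] by (simp add: k_def)
  have "k * hs_form s u u \<le> bform u u + (k + M) * (\<integral>x. (u x)\<^sup>2 \<partial>lborel)" if u: "u \<in> Hs s" for u
    using pot_diag[OF M(2) u] unfolding bform_def pot_integral frac_form_def k_def[symmetric] hs_form_def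
    by (simp add: algebra_simps power2_eq_square)
  then show ?thesis using k M by (intro exI[of _ k] conjI exI[of _ "k + M"]) auto
qed

text \<open>The exterior value is subtracted: \<open>u = w + g\<close> with \<open>w\<close> in
  \<open>Hs_tilde s \<Omega>\<close>, which turns the source into \<open>F - bform g\<close>. The
  Fredholm alternative is applied with the squared L2 norm as the weaker quantity.\<close>

theorem solution_exists:
  assumes inj: "not_dirichlet_eigenvalue s \<Omega> a" and F: "F \<in> Hs_tilde_dual s \<Omega>" and g: "g \<in> Hs s"
  shows "\<exists>u. is_solution s \<Omega> a F g u"
proof -
  let ?V = "Hs_tilde s \<Omega>"
  interpret V: semi_inner ?V "hs_form s" by (rule semi_inner_Hs_tilde[OF s])
  have VH: "u \<in> Hs s" if "u \<in> ?V" for u using that by (rule Hs_tildeD)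
  obtain K where K: "K \<ge> 0" "\<And>u v. u \<in> Hs s \<Longrightarrow> v \<in> Hs s \<Longrightarrow> \<bar>bform u v\<bar> \<le> K * sqrt (hs_form s u u) * sqrt (hs_form s v v)"
    using bform_bound by blast
  obtain c L where cL: "c > 0" "L \<ge> 0" "\<And>u. u \<in> Hs s \<Longrightarrow> c * hs_form s u u \<le> bform u u + L * (\<integral>x. (u x)\<^sup>2 \<partial>lborel)"
    using bform_garding by blast
  have F_add: "\<And>u v. u \<in> ?V \<Longrightarrow> v \<in> ?V \<Longrightarrow> F (\<lambda>x. u x + v x) = F u + F v"
    and F_scale: "\<And>u c. u \<in> ?V \<Longrightarrow> F (\<lambda>x. c * u x) = c * F u"
    using F unfolding Hs_tilde_dual_def by blast+
  obtain C where C: "\<And>u. u \<in> ?V \<Longrightarrow> \<bar>F u\<bar> \<le> C * sqrt (hs_form s u u)"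
    using F unfolding Hs_tilde_dual_def Hs_norm_eq by blast
  have "\<exists>w\<in>?V. \<forall>v\<in>?V. bform w v = F v - bform g v"
  proof (rule V.fredholm_alternative[OF complete_Hs_tilde[OF s] _ _ cL(1,2), where q="\<lambda>u. \<integral>x. (u x)\<^sup>2 \<partial>lborel" and M=K])
    show "sym_form ?V bform"
      by unfold_locales (auto simp: V.zero_mem V.add_mem V.scale_mem VH bf.form_add bf.form_scale bf.form_sym)
    show "\<bar>bform u v\<bar> \<le> K * sqrt (hs_form s u u) * sqrt (hs_form s v v)" if "u \<in> ?V" "v \<in> ?V" for u v
      using K(2) VH that by blast
    show "c * hs_form s u u \<le> bform u u + L * (\<integral>x. (u x)\<^sup>2 \<partial>lborel)" if "u \<in> ?V" for u
      using cL(3) VH that by blast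
    show "\<exists>r::nat \<Rightarrow> nat. strict_mono r \<and>
        (\<forall>e>0. \<exists>N. \<forall>m\<ge>N. \<forall>n\<ge>N. (\<integral>x. (X (r m) x - X (r n) x)\<^sup>2 \<partial>lborel) < e)"
      if "\<And>n. X n \<in> ?V" "\<And>n. quad (hs_form s) (X n) \<le> 1" for X :: "nat \<Rightarrow> _"
      by (rule compact_embedding[OF s dom that])
    \<comment> \<open>The eigenvalue hypothesis gives \<open>u = 0\<close> almost everywhere only;
      the form does not see null sets, neither in the integral over points nor in that over
      pairs.\<close>
    show "hs_form s u u = 0" if u: "u \<in> ?V" and z: "\<And>v. v \<in> ?V \<Longrightarrow> bform u v = 0" for u
    proof -
      have "Hs_zero u" using inj u z unfolding not_dirichlet_eigenvalue_def bform_def by blast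
      then have z0: "AE x in lborel. u x = 0" by (simp add: Hs_zero_def)
      have [measurable]: "u \<in> borel_measurable borel" by (rule HsD(1)[OF VH[OF u]])
      have "(\<integral>x. u x * u x \<partial>lborel) = 0"
        by (rule integral_eq_zero_AE) (use z0 in \<open>eventually_elim, simp\<close>)
      moreover have "gag_form s u u = 0"
        by (rule integral_eq_zero_AE)
          (use AE_lborel_fst[OF z0] AE_lborel_snd[OF z0] in \<open>eventually_elim, simp add: gag_kernel_def case_prod_unfold\<close>)
      ultimately show ?thesis by (simp add: hs_form_def)
    qed
    show "bounded_functional ?V (hs_form s) (\<lambda>v. F v - bform g v)"
      unfolding bounded_functional_def
    proof (intro conjI ballI allI exI)
      fix u v c assume u: "u \<in> ?V"
      then show "F (\<lambda>x. c * u x) - bform g (\<lambda>x. c * u x) = c * (F u - bform g u)"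
        by (simp add: F_scale bf.form_scale2 VH g right_diff_distrib)
      show "F (\<lambda>x. u x + v x) - bform g (\<lambda>x. u x + v x) = F u - bform g u + (F v - bform g v)" if "v \<in> ?V"
        using u that by (simp add: F_add bf.form_add2 VH g)
      show "\<bar>F u - bform g u\<bar> \<le> (C + K * sqrt (hs_form s g g)) * sqrt (hs_form s u u)"
        using C[OF u] K(2)[OF g VH[OF u]] by (simp add: distrib_right)
    qed
  qed
  then obtain w where w: "w \<in> ?V" "\<And>v. v \<in> ?V \<Longrightarrow> bform w v = F v - bform g v" by blast
  have "is_solution s \<Omega> a F g (\<lambda>x. w x + g x)" unfolding is_solution_def
  proof (intro conjI ballI)
    show "(\<lambda>x. w x + g x) \<in> Hs s" using w VH g Hs_add by blast
    show "(\<lambda>x. w x + g x - g x) \<in> ?V" using w by simp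
    fix v assume v: "v \<in> ?V"
    have "bform (\<lambda>x. w x + g x) v = F v" using bf.form_add[OF VH[OF w(1)] g VH[OF v]] w(2)[OF v] by simp
    then show "frac_form s (\<lambda>x. w x + g x) v + (LINT x:\<Omega>|lborel. a x * (w x + g x) * v x) = F v"
      by (simp add: bform_def)
  qed
  then show ?thesis by blast
qed

lemma frac_form_cong_AE:
  assumes "AE x in lborel. u x = v x" "u \<in> Hs s" "v \<in> Hs s" "w \<in> Hs s"
  shows "frac_form s u w = frac_form s v w"
proof -
  have [measurable]: "u \<in> borel_measurable borel" "v \<in> borel_measurable borel" "w \<in> borel_measurable borel"
    using assms by (simp_all add: HsD)
  have "gag_form s u w = gag_form s v w"
    by (rule integral_cong_AE)
      (measurable, use AE_lborel_fst[OF assms(1)] AE_lborel_snd[OF assms(1)] in \<open>eventually_elim, simp add: gag_kernel_def case_prod_unfold\<close>)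
  then show ?thesis by (simp add: frac_form_def)
qed

lemma solution_unique:
  assumes inj: "not_dirichlet_eigenvalue s \<Omega> a" and u: "is_solution s \<Omega> a F g u" and v: "is_solution s \<Omega> a F g v"
  shows "AE x in lborel. u x = v x"
proof -
  interpret V: semi_inner "Hs_tilde s \<Omega>" "hs_form s" by (rule semi_inner_Hs_tilde[OF s])
  have uH: "u \<in> Hs s" and vH: "v \<in> Hs s" using u v by (auto simp: is_solution_def)
  have "(\<lambda>x. (u x - g x) - (v x - g x)) \<in> Hs_tilde s \<Omega>"
    using u v unfolding is_solution_def by (intro V.diff_mem[of "\<lambda>x. u x - g x" "\<lambda>x. v x - g x"]) simp_all
  then have d: "(\<lambda>x. u x - v x) \<in> Hs_tilde s \<Omega>" by simp
  have "bform (\<lambda>x. u x - v x) \<phi> = 0" if \<phi>: "\<phi> \<in> Hs_tilde s \<Omega>" for \<phi>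
    using bf.form_diff[OF uH vH Hs_tildeD[OF \<phi>]] u v \<phi> by (simp add: is_solution_def bform_def)
  then have "Hs_zero (\<lambda>x. u x - v x)"
    using inj d unfolding not_dirichlet_eigenvalue_def bform_def by blast
  then show ?thesis by (simp add: Hs_zero_def)
qed

text \<open>The definite description denotes something: a solution is unique only almost everywhere,
  but the functional it induces is the same for all representatives.\<close>

lemma frac_lap_restr_eq:
  assumes inj: "not_dirichlet_eigenvalue s \<Omega> a" and u: "is_solution s \<Omega> a F g u"
  shows "frac_lap_restr s \<Omega> a F W g = (\<lambda>\<phi>. if test_fun W \<phi> then frac_form s u \<phi> else 0)"
  unfolding frac_lap_restr_def
proof (rule the_equality)
  show "\<exists>v. is_solution s \<Omega> a F g v \<and> (\<lambda>\<phi>. if test_fun W \<phi> then frac_form s u \<phi> else 0)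
      = (\<lambda>\<phi>. if test_fun W \<phi> then frac_form s v \<phi> else 0)" using u by blast
  fix \<Lambda> assume "\<exists>v. is_solution s \<Omega> a F g v \<and> \<Lambda> = (\<lambda>\<phi>. if test_fun W \<phi> then frac_form s v \<phi> else 0)"
  then obtain v where v: "is_solution s \<Omega> a F g v" and \<Lambda>: "\<Lambda> = (\<lambda>\<phi>. if test_fun W \<phi> then frac_form s v \<phi> else 0)" by blast
  have "frac_form s v \<phi> = frac_form s u \<phi>" if "test_fun W \<phi>" for \<phi>
    using solution_unique[OF inj v u] u v test_fun_Hs[OF s that]
    by (intro frac_form_cong_AE) (auto simp: is_solution_def)
  then show "\<Lambda> = (\<lambda>\<phi>. if test_fun W \<phi> then frac_form s u \<phi> else 0)" unfolding \<Lambda> by auto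
qed

end

section \<open>Unique continuation\<close>

inductive hpoly :: "nat \<Rightarrow> ('a::euclidean_space \<Rightarrow> real) \<Rightarrow> bool" where
  const: "hpoly 0 (\<lambda>w. c)"
| mult: "hpoly d f \<Longrightarrow> hpoly (Suc d) (\<lambda>w. (w \<bullet> v) * f w)"
| add: "hpoly d f \<Longrightarrow> hpoly d g \<Longrightarrow> hpoly d (\<lambda>w. f w + g w)"

lemma hpoly_scale: "hpoly d f \<Longrightarrow> hpoly d (\<lambda>w. c * f w)"
proof (induction rule: hpoly.induct)
  case (const k) show ?case by (rule hpoly.const)
next
  case (mult d f v)
  have "hpoly (Suc d) (\<lambda>w. (w \<bullet> v) * (c * f w))" by (rule hpoly.mult[OF mult.IH])
  then show ?case by (simp add: mult.left_commute)
next
  case (add d f g)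
  have "hpoly d (\<lambda>w. c * f w + c * g w)" by (rule hpoly.add[OF add.IH])
  then show ?case by (simp add: distrib_left)
qed

lemma hpoly_mult: "hpoly d f \<Longrightarrow> hpoly e g \<Longrightarrow> hpoly (d + e) (\<lambda>w. f w * g w)"
proof (induction rule: hpoly.induct)
  case (const c) then show ?case by (simp add: hpoly_scale)
next
  case (mult d f v)
  have "hpoly (Suc (d + e)) (\<lambda>w. (w \<bullet> v) * (f w * g w))" by (rule hpoly.mult) (use mult in auto)
  then show ?case by (simp add: mult.assoc)
next
  case (add d f f2)
  have "hpoly (d + e) (\<lambda>w. f w * g w + f2 w * g w)" by (rule hpoly.add) (use add in auto)
  then show ?case by (simp add: distrib_right)
qed

lemma hpoly_homogeneous: "hpoly d f \<Longrightarrow> f (c *\<^sub>R w) = c ^ d * f w"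
  by (induction arbitrary: w rule: hpoly.induct) (auto simp: algebra_simps)

lemma hpoly_bound: "hpoly d f \<Longrightarrow> \<exists>C\<ge>0. \<forall>w. \<bar>f w\<bar> \<le> C * norm w ^ d"
proof (induction rule: hpoly.induct)
  case (const c) show ?case by (rule exI[of _ "\<bar>c\<bar>"]) simp
next
  case (mult d f v)
  then obtain C where C: "C \<ge> 0" "\<And>w. \<bar>f w\<bar> \<le> C * norm w ^ d" by blast
  have "\<bar>(w \<bullet> v) * f w\<bar> \<le> (norm v * C) * norm w ^ Suc d" for w
  proof -
    have "\<bar>(w \<bullet> v) * f w\<bar> \<le> (norm w * norm v) * (C * norm w ^ d)"
      unfolding abs_mult using C by (intro mult_mono Cauchy_Schwarz_ineq2) auto
    then show ?thesis by (simp add: mult_ac)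
  qed
  then show ?case using C by (intro exI[of _ "norm v * C"]) auto
next
  case (add d f g)
  then obtain C D where C: "C \<ge> 0" "\<And>w. \<bar>f w\<bar> \<le> C * norm w ^ d" and D: "D \<ge> 0" "\<And>w. \<bar>g w\<bar> \<le> D * norm w ^ d" by blast
  have "\<bar>f w + g w\<bar> \<le> (C + D) * norm w ^ d" for w
    using C(2)[of w] D(2)[of w] by (simp add: distrib_right)
  then show ?case using C D by (intro exI[of _ "C + D"]) auto
qed

text \<open>Degree 0 is separated because \<open>d - 1\<close> is truncated there: the derivative of
  a constant is to be recorded as 0 and not as another constant.\<close>

lemma hpoly_derivative: "hpoly d f \<Longrightarrow> \<exists>f'. (\<forall>w. (f has_derivative f' w) (at w)) \<and>
   (\<forall>b. if d = 0 then \<forall>w. f' w b = 0 else hpoly (d - 1) (\<lambda>w. f' w b))"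
proof (induction rule: hpoly.induct)
  case (const c) show ?case by (rule exI[of _ "\<lambda>w b. 0"]) auto
next
  case (mult d f v)
  then obtain f' where f': "\<And>w. (f has_derivative f' w) (at w)"
    "\<And>b. if d = 0 then \<forall>w. f' w b = 0 else hpoly (d - 1) (\<lambda>w. f' w b)" by blast
  have "((\<lambda>w. (w \<bullet> v) * f w) has_derivative (\<lambda>b. (w \<bullet> v) * f' w b + (b \<bullet> v) * f w)) (at w)" for w
    by (rule has_derivative_mult[OF _ f'(1)]) (auto intro!: derivative_eq_intros)
  moreover have "hpoly d (\<lambda>w. (w \<bullet> v) * f' w b + (b \<bullet> v) * f w)" for b
  proof (cases "d = 0")
    case True
    then show ?thesis using f'(2)[of b] hpoly_scale[OF mult.hyps] by simp
  next
    case False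
    then have "hpoly (Suc (d - 1)) (\<lambda>w. (w \<bullet> v) * f' w b)" using f'(2)[of b] by (intro hpoly.mult) simp
    then show ?thesis using False hpoly_scale[OF mult.hyps] by (intro hpoly.add) simp_all
  qed
  ultimately show ?case by (intro exI[of _ "\<lambda>w b. (w \<bullet> v) * f' w b + (b \<bullet> v) * f w"]) simp
next
  case (add d f g)
  then obtain f' g' where f': "\<And>w. (f has_derivative f' w) (at w)"
    "\<And>b. if d = 0 then \<forall>w. f' w b = 0 else hpoly (d - 1) (\<lambda>w. f' w b)"
    and g': "\<And>w. (g has_derivative g' w) (at w)"
    "\<And>b. if d = 0 then \<forall>w. g' w b = 0 else hpoly (d - 1) (\<lambda>w. g' w b)" by blast
  have "if d = 0 then \<forall>w. f' w b + g' w b = 0 else hpoly (d - 1) (\<lambda>w. f' w b + g' w b)" for b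
    using f'(2)[of b] g'(2)[of b] by (auto intro: hpoly.add split: if_splits)
  then show ?case using f'(1) g'(1) by (intro exI[of _ "\<lambda>w b. f' w b + g' w b"]) (auto intro: has_derivative_add)
qed

lemma hpoly_measurable [measurable_dest]: "hpoly d f \<Longrightarrow> f \<in> borel_measurable borel"
  by (induction rule: hpoly.induct) auto

text \<open>All polynomials, as finite sums of homogeneous ones. This is the class to which the
  approximants of the Stone-Weierstrass theorem are matched.\<close>

inductive hpoly_sum :: "('a::euclidean_space \<Rightarrow> real) \<Rightarrow> bool" where
  base: "hpoly d f \<Longrightarrow> hpoly_sum f"
| add: "hpoly_sum f \<Longrightarrow> hpoly_sum g \<Longrightarrow> hpoly_sum (\<lambda>w. f w + g w)"

lemma hpoly_sum_mult: "hpoly_sum f \<Longrightarrow> hpoly_sum g \<Longrightarrow> hpoly_sum (\<lambda>w. f w * g w)"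
proof (induction rule: hpoly_sum.induct)
  case (base d f)
  from base(2) base(1) show ?case
  proof (induction rule: hpoly_sum.induct)
    case (base e g) then show ?case using hpoly_mult hpoly_sum.base by blast
  next
    case (add g g2)
    have "hpoly_sum (\<lambda>w. f w * g w + f w * g2 w)" by (rule hpoly_sum.add) (use add in auto)
    then show ?case by (simp add: distrib_left)
  qed
next
  case (add f f2)
  have "hpoly_sum (\<lambda>w. f w * g w + f2 w * g w)" by (rule hpoly_sum.add) (use add in auto)
  then show ?case by (simp add: distrib_right)
qed

lemma real_polynomial_function_hpoly_sum: "real_polynomial_function f \<Longrightarrow> hpoly_sum f"
proof (induction rule: real_polynomial_function.induct)
  case (linear f)
  have lin: "linear f" using linear by (simp add: bounded_linear.linear)
  have "f w = w \<bullet> (\<Sum>b\<in>Basis. f b *\<^sub>R b)" for w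
  proof -
    have "f w = f (\<Sum>b\<in>Basis. (w \<bullet> b) *\<^sub>R b)" by (simp add: euclidean_representation)
    also have "\<dots> = (\<Sum>b\<in>Basis. (w \<bullet> b) * f b)" using lin by (simp add: linear_sum linear_scale)
    finally show ?thesis by (simp add: inner_sum_right mult.commute)
  qed
  then have eq: "f = (\<lambda>w. (w \<bullet> (\<Sum>b\<in>Basis. f b *\<^sub>R b)) * 1)"
    unfolding mult_1_right by (rule ext)
  show ?case
    by (rule arg_cong[where f=hpoly_sum, OF eq, THEN iffD2, OF hpoly_sum.base[OF hpoly.mult[OF hpoly.const]]])
qed (auto intro: hpoly_sum.intros hpoly.const hpoly_sum_mult)

lemma has_derivative_norm_powr:
  fixes w :: "'a::euclidean_space"
  assumes "w \<noteq> 0"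
  shows "((\<lambda>w. norm w powr (- q)) has_derivative (\<lambda>b. - q * (w \<bullet> b) * norm w powr (- (q + 2)))) (at w)"
proof -
  have pos: "norm w > 0" using assms by simp
  have "((\<lambda>z. z powr (- q)) has_derivative (*) (- q * norm w powr (- q - 1))) (at (norm w))"
    using has_real_derivative_powr[OF pos, of "- q"] unfolding has_field_derivative_def .
  from has_derivative_compose[OF has_derivative_norm[OF assms] this]
  have d: "((\<lambda>w. norm w powr (- q)) has_derivative (\<lambda>b. (- q * norm w powr (- q - 1)) * (b \<bullet> sgn w))) (at w)" .
  have e: "(- q * norm w powr (- q - 1)) * (b \<bullet> sgn w) = - q * (w \<bullet> b) * norm w powr (- (q + 2))" for b
  proof -
    have "norm w powr (- q - 1) = norm w * norm w powr (- (q + 2))"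
    proof -
      have "norm w powr (- q - 1) = norm w powr (1 + - (q + 2))" by (rule arg_cong[where f="\<lambda>r. _ powr r"]) simp
      also have "\<dots> = norm w * norm w powr (- (q + 2))" unfolding powr_add using pos by simp
      finally show ?thesis .
    qed
    moreover have "b \<bullet> sgn w = (w \<bullet> b) / norm w" by (simp add: sgn_div_norm inner_commute divide_inverse)
    ultimately show ?thesis using pos by simp
  qed
  show ?thesis by (rule has_derivative_eq_rhs[OF d]) (rule ext, rule e)
qed

section \<open>Kernels whose convolution with \<open>u\<close> vanishes near
  \<open>x0\<close>\<close>

locale ucp =
  fixes s :: real and u :: "'a::euclidean_space \<Rightarrow> real" and x0 :: 'a and R :: real
  assumes s: "0 < s" "s < 1" and R: "R > 0"
    and u_meas [measurable]: "u \<in> borel_measurable borel" and u_L2: "integrable lborel (\<lambda>x. (u x)\<^sup>2)"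
    and u_zero: "\<And>x. x \<in> ball x0 R \<Longrightarrow> u x = 0"
begin

definition p :: real where "p = real DIM('a) + 2 * s"

lemma p_gt: "p > real DIM('a)" "p > 0" using s by (auto simp: p_def intro: add_pos_pos)

text \<open>The density of the finite signed measure that is to be shown zero. Its absolute value
  also majorises, up to a constant, every integrand that occurs.\<close>

definition g :: "'a \<Rightarrow> real" where "g y = u y * norm (x0 - y) powr (- p)"

text \<open>A product of two square-integrable functions: as \<open>u\<close> vanishes near
  \<open>x0\<close> the kernel may be cut off there, and its square is integrable at infinity since
  \<open>2 * p\<close> exceeds the dimension.\<close>

lemma g_integrable: "integrable lborel g"
proof -
  have [measurable]: "{w::'a. R \<le> norm w} \<in> sets borel" by measurable
  let ?k = "\<lambda>y. indicator {w. R \<le> norm w} (x0 - y) * norm (x0 - y) powr (- p)"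
  have "integrable lborel (\<lambda>w::'a. indicator {w. R \<le> norm w} w * norm w powr (- (2 * p)))"
    using p_gt R by (intro integrable_powr_tail) auto
  then have "integrable lborel (\<lambda>y. indicator {w. R \<le> norm w} (x0 - y) * norm (x0 - y) powr (- (2 * p)))"
    by (intro integrable_lborel_reflect[where f="\<lambda>w. indicator {w. R \<le> norm w} w * norm w powr (- (2 * p))"]) measurable
  moreover have "(?k y)\<^sup>2 = indicator {w. R \<le> norm w} (x0 - y) * norm (x0 - y) powr (- (2 * p))" for y
    by (simp add: indicator_def power2_eq_square powr_add[symmetric])
  ultimately have k2: "integrable lborel (\<lambda>y. (?k y)\<^sup>2)" by simp
  have "integrable lborel (\<lambda>y. u y * ?k y)"
    by (rule integrable_mult_L2[OF _ _ u_L2 k2]) measurable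
  moreover have "u y * ?k y = g y" for y
    using u_zero[of y] by (auto simp: g_def indicator_def dist_norm)
  ultimately show ?thesis by simp
qed

lemma g_measurable [measurable]: "g \<in> borel_measurable borel"
  unfolding g_def[abs_def] by measurable

text \<open>Restricting \<open>x\<close> to the half ball keeps \<open>x - y\<close> away from the
  singularity for every \<open>y\<close> that \<open>u\<close> charges, and makes the distances to
  \<open>x\<close> and to \<open>x0\<close> comparable.\<close>

lemma dist_lower:
  assumes x: "x \<in> ball x0 (R / 2)" and y: "u y \<noteq> 0"
  shows "norm (x - y) \<ge> R / 2" "norm (x - y) \<ge> norm (x0 - y) / 2"
proof -
  have "\<not> norm (x0 - y) < R" using u_zero[of y] y by (auto simp: dist_norm)
  moreover have "norm (x0 - x) < R / 2" using x by (simp add: dist_norm)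
  moreover have "norm (x0 - y) \<le> norm (x0 - x) + norm (x - y)"
    using norm_triangle_ineq[of "x0 - x" "x - y"] by simp
  ultimately show "norm (x - y) \<ge> R / 2" "norm (x - y) \<ge> norm (x0 - y) / 2" by linarith+
qed

text \<open>Only arguments of norm at least \<open>R / 2\<close> occur where \<open>u\<close> is
  nonzero, so no condition is imposed near the singularity at the origin.\<close>

definition decaying :: "('a \<Rightarrow> real) \<Rightarrow> bool" where
  "decaying \<kappa> \<longleftrightarrow> \<kappa> \<in> borel_measurable borel \<and> (\<exists>C\<ge>0. \<forall>w. norm w \<ge> R / 2 \<longrightarrow> \<bar>\<kappa> w\<bar> \<le> C * norm w powr (- p))"

text \<open>The identity is required on an open ball and not at \<open>x0\<close> alone, since it
  has to be differentiated in \<open>x\<close>.\<close>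

definition annihilated :: "('a \<Rightarrow> real) \<Rightarrow> bool" where
  "annihilated \<kappa> \<longleftrightarrow> (\<forall>x\<in>ball x0 (R / 2). (\<integral>y. u y * \<kappa> (x - y) \<partial>lborel) = 0)"

text \<open>The majorant is uniform in \<open>x\<close>, which is what dominated convergence needs.
  The factor \<open>2 powr p\<close> pays for replacing the distance to \<open>x\<close> by that to
  \<open>x0\<close>.\<close>

lemma decaying_bound:
  assumes "decaying \<kappa>"
  shows "\<exists>C\<ge>0. \<forall>x\<in>ball x0 (R / 2). \<forall>y. \<bar>u y\<bar> * \<bar>\<kappa> (x - y)\<bar> \<le> C * \<bar>g y\<bar>"
proof -
  obtain C where C: "C \<ge> 0" "\<And>w. norm w \<ge> R / 2 \<Longrightarrow> \<bar>\<kappa> w\<bar> \<le> C * norm w powr (- p)"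
    using assms by (auto simp: decaying_def)
  have "\<bar>u y\<bar> * \<bar>\<kappa> (x - y)\<bar> \<le> (C * 2 powr p) * \<bar>g y\<bar>" if x: "x \<in> ball x0 (R / 2)" for x y
  proof (cases "u y = 0")
    case False
    note d = dist_lower[OF x False]
    have pos: "norm (x0 - y) > 0" using u_zero[of y] False R by (auto simp: dist_norm)
    have "norm (x - y) powr (- p) \<le> (norm (x0 - y) / 2) powr (- p)"
      using d pos p_gt by (intro powr_mono2') auto
    also have "\<dots> = 2 powr p * norm (x0 - y) powr (- p)" using pos by (simp add: powr_divide powr_minus field_simps)
    finally have "C * norm (x - y) powr (- p) \<le> C * (2 powr p * norm (x0 - y) powr (- p))"
      using C(1) by (intro mult_left_mono)
    then have "\<bar>\<kappa> (x - y)\<bar> \<le> C * (2 powr p * norm (x0 - y) powr (- p))" using C(2)[OF d(1)] by linarith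
    then have "\<bar>u y\<bar> * \<bar>\<kappa> (x - y)\<bar> \<le> \<bar>u y\<bar> * (C * (2 powr p * norm (x0 - y) powr (- p)))"
      by (intro mult_left_mono) auto
    then show ?thesis by (simp add: g_def abs_mult mult_ac)
  qed (simp add: g_def)
  then show ?thesis using C(1) by (intro exI[of _ "C * 2 powr p"]) auto
qed

lemma decaying_integrable:
  assumes k: "decaying \<kappa>" and x: "x \<in> ball x0 (R / 2)"
  shows "integrable lborel (\<lambda>y. u y * \<kappa> (x - y))"
proof -
  have [measurable]: "\<kappa> \<in> borel_measurable borel" using k by (simp add: decaying_def)
  obtain C where C: "C \<ge> 0" "\<And>y. \<bar>u y\<bar> * \<bar>\<kappa> (x - y)\<bar> \<le> C * \<bar>g y\<bar>" using decaying_bound[OF k] x by blast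
  show ?thesis
  proof (rule Bochner_Integration.integrable_bound)
    show "integrable lborel (\<lambda>y. C * \<bar>g y\<bar>)" using g_integrable by simp
    show "AE y in lborel. norm (u y * \<kappa> (x - y)) \<le> norm (C * \<bar>g y\<bar>)"
      using C by (simp add: abs_mult)
  qed measurable
qed

lemma decaying_add:
  assumes "decaying \<kappa>" "decaying \<mu>" shows "decaying (\<lambda>w. \<kappa> w + \<mu> w)"
proof -
  obtain C D where C: "C \<ge> 0" "\<And>w. norm w \<ge> R / 2 \<Longrightarrow> \<bar>\<kappa> w\<bar> \<le> C * norm w powr (- p)"
    and D: "D \<ge> 0" "\<And>w. norm w \<ge> R / 2 \<Longrightarrow> \<bar>\<mu> w\<bar> \<le> D * norm w powr (- p)"
    using assms unfolding decaying_def by blast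
  have "\<bar>\<kappa> w + \<mu> w\<bar> \<le> (C + D) * norm w powr (- p)" if "norm w \<ge> R / 2" for w
    using C(2)[OF that] D(2)[OF that] by (simp add: distrib_right)
  then show ?thesis using assms C D unfolding decaying_def
    by (intro conjI exI[of _ "C + D"]) auto
qed

lemma decaying_scale:
  assumes "decaying \<kappa>" shows "decaying (\<lambda>w. c * \<kappa> w)"
proof -
  obtain C where C: "C \<ge> 0" "\<And>w. norm w \<ge> R / 2 \<Longrightarrow> \<bar>\<kappa> w\<bar> \<le> C * norm w powr (- p)"
    using assms unfolding decaying_def by blast
  have "\<bar>c * \<kappa> w\<bar> \<le> (\<bar>c\<bar> * C) * norm w powr (- p)" if "norm w \<ge> R / 2" for w
    using mult_left_mono[OF C(2)[OF that], of "\<bar>c\<bar>"] by (simp add: abs_mult mult.assoc)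
  then show ?thesis using assms C unfolding decaying_def
    by (intro conjI exI[of _ "\<bar>c\<bar> * C"]) auto
qed

lemma annihilated_add:
  assumes "decaying \<kappa>" "decaying \<mu>" "annihilated \<kappa>" "annihilated \<mu>" shows "annihilated (\<lambda>w. \<kappa> w + \<mu> w)"
  using assms decaying_integrable unfolding annihilated_def by (simp add: distrib_left)

lemma annihilated_scale: "annihilated \<kappa> \<Longrightarrow> annihilated (\<lambda>w. c * \<kappa> w)"
  unfolding annihilated_def by (simp add: mult.left_commute)

text \<open>Differentiation under the integral sign in the direction \<open>b\<close>. The
  difference quotients integrate to 0, and the mean value theorem rewrites them as values of
  \<open>\<kappa>'\<close> at points of the half ball, which have a common majorant. The derivative
  is assumed away from the origin only, because \<open>x - y\<close> never meets it along the
  segments used.\<close>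

lemma annihilated_derivative:
  assumes k: "decaying \<kappa>" and k': "decaying \<kappa>'" and ann: "annihilated \<kappa>"
    and deriv: "\<And>w. w \<noteq> 0 \<Longrightarrow> \<exists>D. (\<kappa> has_derivative D) (at w) \<and> D b = \<kappa>' w"
  shows "annihilated \<kappa>'"
  unfolding annihilated_def
proof
  fix x assume x: "x \<in> ball x0 (R / 2)"
  have [measurable]: "\<kappa> \<in> borel_measurable borel" "\<kappa>' \<in> borel_measurable borel"
    using k k' by (auto simp: decaying_def)
  obtain C where C: "C \<ge> 0" "\<And>x y. x \<in> ball x0 (R / 2) \<Longrightarrow> \<bar>u y\<bar> * \<bar>\<kappa>' (x - y)\<bar> \<le> C * \<bar>g y\<bar>"
    using decaying_bound[OF k'] by blast
  \<comment> \<open>The segment from \<open>x\<close> to \<open>x + \<epsilon> b\<close> stays in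
    the open half ball; adding 1 in the denominator allows \<open>b = 0\<close>.\<close>
  define \<epsilon> where "\<epsilon> = (R / 2 - norm (x - x0)) / (norm b + 1)"
  have e: "\<epsilon> > 0" using x by (auto simp: \<epsilon>_def dist_norm norm_minus_commute intro!: divide_pos_pos add_nonneg_pos)
  have seg: "x + t *\<^sub>R b \<in> ball x0 (R / 2)" if "0 \<le> t" "t \<le> \<epsilon>" for t
  proof -
    have "norm (x + t *\<^sub>R b - x0) \<le> norm (x - x0) + t * norm b"
      using norm_triangle_ineq[of "x - x0" "t *\<^sub>R b"] that by (simp add: algebra_simps)
    also have "t * norm b \<le> \<epsilon> * norm b" using that by (intro mult_right_mono) auto
    also have "\<epsilon> * norm b < \<epsilon> * (norm b + 1)" using e by simp
    also have "\<epsilon> * (norm b + 1) = R / 2 - norm (x - x0)"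
    proof -
      have "norm b + 1 > 0" by (rule add_nonneg_pos) auto
      then show ?thesis by (simp add: \<epsilon>_def)
    qed
    finally show ?thesis by (simp add: dist_norm norm_minus_commute)
  qed
  have path: "((\<lambda>t. \<kappa> (w + t *\<^sub>R b)) has_real_derivative \<kappa>' (w + t *\<^sub>R b)) (at t)" if nz: "w + t *\<^sub>R b \<noteq> 0" for w t
  proof -
    obtain D where D: "(\<kappa> has_derivative D) (at (w + t *\<^sub>R b))" "D b = \<kappa>' (w + t *\<^sub>R b)" using deriv[OF nz] by blast
    have "((\<lambda>t. w + t *\<^sub>R b) has_derivative (\<lambda>h. h *\<^sub>R b)) (at t)" by (auto intro!: derivative_eq_intros)
    from has_derivative_compose[OF this D(1)]
    have "((\<lambda>t. \<kappa> (w + t *\<^sub>R b)) has_derivative (\<lambda>h. D (h *\<^sub>R b))) (at t)" .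
    moreover have "D (h *\<^sub>R b) = \<kappa>' (w + t *\<^sub>R b) * h" for h
      using D(2) linear_scale[OF has_derivative_linear[OF D(1)]] by simp
    ultimately show ?thesis by (simp add: has_field_derivative_def)
  qed
  define t where "t n = \<epsilon> / (real n + 1)" for n
  have t: "0 < t n" "t n \<le> \<epsilon>" for n using e by (auto simp: t_def field_simps)
  have t_lim: "t \<longlonglongrightarrow> 0" unfolding t_def by real_asymp
  let ?q = "\<lambda>n y. (u y * \<kappa> (x + t n *\<^sub>R b - y) - u y * \<kappa> (x - y)) / t n"
  have lim: "(\<lambda>n. \<integral>y. ?q n y \<partial>lborel) \<longlonglongrightarrow> (\<integral>y. u y * \<kappa>' (x - y) \<partial>lborel)"
  proof (rule integral_dominated_convergence[where w="\<lambda>y. C * \<bar>g y\<bar>"])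
    show "integrable lborel (\<lambda>y. C * \<bar>g y\<bar>)" using g_integrable by simp
    show "AE y in lborel. (\<lambda>n. ?q n y) \<longlonglongrightarrow> u y * \<kappa>' (x - y)"
    proof (intro always_eventually allI)
      fix y
      show "(\<lambda>n. ?q n y) \<longlonglongrightarrow> u y * \<kappa>' (x - y)"
      proof (cases "u y = 0")
        case False
        have "x - y \<noteq> 0" using dist_lower(1)[OF x False] R by auto
        then have "((\<lambda>t. \<kappa> ((x - y) + t *\<^sub>R b)) has_real_derivative \<kappa>' (x - y)) (at 0)" using path[of "x - y" 0] by simp
        then have "((\<lambda>h. (\<kappa> ((x - y) + h *\<^sub>R b) - \<kappa> (x - y)) / h) \<longlongrightarrow> \<kappa>' (x - y)) (at 0)" by (simp add: DERIV_def)
        moreover have "filterlim t (at 0) sequentially"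
          using t_lim t(1) by (intro filterlim_atI) (auto simp: less_imp_neq[symmetric])
        ultimately have "(\<lambda>n. (\<kappa> ((x - y) + t n *\<^sub>R b) - \<kappa> (x - y)) / t n) \<longlonglongrightarrow> \<kappa>' (x - y)"
          by (rule filterlim_compose)
        then have "(\<lambda>n. u y * ((\<kappa> ((x - y) + t n *\<^sub>R b) - \<kappa> (x - y)) / t n)) \<longlonglongrightarrow> u y * \<kappa>' (x - y)"
          by (intro tendsto_mult tendsto_const)
        then show ?thesis by (simp add: algebra_simps diff_divide_distrib)
      qed simp
    qed
    show "AE y in lborel. norm (?q n y) \<le> C * \<bar>g y\<bar>" for n
    proof (intro always_eventually allI)
      fix y
      show "norm (?q n y) \<le> C * \<bar>g y\<bar>"
      proof (cases "u y = 0")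
        case False
        have nz: "(x - y) + r *\<^sub>R b \<noteq> 0" if "0 \<le> r" "r \<le> t n" for r
        proof -
          have "r \<le> \<epsilon>" using that(2) t(2)[of n] by linarith
          from dist_lower(1)[OF seg[OF that(1) this] False] R show ?thesis by (auto simp: algebra_simps)
        qed
        obtain r where r: "0 < r" "r < t n"
          "\<kappa> ((x - y) + t n *\<^sub>R b) - \<kappa> ((x - y) + 0 *\<^sub>R b) = (t n - 0) * \<kappa>' ((x - y) + r *\<^sub>R b)"
          using MVT2[OF t(1)[of n], of "\<lambda>r. \<kappa> ((x - y) + r *\<^sub>R b)" "\<lambda>r. \<kappa>' ((x - y) + r *\<^sub>R b)"] path nz by blast
        have "?q n y = u y * \<kappa>' ((x - y) + r *\<^sub>R b)"
          using r(3) t(1)[of n] by (simp add: algebra_simps diff_divide_distrib[symmetric] right_diff_distrib[symmetric])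
        moreover have "x + r *\<^sub>R b \<in> ball x0 (R / 2)" using r t(2)[of n] by (intro seg) auto
        ultimately show ?thesis using C(2)[of "x + r *\<^sub>R b" y] by (simp add: abs_mult algebra_simps)
      qed (use C in simp)
    qed
  qed measurable
  have zero: "(\<integral>y. ?q n y \<partial>lborel) = 0" for n
  proof -
    have xt: "x + t n *\<^sub>R b \<in> ball x0 (R / 2)" using t[of n] by (intro seg) auto
    have "(\<integral>y. ?q n y \<partial>lborel) = (\<integral>y. u y * \<kappa> (x + t n *\<^sub>R b - y) - u y * \<kappa> (x - y) \<partial>lborel) / t n" by simp
    also have "(\<integral>y. u y * \<kappa> (x + t n *\<^sub>R b - y) - u y * \<kappa> (x - y) \<partial>lborel)
       = (\<integral>y. u y * \<kappa> (x + t n *\<^sub>R b - y) \<partial>lborel) - (\<integral>y. u y * \<kappa> (x - y) \<partial>lborel)"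
      by (intro Bochner_Integration.integral_diff decaying_integrable k x xt)
    also have "\<dots> = 0" using ann x xt by (simp add: annihilated_def)
    finally show ?thesis by simp
  qed
  from lim have "(\<lambda>n::nat. 0) \<longlonglongrightarrow> (\<integral>y. u y * \<kappa>' (x - y) \<partial>lborel)" unfolding zero .
  then show "(\<integral>y. u y * \<kappa>' (x - y) \<partial>lborel) = 0" by (rule LIMSEQ_const_iff[THEN iffD1, symmetric])
qed

end

section \<open>Raising the exponent and the degree of the kernels\<close>

context ucp
begin

lemma centre: "x0 \<in> ball x0 (R / 2)"
  using R by simp

lemma hpoly_decaying:
  assumes f: "hpoly d f" and q: "q \<ge> p + real d"
  shows "decaying (\<lambda>w. f w * norm w powr (- q))"
proof -
  obtain C where C: "C \<ge> 0" "\<And>w. \<bar>f w\<bar> \<le> C * norm w ^ d" using hpoly_bound[OF f] by blast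
  have [measurable]: "f \<in> borel_measurable borel" by (rule hpoly_measurable[OF f])
  let ?D = "C * (R / 2) powr (p + real d - q)"
  have "\<bar>f w * norm w powr (- q)\<bar> \<le> ?D * norm w powr (- p)" if w: "norm w \<ge> R / 2" for w
  proof -
    have pos: "norm w > 0" using w R by linarith
    have "\<bar>f w * norm w powr (- q)\<bar> \<le> (C * norm w ^ d) * norm w powr (- q)"
      unfolding abs_mult using C(2)[of w] by (intro mult_mono) auto
    also have "\<dots> = C * (norm w powr (p + real d - q) * norm w powr (- p))"
      using pos by (simp add: powr_realpow[symmetric] powr_add[symmetric])
    also have "\<dots> \<le> C * ((R / 2) powr (p + real d - q) * norm w powr (- p))"
      using q w R C(1) by (intro mult_left_mono mult_right_mono powr_mono2') auto
    finally show ?thesis by (simp add: mult.assoc)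
  qed
  then show ?thesis using C(1) unfolding decaying_def by (intro conjI exI[of _ ?D]) auto
qed

lemma decaying_annihilated_sum:
  assumes "finite B" "\<And>b. b \<in> B \<Longrightarrow> decaying (\<kappa> b) \<and> annihilated (\<kappa> b)"
  shows "decaying (\<lambda>w. \<Sum>b\<in>B. \<kappa> b w) \<and> annihilated (\<lambda>w. \<Sum>b\<in>B. \<kappa> b w)"
  using assms
proof (induction B rule: finite_induct)
  case empty
  show ?case by (auto simp: decaying_def annihilated_def intro: exI[of _ 0])
next
  case (insert b B)
  then show ?case by (simp add: decaying_add annihilated_add)
qed

text \<open>The Laplacian is a sum of second derivatives, each of which preserves annihilation. Its
  coefficient \<open>q * (q + 2 - n)\<close> may be divided out because \<open>q \<ge> p\<close>
  exceeds the dimension \<open>n\<close>.\<close>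

lemma laplace_step:
  assumes q: "q \<ge> p" and ann: "annihilated (\<lambda>w. norm w powr (- q))"
  shows "annihilated (\<lambda>w. norm w powr (- (q + 2)))"
proof -
  have q0: "q > 0" using q p_gt by linarith
  have h1: "hpoly 1 (\<lambda>w. (w \<bullet> b) * c)" for b :: 'a and c using hpoly.mult[OF hpoly.const] by simp
  have h2: "hpoly 2 (\<lambda>w. (w \<bullet> b) * ((w \<bullet> b) * c))" for b :: 'a and c
    using hpoly.mult[OF h1] by (simp add: numeral_2_eq_2)
  \<comment> \<open>\<open>\<kappa>1 b\<close> and \<open>\<kappa>2 b\<close> are the first and
    second derivatives of \<open>norm w powr (- q)\<close> in the direction of a unit vector
    \<open>b\<close>.\<close>
  define \<kappa>1 where "\<kappa>1 b w = ((w \<bullet> b) * (- q)) * norm w powr (- (q + 2))" for b w :: 'a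
  define \<kappa>2 where "\<kappa>2 b w = (- q) * norm w powr (- (q + 2)) + ((w \<bullet> b) * ((w \<bullet> b) * (q * (q + 2)))) * norm w powr (- (q + 4))" for b w :: 'a
  have d0: "decaying (\<lambda>w. norm w powr (- q))"
    using hpoly_decaying[OF hpoly.const[of 1], of q] q by simp
  have d1: "decaying (\<kappa>1 b)" for b
    unfolding \<kappa>1_def[abs_def] by (rule hpoly_decaying[OF h1]) (use q in simp)
  have d2: "decaying (\<kappa>2 b)" for b
    unfolding \<kappa>2_def[abs_def]
    by (intro decaying_add hpoly_decaying[OF hpoly.const] hpoly_decaying[OF h2]) (use q in auto)
  have a1: "annihilated (\<kappa>1 b)" for b
  proof (rule annihilated_derivative[OF d0 d1 ann])
    fix w :: 'a assume "w \<noteq> 0"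
    note d = has_derivative_norm_powr[OF this, of q]
    show "\<exists>D. ((\<lambda>w. norm w powr (- q)) has_derivative D) (at w) \<and> D b = \<kappa>1 b w"
      by (rule exI, rule conjI, rule d) (simp add: \<kappa>1_def)
  qed
  have a2: "annihilated (\<kappa>2 b)" if b: "b \<in> Basis" for b
  proof (rule annihilated_derivative[OF d1 d2 a1])
    fix w :: 'a assume w: "w \<noteq> 0"
    have l: "((\<lambda>w. (w \<bullet> b) * (- q)) has_derivative (\<lambda>h. (h \<bullet> b) * (- q))) (at w)"
      by (auto intro!: derivative_eq_intros)
    have "(\<kappa>1 b has_derivative (\<lambda>h. ((w \<bullet> b) * (- q)) * (- (q + 2) * (w \<bullet> h) * norm w powr (- (q + 2 + 2)))
         + (h \<bullet> b) * (- q) * norm w powr (- (q + 2)))) (at w)"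
      unfolding \<kappa>1_def[abs_def] by (rule has_derivative_mult[OF l has_derivative_norm_powr[OF w]])
    moreover have "((w \<bullet> b) * (- q)) * (- (q + 2) * (w \<bullet> b) * norm w powr (- (q + 2 + 2)))
         + (b \<bullet> b) * (- q) * norm w powr (- (q + 2)) = \<kappa>2 b w"
      using b by (simp add: \<kappa>2_def inner_same_Basis algebra_simps)
    ultimately show "\<exists>D. (\<kappa>1 b has_derivative D) (at w) \<and> D b = \<kappa>2 b w" by blast
  qed
  have "annihilated (\<lambda>w. \<Sum>b\<in>Basis. \<kappa>2 b w)"
    using decaying_annihilated_sum[of Basis \<kappa>2] a2 d2 by simp
  moreover have "(\<Sum>b\<in>Basis. \<kappa>2 b w) = q * (q + 2 - real DIM('a)) * norm w powr (- (q + 2))" for w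
  \<comment> \<open>At the origin both sides are 0, as \<open>0 powr r = 0\<close> for every
    \<open>r\<close>.\<close>
  proof (cases "w = 0")
    case False
    then have pos: "norm w > 0" by simp
    have sq: "(\<Sum>b\<in>Basis. (w \<bullet> b) * (w \<bullet> b)) = norm w powr 2"
      using pos by (simp add: euclidean_inner[symmetric] power2_norm_eq_inner[symmetric])
    have "(\<Sum>b\<in>Basis. \<kappa>2 b w) = real DIM('a) * ((- q) * norm w powr (- (q + 2)))
       + (q * (q + 2) * norm w powr (- (q + 4))) * (\<Sum>b\<in>Basis. (w \<bullet> b) * (w \<bullet> b))"
      unfolding \<kappa>2_def sum.distrib sum_distrib_left by (simp add: mult_ac)
    also have "(q * (q + 2) * norm w powr (- (q + 4))) * (\<Sum>b\<in>Basis. (w \<bullet> b) * (w \<bullet> b)) = q * (q + 2) * norm w powr (- (q + 2))"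
    proof -
      have "norm w powr (- (q + 4)) * norm w powr 2 = norm w powr (- (q + 2))"
        unfolding powr_add[symmetric] by (rule arg_cong[where f="\<lambda>r. _ powr r"]) simp
      then show ?thesis unfolding sq mult.assoc by simp
    qed
    finally show ?thesis by (simp add: algebra_simps)
  qed (simp add: \<kappa>2_def)
  ultimately have "annihilated (\<lambda>w. q * (q + 2 - real DIM('a)) * norm w powr (- (q + 2)))" by simp
  from annihilated_scale[OF this, of "1 / (q * (q + 2 - real DIM('a)))"]
  show ?thesis using q0 q p_gt by simp
qed

lemma radial_annihilated:
  assumes "annihilated (\<lambda>w. norm w powr (- p))"
  shows "annihilated (\<lambda>w. norm w powr (- (p + 2 * real k)))"
proof (induction k)
  case (Suc k)
  have "annihilated (\<lambda>w. norm w powr (- ((p + 2 * real k) + 2)))"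
    by (rule laplace_step[OF _ Suc]) simp
  then show ?case by (simp add: algebra_simps)
qed (use assms in simp)

text \<open>With \<open>Q = p + 2 (k - 1)\<close>, the derivative of
  \<open>f1 w * norm w powr (- Q)\<close> along \<open>v\<close> is
  \<open>- Q (w \<bullet> v) f1 w * norm w powr (- Q - 2)\<close> plus a term with the derivative of
  \<open>f1\<close> and the old exponent. The latter has lower degree, so the former is annihilated
  too, and it has one more linear factor. Each factor uses up one step of \<open>k\<close>, whence
  \<open>k \<ge> d\<close>.\<close>

lemma hpoly_annihilated:
  assumes base: "annihilated (\<lambda>w. norm w powr (- p))"
  shows "hpoly d f \<Longrightarrow> k \<ge> d \<Longrightarrow> annihilated (\<lambda>w. f w * norm w powr (- (p + 2 * real k)))"
proof (induction d arbitrary: f k rule: less_induct)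
  case (less d)
  \<comment> \<open>The inner induction takes \<open>f\<close> apart. The equation
    \<open>e = d\<close> fixes its degree, so that a factor of smaller degree falls under the outer
    hypothesis, and so does its derivative.\<close>
  have "hpoly e f \<Longrightarrow> e = d \<Longrightarrow> annihilated (\<lambda>w. f w * norm w powr (- (p + 2 * real k)))" for e
  proof (induction rule: hpoly.induct)
    case (const c)
    show ?case by (rule annihilated_scale[OF radial_annihilated[OF base]])
  next
    case (add e f1 f2)
    have q: "p + 2 * real k \<ge> p + real e" using add.prems less.prems by simp
    show ?case
      unfolding distrib_right using add by (intro annihilated_add hpoly_decaying[OF _ q]) auto
  next
    case (mult e f1 v)
    have k: "k \<ge> Suc e" "e < d" using mult.prems less.prems by auto
    define Q where "Q = p + 2 * real (k - 1)"
    have Q2: "Q + 2 = p + 2 * real k" using k by (simp add: Q_def of_nat_diff)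
    have Q0: "Q > 0" using p_gt by (simp add: Q_def add_pos_nonneg)
    have Qe: "Q \<ge> p + real e" using k by (simp add: Q_def)
    have ann1: "annihilated (\<lambda>w. f1 w * norm w powr (- Q))"
      unfolding Q_def using less.IH[OF k(2) mult.hyps, of "k - 1"] k by simp
    obtain f' where f': "\<And>w. (f1 has_derivative f' w) (at w)"
      "\<And>b. if e = 0 then \<forall>w. f' w b = 0 else hpoly (e - 1) (\<lambda>w. f' w b)"
      using hpoly_derivative[OF mult.hyps] by blast
    have f'v: "decaying (\<lambda>w. f' w v * norm w powr (- Q)) \<and> annihilated (\<lambda>w. f' w v * norm w powr (- Q))"
    proof (cases "e = 0")
      case True
      then have "f' w v = 0" for w using f'(2)[of v] by simp
      then show ?thesis by (auto simp: decaying_def annihilated_def intro: exI[of _ 0])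
    next
      case False
      then have h: "hpoly (e - 1) (\<lambda>w. f' w v)" using f'(2)[of v] by simp
      have "annihilated (\<lambda>w. f' w v * norm w powr (- Q))"
        unfolding Q_def using less.IH[OF _ h, of "k - 1"] k False by simp
      moreover have "decaying (\<lambda>w. f' w v * norm w powr (- Q))"
        by (rule hpoly_decaying[OF h]) (use Qe in simp)
      ultimately show ?thesis by blast
    qed
    have h1: "hpoly (Suc e) (\<lambda>w. (w \<bullet> v) * f1 w)" by (rule hpoly.mult[OF mult.hyps])
    have dm: "decaying (\<lambda>w. ((w \<bullet> v) * f1 w) * norm w powr (- (Q + 2)))"
      by (rule hpoly_decaying[OF h1]) (use Qe in simp)
    let ?\<kappa> = "\<lambda>w. (- Q) * (((w \<bullet> v) * f1 w) * norm w powr (- (Q + 2))) + f' w v * norm w powr (- Q)"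
    have "annihilated ?\<kappa>"
    proof (rule annihilated_derivative[OF hpoly_decaying[OF mult.hyps Qe] _ ann1])
      show "decaying ?\<kappa>" using dm f'v by (intro decaying_add decaying_scale) auto
      fix w :: 'a assume w: "w \<noteq> 0"
      have "((\<lambda>w. f1 w * norm w powr (- Q)) has_derivative
         (\<lambda>h. f1 w * (- Q * (w \<bullet> h) * norm w powr (- (Q + 2))) + f' w h * norm w powr (- Q))) (at w)"
        by (rule has_derivative_mult[OF f'(1) has_derivative_norm_powr[OF w]])
      then show "\<exists>D. ((\<lambda>w. f1 w * norm w powr (- Q)) has_derivative D) (at w) \<and> D v = ?\<kappa> w"
        by (intro exI conjI) (auto simp: algebra_simps)
    qed
    note ann\<kappa> = this
    have "annihilated (\<lambda>w. ?\<kappa> w + (- 1) * (f' w v * norm w powr (- Q)))"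
      by (rule annihilated_add[OF decaying_add[OF decaying_scale[OF dm] conjunct1[OF f'v]]
            decaying_scale[OF conjunct1[OF f'v]] ann\<kappa> annihilated_scale[OF conjunct2[OF f'v]]])
    then have "annihilated (\<lambda>w. (- Q) * (((w \<bullet> v) * f1 w) * norm w powr (- (Q + 2))))" by simp
    from annihilated_scale[OF this, of "- 1 / Q"]
    show ?case using Q0 unfolding Q2 by simp
  qed
  with less.prems show ?case by blast
qed

section \<open>Inversion about \<open>x0\<close> and polynomial approximation\<close>

definition inversion :: "'a \<Rightarrow> 'a" where
  "inversion y = inverse ((norm (x0 - y))\<^sup>2) *\<^sub>R (x0 - y)"

lemma inversion_measurable [measurable]: "inversion \<in> borel_measurable borel"
  unfolding inversion_def[abs_def] by measurable

lemma norm_inversion: "norm (inversion y) = inverse (norm (x0 - y))"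
  unfolding inversion_def by (cases "x0 = y") (auto simp: power2_eq_square)

lemma inversion_range: "u y \<noteq> 0 \<Longrightarrow> inversion y \<in> cball 0 (1 / R)"
proof -
  assume "u y \<noteq> 0"
  then have "\<not> norm (x0 - y) < R" using u_zero[of y] by (auto simp: dist_norm)
  then have "inverse (norm (x0 - y)) \<le> inverse R" using R by (intro le_imp_inverse_le) auto
  then show ?thesis by (simp add: norm_inversion divide_inverse)
qed

text \<open>For a homogeneous summand of degree \<open>d\<close>, homogeneity extracts
  \<open>norm (x0 - y) powr (- 2 d)\<close> from the inversion, and the integral becomes a kernel
  identity at the single point \<open>x = x0\<close>.\<close>

lemma hpoly_sum_integral:
  assumes base: "annihilated (\<lambda>w. norm w powr (- p))"
  shows "hpoly_sum f \<Longrightarrow> integrable lborel (\<lambda>y. g y * f (inversion y)) \<and> (\<integral>y. g y * f (inversion y) \<partial>lborel) = 0"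
proof (induction rule: hpoly_sum.induct)
  case (base d f)
  have eq: "g y * f (inversion y) = u y * (f (x0 - y) * norm (x0 - y) powr (- (p + 2 * real d)))" for y
  proof (cases "u y = 0")
    case False
    then have pos: "norm (x0 - y) > 0" using u_zero[of y] R by (auto simp: dist_norm)
    have "inverse ((norm (x0 - y))\<^sup>2) ^ d = norm (x0 - y) powr (- (2 * real d))"
    proof -
      have "norm (x0 - y) powr (2 * real d) = ((norm (x0 - y))\<^sup>2) ^ d"
        using pos powr_realpow[OF pos, of "2 * d"] by (simp add: power_mult)
      then show ?thesis by (simp add: powr_minus power_inverse)
    qed
    then have "g y * f (inversion y) = u y * (f (x0 - y) * (norm (x0 - y) powr (- p) * norm (x0 - y) powr (- (2 * real d))))"
      unfolding g_def inversion_def hpoly_homogeneous[OF base] by (simp add: mult_ac)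
    then show ?thesis by (simp add: powr_add[symmetric])
  qed (simp add: g_def)
  have "decaying (\<lambda>w. f w * norm w powr (- (p + 2 * real d)))" by (rule hpoly_decaying[OF base]) simp
  from decaying_integrable[OF this centre] hpoly_annihilated[OF assms base order_refl]
  show ?case unfolding eq annihilated_def using centre by blast
next
  case (add f1 f2)
  then show ?case by (simp add: distrib_left)
qed

text \<open>Where \<open>u\<close> is nonzero the inversion takes values in the compact ball, so
  uniform approximation there controls the integral by the mass of \<open>g\<close>. Measurability
  is assumed separately, since continuity is assumed on the ball only.\<close>

lemma inversion_integral_continuous:
  assumes base: "annihilated (\<lambda>w. norm w powr (- p))"
    and cont: "continuous_on (cball 0 (1 / R)) \<psi>" and [measurable]: "(\<lambda>y. \<psi> (inversion y)) \<in> borel_measurable borel"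
  shows "(\<integral>y. g y * \<psi> (inversion y) \<partial>lborel) = 0"
proof -
  have comp: "compact (cball (0::'a) (1 / R))" by simp
  have "bounded (\<psi> ` cball 0 (1 / R))" by (intro compact_imp_bounded compact_continuous_image cont comp)
  then obtain M where "\<forall>z\<in>cball 0 (1 / R). \<bar>\<psi> z\<bar> \<le> M" unfolding bounded_iff by auto
  then have M: "\<bar>\<psi> z\<bar> \<le> M" if "z \<in> cball 0 (1 / R)" for z using that by blast
  have g0: "g y = 0" if "u y = 0" for y using that by (simp add: g_def)
  have int: "integrable lborel (\<lambda>y. g y * \<psi> (inversion y))"
  proof (rule Bochner_Integration.integrable_bound)
    show "integrable lborel (\<lambda>y. \<bar>M\<bar> * \<bar>g y\<bar>)" using g_integrable by simp
    have "\<bar>g y\<bar> * \<bar>\<psi> (inversion y)\<bar> \<le> \<bar>M\<bar> * \<bar>g y\<bar>" for y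
    proof (cases "u y = 0")
      case False
      have "\<bar>\<psi> (inversion y)\<bar> \<le> \<bar>M\<bar>" using M[OF inversion_range[OF False]] by linarith
      then show ?thesis using mult_left_mono[of "\<bar>\<psi> (inversion y)\<bar>" "\<bar>M\<bar>" "\<bar>g y\<bar>"] by (simp add: mult.commute)
    qed (simp add: g0)
    then show "AE y in lborel. norm (g y * \<psi> (inversion y)) \<le> norm (\<bar>M\<bar> * \<bar>g y\<bar>)" by (simp add: abs_mult)
  qed measurable
  define I where "I = (\<integral>y. \<bar>g y\<bar> \<partial>lborel)"
  have "\<bar>\<integral>y. g y * \<psi> (inversion y) \<partial>lborel\<bar> \<le> e * I" if e: "e > 0" for e
  proof -
    obtain f where f: "real_polynomial_function f" "\<And>z. z \<in> cball 0 (1 / R) \<Longrightarrow> \<bar>\<psi> z - f z\<bar> < e"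
      using Stone_Weierstrass_real_polynomial_function[OF comp cont e] by blast
    note fi = hpoly_sum_integral[OF base real_polynomial_function_hpoly_sum[OF f(1)]]
    have "(\<integral>y. g y * \<psi> (inversion y) \<partial>lborel) = (\<integral>y. g y * \<psi> (inversion y) \<partial>lborel) - (\<integral>y. g y * f (inversion y) \<partial>lborel)"
      using fi by simp
    also have "\<dots> = (\<integral>y. g y * \<psi> (inversion y) - g y * f (inversion y) \<partial>lborel)"
      using int fi by (intro Bochner_Integration.integral_diff[symmetric]) auto
    also have "norm \<dots> \<le> (\<integral>y. e * \<bar>g y\<bar> \<partial>lborel)"
    proof (rule order_trans[OF integral_norm_bound integral_mono])
      show "integrable lborel (\<lambda>y. norm (g y * \<psi> (inversion y) - g y * f (inversion y)))"
        using int fi by (intro integrable_norm Bochner_Integration.integrable_diff) auto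
      show "integrable lborel (\<lambda>y. e * \<bar>g y\<bar>)" using g_integrable by simp
      show "norm (g y * \<psi> (inversion y) - g y * f (inversion y)) \<le> e * \<bar>g y\<bar>" for y
      proof (cases "u y = 0")
        case False
        have "norm (g y * \<psi> (inversion y) - g y * f (inversion y)) = \<bar>\<psi> (inversion y) - f (inversion y)\<bar> * \<bar>g y\<bar>"
          unfolding right_diff_distrib[symmetric] by (simp add: abs_mult mult.commute)
        also have "\<dots> \<le> e * \<bar>g y\<bar>" using f(2)[OF inversion_range[OF False]] by (intro mult_right_mono) auto
        finally show ?thesis .
      qed (simp add: g0)
    qed
    finally show ?thesis by (simp add: I_def)
  qed
  note le = this
  have "I \<ge> 0" by (simp add: I_def)
  \<comment> \<open>The previous bound is used with \<open>e / (I + 1)\<close>, which avoids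
    dividing by a mass \<open>I\<close> that may be 0.\<close>
  have "\<bar>\<integral>y. g y * \<psi> (inversion y) \<partial>lborel\<bar> \<le> e" if e: "e > 0" for e
  proof -
    have "\<bar>\<integral>y. g y * \<psi> (inversion y) \<partial>lborel\<bar> \<le> (e / (I + 1)) * I" using e \<open>I \<ge> 0\<close> by (intro le) simp
    also have "\<dots> \<le> e" using e \<open>I \<ge> 0\<close> by (simp add: field_simps)
    finally show ?thesis .
  qed
  then have "\<bar>\<integral>y. g y * \<psi> (inversion y) \<partial>lborel\<bar> \<le> 0" by (rule dense_ge)
  then show ?thesis by simp
qed

lemma inversion_inversion: "inversion y \<noteq> 0 \<Longrightarrow> x0 - inverse ((norm (inversion y))\<^sup>2) *\<^sub>R inversion y = y"
proof -
  assume "inversion y \<noteq> 0"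
  then have "norm (x0 - y) \<noteq> 0" by (auto simp: inversion_def)
  then have "inverse ((inverse (norm (x0 - y)))\<^sup>2) * inverse ((norm (x0 - y))\<^sup>2) = 1"
    by (simp add: power_inverse)
  then show ?thesis unfolding norm_inversion by (simp add: inversion_def)
qed

text \<open>Bumps in \<open>y\<close> are pulled back to functions of \<open>z\<close>. A bump has
  bounded support, so its pullback vanishes near \<open>z = 0\<close>, the image of infinity, and is
  continuous there as well.\<close>

lemma AE_zero_if_annihilated:
  assumes base: "annihilated (\<lambda>w. norm w powr (- p))"
  shows "AE y in lborel. u y = 0"
proof -
  have box: "AE y in lborel. y \<in> box a b \<longrightarrow> g y = 0" for a b
  proof (rule AE_zero_if_bump_integrals_zero[OF g_integrable])
    fix e f :: 'a and c :: real
    assume ne: "box e f \<noteq> {}" and c: "c > 0"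
    \<comment> \<open>The inversion is undone inside the bump. The value at \<open>z = 0\<close> is
      set to 0, in agreement with \<open>near0\<close> below.\<close>
    define \<psi> where "\<psi> z = (if z = 0 then 0 else box_bump c e f (x0 - inverse ((norm z)\<^sup>2) *\<^sub>R z))" for z
    have bc: "continuous_on UNIV (box_bump c e f)"
      by (rule test_fun_continuous[OF test_fun_box_bump[OF c ne order_refl]])
    obtain B where B: "B > 0" "\<And>y. y \<in> box e f \<Longrightarrow> norm (x0 - y) < B"
    proof -
      obtain B0 where B0: "\<And>y. y \<in> box e f \<Longrightarrow> norm y \<le> B0" using bounded_box[of e f] unfolding bounded_iff by blast
      have "norm (x0 - y) < norm x0 + \<bar>B0\<bar> + 1" if "y \<in> box e f" for y
        using B0[OF that] norm_triangle_ineq4[of x0 y] by linarith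
      moreover have "0 < norm x0 + \<bar>B0\<bar> + 1" using norm_ge_zero[of x0] by linarith
      ultimately show thesis using that by blast
    qed
    have near0: "\<psi> z = 0" if "norm z < 1 / B" for z
    proof (cases "z = 0")
      case False
      have "norm (x0 - (x0 - inverse ((norm z)\<^sup>2) *\<^sub>R z)) = inverse (norm z)"
        using False by (simp add: power2_eq_square)
      also have "\<dots> > B" using that B False by (simp add: field_simps)
      finally have "x0 - inverse ((norm z)\<^sup>2) *\<^sub>R z \<notin> box e f" using B(2) by force
      then show ?thesis using False box_bump_outside[OF ne] by (simp add: \<psi>_def)
    qed (simp add: \<psi>_def)
    have "isCont \<psi> z" for z
    proof (cases "z = 0")
      case True
      have "eventually (\<lambda>z. z \<in> ball 0 (1 / B)) (nhds (0::'a))" using B by (intro eventually_nhds_in_open) auto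
      then have "eventually (\<lambda>z. \<psi> z = 0) (nhds 0)" by eventually_elim (simp add: near0)
      then show ?thesis using True isCont_cong[of \<psi> "\<lambda>_. 0" 0] by simp
    next
      case False
      have "eventually (\<lambda>y. y \<in> - {0}) (nhds z)" using False by (intro eventually_nhds_in_open) auto
      then have ev: "eventually (\<lambda>z. \<psi> z = box_bump c e f (x0 - inverse ((norm z)\<^sup>2) *\<^sub>R z)) (nhds z)"
        by eventually_elim (simp add: \<psi>_def)
      have cb: "isCont (box_bump c e f) y" for y using bc by (simp add: continuous_on_eq_continuous_at)
      have "isCont (\<lambda>z. x0 - inverse ((norm z)\<^sup>2) *\<^sub>R z) z"
        by (intro continuous_intros) (simp add: False)
      from isCont_o2[OF this cb]
      have "isCont (\<lambda>z. box_bump c e f (x0 - inverse ((norm z)\<^sup>2) *\<^sub>R z)) z" .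
      then show ?thesis using isCont_cong[OF ev] by simp
    qed
    then have cont: "continuous_on UNIV \<psi>" by (simp add: continuous_at_imp_continuous_on)
    have [measurable]: "\<psi> \<in> borel_measurable borel" by (rule borel_measurable_continuous_onI[OF cont])
    have zero: "(\<integral>y. g y * \<psi> (inversion y) \<partial>lborel) = 0"
      by (rule inversion_integral_continuous[OF base continuous_on_subset[OF cont]]) auto
    have eq: "box_bump c e f y * g y = g y * \<psi> (inversion y)" for y
    proof (cases "u y = 0")
      case False
      then have "norm (x0 - y) \<noteq> 0" using u_zero[of y] R by (auto simp: dist_norm)
      then have nz: "inversion y \<noteq> 0" by (simp add: inversion_def)
      show ?thesis using nz by (simp add: \<psi>_def inversion_inversion[OF nz])
    qed (simp add: g_def)
    show "(\<integral>y. box_bump c e f y * g y \<partial>lborel) = 0" unfolding eq by (rule zero)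
  qed
  have "AE y in lborel. \<forall>n::nat. y \<in> box (- real n *\<^sub>R One) (real n *\<^sub>R One) \<longrightarrow> g y = 0"
    unfolding AE_all_countable using box by blast
  then show ?thesis
  proof eventually_elim
    case (elim y)
    have "y \<in> (\<Union>n::nat. box (- real n *\<^sub>R One) (real n *\<^sub>R One))" using UN_box_eq_UNIV by auto
    then have "g y = 0" using elim by blast
    then show "u y = 0" using u_zero[of y] R by (auto simp: g_def)
  qed
qed

end

section \<open>From the weak equation to a pointwise identity\<close>

context ucp
begin

lemma kernel_decaying: "decaying (\<lambda>w. norm w powr (- p))"
  using hpoly_decaying[OF hpoly.const[of 1], of p] by simp

definition riesz_pot :: "'a \<Rightarrow> real" where
  "riesz_pot x = (\<integral>y. u y * norm (x - y) powr (- p) \<partial>lborel)"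

lemma riesz_pot_measurable [measurable]: "riesz_pot \<in> borel_measurable borel"
proof -
  have "(\<lambda>z::'a \<times> 'a. u (snd z) * norm (fst z - snd z) powr (- p)) \<in> borel_measurable (borel \<Otimes>\<^sub>M lborel)"
    by measurable
  then show ?thesis unfolding riesz_pot_def[abs_def]
    by (intro lborel.borel_measurable_lebesgue_integral) (simp add: case_prod_unfold)
qed

lemma riesz_pot_bound: "\<exists>C\<ge>0. \<forall>x\<in>ball x0 (R / 2). \<bar>riesz_pot x\<bar> \<le> C"
proof -
  obtain C where C: "C \<ge> 0" "\<And>x y. x \<in> ball x0 (R / 2) \<Longrightarrow> \<bar>u y\<bar> * \<bar>norm (x - y) powr (- p)\<bar> \<le> C * \<bar>g y\<bar>"
    using decaying_bound[OF kernel_decaying] by blast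
  have "\<bar>riesz_pot x\<bar> \<le> (\<integral>y. C * \<bar>g y\<bar> \<partial>lborel)" if x: "x \<in> ball x0 (R / 2)" for x
  proof -
    have "norm (riesz_pot x) \<le> (\<integral>y. C * \<bar>g y\<bar> \<partial>lborel)" unfolding riesz_pot_def
    proof (rule order_trans[OF integral_norm_bound integral_mono])
      show "integrable lborel (\<lambda>y. norm (u y * norm (x - y) powr (- p)))"
        using decaying_integrable[OF kernel_decaying x] by (rule integrable_norm)
      show "integrable lborel (\<lambda>y. C * \<bar>g y\<bar>)" using g_integrable by simp
      show "norm (u y * norm (x - y) powr (- p)) \<le> C * \<bar>g y\<bar>" for y
        using C(2)[OF x, of y] by (simp add: abs_mult)
    qed
    then show ?thesis by simp
  qed
  moreover have "0 \<le> (\<integral>y. C * \<bar>g y\<bar> \<partial>lborel)" using C by (intro Bochner_Integration.integral_nonneg) auto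
  ultimately show ?thesis by blast
qed

lemma riesz_pot_continuous:
  assumes X: "\<And>n. X n \<in> ball x0 (R / 2)" and x: "x \<in> ball x0 (R / 2)" and lim: "X \<longlonglongrightarrow> x"
  shows "(\<lambda>n. riesz_pot (X n)) \<longlonglongrightarrow> riesz_pot x"
proof -
  obtain C where C: "C \<ge> 0" "\<And>x y. x \<in> ball x0 (R / 2) \<Longrightarrow> \<bar>u y\<bar> * \<bar>norm (x - y) powr (- p)\<bar> \<le> C * \<bar>g y\<bar>"
    using decaying_bound[OF kernel_decaying] by blast
  show ?thesis unfolding riesz_pot_def
  proof (rule integral_dominated_convergence[where w="\<lambda>y. C * \<bar>g y\<bar>"])
    show "integrable lborel (\<lambda>y. C * \<bar>g y\<bar>)" using g_integrable by simp
    show "AE y in lborel. norm (u y * norm (X n - y) powr (- p)) \<le> C * \<bar>g y\<bar>" for n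
      using C(2)[OF X, of _ n] by (simp add: abs_mult)
    show "AE y in lborel. (\<lambda>n. u y * norm (X n - y) powr (- p)) \<longlonglongrightarrow> u y * norm (x - y) powr (- p)"
    proof (intro always_eventually allI)
      fix y
      show "(\<lambda>n. u y * norm (X n - y) powr (- p)) \<longlonglongrightarrow> u y * norm (x - y) powr (- p)"
      proof (cases "u y = 0")
        case False
        then have "norm (x - y) \<noteq> 0" using dist_lower(1)[OF x False] R by auto
        then show ?thesis by (intro tendsto_intros lim) auto
      qed simp
    qed
  qed measurable
qed

text \<open>As \<open>u\<close> vanishes on the support of \<open>\<phi>\<close>, the product of
  increments loses its diagonal terms. The two mixed terms are reflections of each other, hence the
  factor 2, and both are absolutely integrable because the support of \<open>\<phi>\<close> keeps
  them off the singularity; so Fubini's theorem applies.\<close>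

lemma gag_integral_eq:
  assumes \<phi>: "test_fun (ball x0 (R / 2)) \<phi>"
  shows "gag_form s u \<phi> = - 2 * (\<integral>x. \<phi> x * riesz_pot x \<partial>lborel)"
proof -
  have [measurable]: "\<phi> \<in> borel_measurable borel"
    by (rule borel_measurable_continuous_onI[OF test_fun_continuous[OF \<phi>]])
  have \<phi>out: "\<phi> x = 0" if "x \<notin> ball x0 (R / 2)" for x using test_fun_outside[OF \<phi> that] .
  have \<phi>int: "integrable lborel (\<lambda>x. \<bar>\<phi> x\<bar>)"
  proof -
    obtain M where M: "M \<ge> 0" "\<And>x. \<bar>\<phi> x\<bar> \<le> M" using test_fun_bounded[OF \<phi>] by blast
    have bm [measurable]: "ball x0 (R / 2) \<in> sets borel" by simp
    show ?thesis
    proof (rule Bochner_Integration.integrable_bound)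
      show "integrable lborel (\<lambda>x. M * indicator (ball x0 (R / 2)) x :: real)"
        using emeasure_bounded_finite[OF bounded_ball[of x0 "R / 2"]] by simp
      have "\<bar>\<phi> x\<bar> \<le> M * indicator (ball x0 (R / 2)) x" for x
        using M(2)[of x] \<phi>out[of x] by (cases "x \<in> ball x0 (R / 2)") auto
      then show "AE x in lborel. norm \<bar>\<phi> x\<bar> \<le> norm (M * indicator (ball x0 (R / 2)) x)"
        using M(1) by simp
    qed measurable
  qed
  obtain C where C: "C \<ge> 0" "\<And>x y. x \<in> ball x0 (R / 2) \<Longrightarrow> \<bar>u y\<bar> * \<bar>norm (x - y) powr (- p)\<bar> \<le> C * \<bar>g y\<bar>"
    using decaying_bound[OF kernel_decaying] by blast
  define f where "f z = \<phi> (fst z) * (u (snd z) * norm (fst z - snd z) powr (- p))" for z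
  have fm [measurable]: "f \<in> borel_measurable lborel2" unfolding f_def[abs_def] by measurable
  have f_int: "integrable lborel2 f"
  proof (rule Bochner_Integration.integrable_bound)
    show "integrable lborel2 (\<lambda>z. \<bar>\<phi> (fst z)\<bar> * (C * \<bar>g (snd z)\<bar>))"
    proof (rule lborel_pair.Fubini_integrable)
      show "AE x in lborel. integrable lborel (\<lambda>y. \<bar>\<phi> (fst (x, y))\<bar> * (C * \<bar>g (snd (x, y))\<bar>))"
        using g_integrable by simp
      have "(\<lambda>x. \<integral>y. norm (\<bar>\<phi> (fst (x, y))\<bar> * (C * \<bar>g (snd (x, y))\<bar>)) \<partial>lborel) = (\<lambda>x. \<bar>\<phi> x\<bar> * (C * (\<integral>y. \<bar>g y\<bar> \<partial>lborel)))"
        using C(1) by (simp add: abs_mult)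
      then show "integrable lborel (\<lambda>x. \<integral>y. norm (\<bar>\<phi> (fst (x, y))\<bar> * (C * \<bar>g (snd (x, y))\<bar>)) \<partial>lborel)"
        using \<phi>int by simp
    qed measurable
    have "norm (f z) \<le> \<bar>\<phi> (fst z)\<bar> * (C * \<bar>g (snd z)\<bar>)" for z
    proof (cases "fst z \<in> ball x0 (R / 2)")
      case True
      show ?thesis unfolding f_def using C(2)[OF True, of "snd z"] by (simp add: abs_mult mult_left_mono)
    qed (simp add: f_def \<phi>out)
    then show "AE z in lborel2. norm (f z) \<le> norm (\<bar>\<phi> (fst z)\<bar> * (C * \<bar>g (snd z)\<bar>))"
      using C(1) by (simp add: abs_mult)
  qed measurable
  have eq: "gag_kernel s u \<phi> z = - (f z + (case z of (x, y) \<Rightarrow> f (y, x)))" for z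
  proof (cases z)
    case (Pair x y)
    have 0: "u x * \<phi> x = 0" for x
      using u_zero[of x] \<phi>out[of x] R by (cases "x \<in> ball x0 (R / 2)") auto
    have "(u x - u y) * (\<phi> x - \<phi> y) = u x * \<phi> x + u y * \<phi> y - (\<phi> x * u y + \<phi> y * u x)"
      by (simp add: algebra_simps)
    also have "\<dots> = - (\<phi> x * u y + \<phi> y * u x)" unfolding 0 by simp
    finally have "gag_kernel s u \<phi> z = - (\<phi> x * u y + \<phi> y * u x) * norm (x - y) powr (- p)"
      unfolding Pair gag_kernel_def prod.case p_def by (simp only: powr_minus divide_inverse)
    also have "\<dots> = - (f (x, y) + f (y, x))"
      by (simp add: f_def norm_minus_commute[of y x] algebra_simps)
    finally show ?thesis by (simp add: Pair)
  qed
  have "gag_form s u \<phi> = - (integral\<^sup>L lborel2 f + (\<integral>z. (case z of (x, y) \<Rightarrow> f (y, x)) \<partial>lborel2))"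
    unfolding eq using f_int lborel_pair.integrable_product_swap[OF f_int] by simp
  also have "(\<integral>z. (case z of (x, y) \<Rightarrow> f (y, x)) \<partial>lborel2) = integral\<^sup>L lborel2 f"
    by (rule lborel_pair.integral_product_swap) measurable
  also have "integral\<^sup>L lborel2 f = (\<integral>x. \<integral>y. f (x, y) \<partial>lborel \<partial>lborel)"
    by (rule lborel_pair.integral_fst'[symmetric, OF f_int])
  also have "\<dots> = (\<integral>x. \<phi> x * riesz_pot x \<partial>lborel)"
    by (simp add: f_def riesz_pot_def)
  finally show ?thesis by simp
qed

text \<open>Testing with bumps gives the identity almost everywhere. Zeros of the potential are
  therefore dense in the half ball, and continuity extends the identity to every point.\<close>

lemma annihilated_if_weakly_zero:
  assumes weak: "\<And>\<phi>. test_fun (ball x0 (R / 2)) \<phi> \<Longrightarrow> gag_form s u \<phi> = 0"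
  shows "annihilated (\<lambda>w. norm w powr (- p))"
  unfolding annihilated_def
proof
  fix x assume x: "x \<in> ball x0 (R / 2)"
  obtain C where C: "C \<ge> 0" "\<And>x. x \<in> ball x0 (R / 2) \<Longrightarrow> \<bar>riesz_pot x\<bar> \<le> C" using riesz_pot_bound by blast
  have ae: "AE y in lborel. y \<in> box a b \<longrightarrow> riesz_pot y = 0" if ab: "cbox a b \<subseteq> ball x0 (R / 2)" for a b
  proof -
    \<comment> \<open>The potential is bounded on the half ball only; cutting it off to a box inside
      yields a globally integrable function.\<close>
    let ?h = "\<lambda>y. indicator (cbox a b) y * riesz_pot y"
    have [measurable]: "cbox a b \<in> sets borel" by simp
    have "AE y in lborel. y \<in> box a b \<longrightarrow> ?h y = 0"
    proof (rule AE_zero_if_bump_integrals_zero)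
      show "integrable lborel ?h"
      proof (rule Bochner_Integration.integrable_bound)
        show "integrable lborel (\<lambda>y. C * indicator (cbox a b) y :: real)"
          using emeasure_bounded_finite[OF bounded_cbox[of a b]] by simp
        have "\<bar>?h y\<bar> \<le> C * indicator (cbox a b) y" for y
          using C(2)[of y] ab by (cases "y \<in> cbox a b") auto
        then show "AE y in lborel. norm (?h y) \<le> norm (C * indicator (cbox a b) y)" using C(1) by simp
      qed measurable
      fix e f c assume ef: "box e f \<noteq> {}" "cbox e f \<subseteq> cbox a b" "c > (0::real)"
      have t: "test_fun (ball x0 (R / 2)) (box_bump c e f)"
        using ef ab by (intro test_fun_box_bump) auto
      have "(\<integral>x. box_bump c e f x * riesz_pot x \<partial>lborel) = 0"
        using weak[OF t] gag_integral_eq[OF t] by simp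
      note zero = this
      have eq: "box_bump c e f y * ?h y = box_bump c e f y * riesz_pot y" for y
        using box_bump_outside[OF ef(1), of y c] ef(2) box_subset_cbox[of e f] by (cases "y \<in> cbox a b") auto
      show "(\<integral>x. box_bump c e f x * ?h x \<partial>lborel) = 0" unfolding eq by (rule zero)
    qed
    then show ?thesis
      by eventually_elim (use box_subset_cbox[of a b] in \<open>auto simp: indicator_def split: if_splits\<close>)
  qed
  have "\<exists>y. dist y x < 1 / (real n + 1) \<and> y \<in> ball x0 (R / 2) \<and> riesz_pot y = 0" for n :: nat
  proof -
    have "open (ball x0 (R / 2) \<inter> ball x (1 / (real n + 1)))" "x \<in> ball x0 (R / 2) \<inter> ball x (1 / (real n + 1))"
      using x by auto
    then obtain a b where ab: "cbox a b \<subseteq> ball x0 (R / 2) \<inter> ball x (1 / (real n + 1))" "x \<in> box a b" "\<forall>i\<in>Basis. a \<bullet> i < b \<bullet> i"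
      by (rule open_contains_cbox)
    \<comment> \<open>A nonempty open box has positive measure and cannot be contained in the
      exceptional null set.\<close>
    have "\<exists>y\<in>box a b. riesz_pot y = 0"
    proof (rule ccontr)
      assume "\<not> ?thesis"
      then have "AE y in lborel. y \<notin> box a b" using ae[of a b] ab(1) by auto
      then have "emeasure lborel (box a b) = 0" by (intro AE_iff_measurable[THEN iffD1, of "box a b" lborel "\<lambda>y. y \<notin> box a b"]) auto
      note em0 = this
      have em: "emeasure lborel (box a b) = ennreal (\<Prod>i\<in>Basis. (b - a) \<bullet> i)"
        using ab(3) by (intro emeasure_lborel_box) (auto intro: less_imp_le)
      have "(\<Prod>i\<in>Basis. (b - a) \<bullet> i) > 0" using ab(3) by (intro prod_pos) (simp add: inner_diff_left)
      then show False using em0 unfolding em ennreal_eq_0_iff by (rule leD[THEN notE, rotated])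
    qed
    then obtain y where y: "y \<in> box a b" "riesz_pot y = 0" by blast
    then have "y \<in> ball x0 (R / 2)" "y \<in> ball x (1 / (real n + 1))"
      using ab(1) box_subset_cbox[of a b] by blast+
    then show ?thesis using y(2) by (intro exI[of _ y]) (simp add: dist_commute)
  qed
  then obtain X where X: "\<And>n. dist (X n) x < 1 / (real n + 1)" "\<And>n. X n \<in> ball x0 (R / 2)" "\<And>n. riesz_pot (X n) = 0" by metis
  have "X \<longlonglongrightarrow> x"
  proof (rule tendstoI)
    fix e :: real assume "e > 0"
    moreover have "(\<lambda>n. 1 / (real n + 1)) \<longlonglongrightarrow> 0" by real_asymp
    ultimately have "eventually (\<lambda>n. 1 / (real n + 1) < e) sequentially" by (rule order_tendstoD(2)[rotated])
    then show "eventually (\<lambda>n. dist (X n) x < e) sequentially" by eventually_elim (use X(1) less_trans in blast)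
  qed
  from riesz_pot_continuous[OF X(2) x this] have "(\<lambda>n::nat. 0) \<longlonglongrightarrow> riesz_pot x" unfolding X(3) .
  then have "riesz_pot x = 0" by (rule LIMSEQ_const_iff[THEN iffD1, symmetric])
  then show "(\<integral>y. u y * norm (x - y) powr (- p) \<partial>lborel) = 0" by (simp add: riesz_pot_def)
qed

end

theorem unique_continuation:
  fixes u :: "'a::euclidean_space \<Rightarrow> real"
  assumes s: "0 < s" "s < 1" and u: "u \<in> Hs s" and W: "open W" "W \<noteq> {}"
    and zero: "AE x in lborel. x \<in> W \<longrightarrow> u x = 0"
    and weak: "\<And>\<phi>. test_fun W \<phi> \<Longrightarrow> frac_form s u \<phi> = 0"
  shows "AE x in lborel. u x = 0"
proof -
  obtain x0 where "x0 \<in> W" using W by blast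
  then obtain R where R0: "R > 0" and RW: "ball x0 R \<subseteq> W" using W openE by blast
  have [measurable]: "u \<in> borel_measurable borel" by (rule HsD(1)[OF u])
  have [measurable]: "ball x0 R \<in> sets borel" by simp
  \<comment> \<open>The locale demands that the function vanish at every point of the ball. Changing
    \<open>u\<close> on a null set achieves this and does not affect the form.\<close>
  define v where "v x = indicator (- ball x0 R) x * u x" for x
  have [measurable]: "v \<in> borel_measurable borel" unfolding v_def[abs_def] by measurable
  have uv: "AE x in lborel. v x = u x" using zero by eventually_elim (use RW in \<open>auto simp: v_def indicator_def\<close>)
  have v2: "(\<lambda>x. (v x)\<^sup>2) = (\<lambda>x. indicator (- ball x0 R) x * (u x)\<^sup>2)"
    by (auto simp: v_def indicator_def fun_eq_iff)
  interpret ucp s v x0 R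
  proof
    show "integrable lborel (\<lambda>x. (v x)\<^sup>2)"
      unfolding v2 using integrable_mult_indicator[OF _ HsD(2)[OF u], of "- ball x0 R"] by simp
  qed (use s R0 in \<open>auto simp: v_def\<close>)
  have "gag_form s v \<phi> = 0" if \<phi>: "test_fun (ball x0 (R / 2)) \<phi>" for \<phi>
  proof -
    have [measurable]: "\<phi> \<in> borel_measurable borel"
      by (rule borel_measurable_continuous_onI[OF test_fun_continuous[OF \<phi>]])
    have "gag_form s v \<phi> = gag_form s u \<phi>"
      by (rule integral_cong_AE)
        (measurable, use AE_lborel_fst[OF uv] AE_lborel_snd[OF uv] in \<open>eventually_elim, simp add: gag_kernel_def case_prod_unfold\<close>)
    also have "\<dots> = 0"
    proof -
      have "ball x0 (R / 2) \<subseteq> ball x0 R" using R0 by (intro subset_ball) simp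
      then have "test_fun W \<phi>" using RW by (rule test_fun_mono[OF \<phi> subset_trans])
      then have "c_ns DIM('a) s / 2 * gag_form s u \<phi> = 0"
        unfolding frac_form_def[symmetric] by (rule weak)
      moreover have "c_ns DIM('a) s / 2 \<noteq> 0" using c_ns_pos[OF s, of "DIM('a)"] by simp
      ultimately show ?thesis by (simp only: mult_eq_0_iff simp_thms)
    qed
    finally show ?thesis .
  qed
  from AE_zero_if_annihilated[OF annihilated_if_weakly_zero[OF this]]
  have "AE y in lborel. v y = 0" by simp
  with uv show ?thesis by eventually_elim simp
qed

section \<open>The inverse problem\<close>

text \<open>Solutions for the two potentials coincide only almost everywhere; this transfers one
  representative from one equation to the other.\<close>

lemma (in potential) bform_cong_AE:
  assumes "AE x in lborel. u x = v x" "u \<in> Hs s" "v \<in> Hs s" "w \<in> Hs s"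
  shows "bform u w = bform v w"
proof -
  have [measurable]: "u \<in> borel_measurable borel" "v \<in> borel_measurable borel" "w \<in> borel_measurable borel"
    using assms by (simp_all add: HsD)
  have "(\<integral>x. pot x * (u x * w x) \<partial>lborel) = (\<integral>x. pot x * (v x * w x) \<partial>lborel)"
    by (rule integral_cong_AE) (measurable, use assms(1) in \<open>eventually_elim, simp\<close>)
  then show ?thesis unfolding bform_def pot_integral using frac_form_cong_AE[OF assms] by simp
qed

theorem theorem3p2:
  fixes \<Omega> W1 W2 :: "'a::euclidean_space set"
    and s :: real
    and a1 a2 :: "'a \<Rightarrow> real"
    and F1 F2 :: "('a \<Rightarrow> real) \<Rightarrow> real"
    and f :: "'a \<Rightarrow> real"
  assumes dom: "lipschitz_domain \<Omega>"
    and s: "0 < s" "s < 1"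
    and W1: "open W1" "W1 \<noteq> {}" "W1 \<subseteq> - closure \<Omega>"
    and W2: "open W2" "W2 \<noteq> {}" "W2 \<subseteq> - closure \<Omega>"
    and a1: "continuous_on (closure \<Omega>) a1" "not_dirichlet_eigenvalue s \<Omega> a1"
    and a2: "continuous_on (closure \<Omega>) a2" "not_dirichlet_eigenvalue s \<Omega> a2"
    and F1: "F1 \<in> Hs_tilde_dual s \<Omega>"
    and F2: "F2 \<in> Hs_tilde_dual s \<Omega>"
    and f: "f \<in> Hs_tilde s W1" "\<not> Hs_zero f"
    and hpassive: "passive_data s \<Omega> W2 a1 F1 = passive_data s \<Omega> W2 a2 F2"
    and hactive: "cauchy_data s \<Omega> W1 W2 a1 F1 f = cauchy_data s \<Omega> W1 W2 a2 F2 f"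
  shows "(\<forall>x\<in>closure \<Omega>. a1 x = a2 x) \<and> (\<forall>\<phi>\<in>Hs_tilde s \<Omega>. F1 \<phi> = F2 \<phi>)"
proof -
  have \<Omega>: "open \<Omega>" "bounded \<Omega>" using dom by (auto simp: lipschitz_domain_def)
  have \<Omega>_meas: "\<Omega> \<in> sets borel" using \<Omega> by simp
  interpret P1: potential s \<Omega> a1 by unfold_locales (use s \<Omega> a1 in auto)
  interpret P2: potential s \<Omega> a2 by unfold_locales (use s \<Omega> a2 in auto)
  interpret V: semi_inner "Hs_tilde s \<Omega>" "hs_form s" by (rule semi_inner_Hs_tilde[OF s])
  interpret G: sym_form "Hs s :: ('a \<Rightarrow> real) set" "gag_form s"
    by (rule sym_form_gag)
  have W2_out: "x \<notin> \<Omega>" if "x \<in> W2" for x using that W2(3) closure_subset by blast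
  have W1_out: "x \<notin> W1" if "x \<in> \<Omega>" for x using that W1(3) closure_subset by blast
  have fH: "f \<in> Hs s" by (rule Hs_tildeD[OF f(1)])

  \<comment> \<open>The exterior value \<open>g\<close> is left general because the claim is used
    for 0 and for \<open>f\<close>. The difference of the two solutions lies in
    \<open>Hs_tilde s \<Omega>\<close> whatever \<open>g\<close> is.\<close>
  have same: "AE x in lborel. u x = v x"
    if u: "is_solution s \<Omega> a1 F1 g u" and v: "is_solution s \<Omega> a2 F2 g v"
      and data: "frac_lap_restr s \<Omega> a1 F1 W2 g = frac_lap_restr s \<Omega> a2 F2 W2 g" for u v g
  proof -
    have uH: "u \<in> Hs s" and vH: "v \<in> Hs s" using u v by (auto simp: is_solution_def)
    have "(\<lambda>x. (u x - g x) - (v x - g x)) \<in> Hs_tilde s \<Omega>"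
      using u v unfolding is_solution_def by (intro V.diff_mem[of "\<lambda>x. u x - g x" "\<lambda>x. v x - g x"]) simp_all
    then have d: "(\<lambda>x. u x - v x) \<in> Hs_tilde s \<Omega>" by simp
    have "AE x in lborel. u x - v x = 0"
    proof (rule unique_continuation[OF s Hs_tildeD[OF d] W2(1,2)])
      show "AE x in lborel. x \<in> W2 \<longrightarrow> u x - v x = 0"
        using Hs_tilde_AE_outside[OF s d \<Omega>_meas] by eventually_elim (use W2_out in blast)
      fix \<phi> assume \<phi>: "test_fun W2 \<phi>"
      have "frac_form s u \<phi> = frac_form s v \<phi>"
        using fun_cong[OF data, of \<phi>] \<phi>
        unfolding P1.frac_lap_restr_eq[OF a1(2) u] P2.frac_lap_restr_eq[OF a2(2) v] by simp
      then show "frac_form s (\<lambda>x. u x - v x) \<phi> = 0"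
        unfolding frac_form_def G.form_diff[OF uH vH test_fun_Hs[OF s \<phi>]] by (simp add: right_diff_distrib)
    qed
    then show ?thesis by simp
  qed

  obtain u1 where u1: "is_solution s \<Omega> a1 F1 (\<lambda>_. 0) u1" using P1.solution_exists[OF a1(2) F1 Hs_zero_mem] by blast
  obtain u2 where u2: "is_solution s \<Omega> a2 F2 (\<lambda>_. 0) u2" using P2.solution_exists[OF a2(2) F2 Hs_zero_mem] by blast
  obtain v1 where v1: "is_solution s \<Omega> a1 F1 f v1" using P1.solution_exists[OF a1(2) F1 fH] by blast
  obtain v2 where v2: "is_solution s \<Omega> a2 F2 f v2" using P2.solution_exists[OF a2(2) F2 fH] by blast
  have H: "u1 \<in> Hs s" "u2 \<in> Hs s" "v1 \<in> Hs s" "v2 \<in> Hs s" using u1 u2 v1 v2 by (auto simp: is_solution_def)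
  have uu: "AE x in lborel. u1 x = u2 x"
    by (rule same[OF u1 u2]) (use hpassive in \<open>simp add: passive_data_def\<close>)
  have vv: "AE x in lborel. v1 x = v2 x"
    by (rule same[OF v1 v2]) (use hactive in \<open>simp add: cauchy_data_def\<close>)

  \<comment> \<open>Subtracting the passive solution removes the unknown sources, so that only the
    potentials are left in the equations for \<open>w\<close>.\<close>
  define w where "w x = v1 x - u1 x" for x
  have wH: "w \<in> Hs s" unfolding w_def[abs_def] using H by (intro Hs.diff_mem)
  have wm [measurable]: "w \<in> borel_measurable borel" by (rule HsD(1)[OF wH])
  have w1: "P1.bform w \<phi> = 0" if \<phi>: "\<phi> \<in> Hs_tilde s \<Omega>" for \<phi>
    unfolding w_def[abs_def] P1.bf.form_diff[OF H(3,1) Hs_tildeD[OF \<phi>]]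
    using u1 v1 \<phi> by (simp add: is_solution_def P1.bform_def)
  have w2: "P2.bform w \<phi> = 0" if \<phi>: "\<phi> \<in> Hs_tilde s \<Omega>" for \<phi>
  proof -
    have "P2.bform w \<phi> = P2.bform (\<lambda>x. v2 x - u2 x) \<phi>"
    proof (rule P2.bform_cong_AE)
      show "AE x in lborel. w x = v2 x - u2 x" using uu vv by eventually_elim (simp add: w_def)
    qed (use wH H Hs.diff_mem Hs_tildeD[OF \<phi>] in auto)
    also have "\<dots> = 0"
      unfolding P2.bf.form_diff[OF H(4,2) Hs_tildeD[OF \<phi>]]
      using u2 v2 \<phi> by (simp add: is_solution_def P2.bform_def)
    finally show ?thesis .
  qed
  \<comment> \<open>\<open>w - f\<close> vanishes outside \<open>\<Omega>\<close> and
    \<open>f\<close> outside \<open>W1\<close>, which is disjoint from \<open>\<Omega>\<close>. So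
    \<open>w = 0\<close> would leave no place where \<open>f\<close> could be nonzero.\<close>
  have w_not_zero: "\<not> (AE x in lborel. w x = 0)"
  proof
    assume w0: "AE x in lborel. w x = 0"
    have "(\<lambda>x. (v1 x - f x) - (u1 x - 0)) \<in> Hs_tilde s \<Omega>"
      using u1 v1 unfolding is_solution_def by (intro V.diff_mem[of "\<lambda>x. v1 x - f x" "\<lambda>x. u1 x - 0"]) simp_all
    moreover have "(\<lambda>x. (v1 x - f x) - (u1 x - 0)) = (\<lambda>x. w x - f x)" by (auto simp: w_def)
    ultimately have d: "(\<lambda>x. w x - f x) \<in> Hs_tilde s \<Omega>" by simp
    have "AE x in lborel. f x = 0"
      using w0 Hs_tilde_AE_outside[OF s d \<Omega>_meas] Hs_tilde_AE_outside[OF s f(1) borel_open[OF W1(1)]]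
    proof eventually_elim
      case (elim x)
      then show ?case using W1_out[of x] by (cases "x \<in> \<Omega>") auto
    qed
    with f(2) show False by (simp add: Hs_zero_def)
  qed

  have eq_in: "a1 x = a2 x" if x: "x \<in> \<Omega>" for x
  proof (rule ccontr)
    assume ne: "a1 x \<noteq> a2 x"
    have "continuous_on \<Omega> (\<lambda>x. a1 x - a2 x)"
      using continuous_on_subset[OF a1(1) closure_subset] continuous_on_subset[OF a2(1) closure_subset]
      by (intro continuous_on_diff)
    then have "open (\<Omega> \<inter> (\<lambda>x. a1 x - a2 x) -` (- {0}))"
      by (intro continuous_open_preimage \<Omega>) auto
    moreover have "x \<in> \<Omega> \<inter> (\<lambda>x. a1 x - a2 x) -` (- {0})" using x ne by simp
    ultimately obtain a b where ab: "cbox a b \<subseteq> \<Omega> \<inter> (\<lambda>x. a1 x - a2 x) -` (- {0})" "x \<in> box a b"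
      by (rule open_contains_cbox)
    have sub: "cbox a b \<subseteq> \<Omega>" using ab(1) by blast
    obtain M1 where M1: "M1 \<ge> 0" "\<And>x. \<bar>P1.pot x\<bar> \<le> M1" using P1.pot_bounded by blast
    obtain M2 where M2: "M2 \<ge> 0" "\<And>x. \<bar>P2.pot x\<bar> \<le> M2" using P2.pot_bounded by blast
    \<comment> \<open>The difference of the potentials, cut off to a closed box on which it has no
      zero. The cut-off makes it square integrable, so that its product with \<open>w\<close> is
      integrable.\<close>
    define k where "k x = indicator (cbox a b) x * (P1.pot x - P2.pot x)" for x
    have [measurable]: "cbox a b \<in> sets borel" by simp
    have [measurable]: "k \<in> borel_measurable borel" unfolding k_def[abs_def] by measurable
    have k2: "integrable lborel (\<lambda>x. (k x)\<^sup>2)"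
    proof (rule Bochner_Integration.integrable_bound)
      show "integrable lborel (\<lambda>x. (M1 + M2)\<^sup>2 * indicator (cbox a b) x :: real)"
        using emeasure_bounded_finite[OF bounded_cbox[of a b]] by simp
      have "(k x)\<^sup>2 \<le> (M1 + M2)\<^sup>2 * indicator (cbox a b) x" for x
      proof (cases "x \<in> cbox a b")
        case True
        have "\<bar>P1.pot x - P2.pot x\<bar> \<le> M1 + M2" using M1(2)[of x] M2(2)[of x] by linarith
        from power_mono[OF this, of 2] show ?thesis using True by (simp add: k_def)
      qed (simp add: k_def)
      then show "AE x in lborel. norm ((k x)\<^sup>2) \<le> norm ((M1 + M2)\<^sup>2 * indicator (cbox a b) x)" by simp
    qed measurable
    have "AE y in lborel. y \<in> box a b \<longrightarrow> k y * w y = 0"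
    proof (rule AE_zero_if_bump_integrals_zero)
      show "integrable lborel (\<lambda>y. k y * w y)"
        by (rule integrable_mult_L2[OF _ _ k2 HsD(2)[OF wH]]) measurable
      fix e f' and c :: real assume ef: "box e f' \<noteq> {}" "cbox e f' \<subseteq> cbox a b" "c > 0"
      define \<phi> where "\<phi> = box_bump c e f'"
      have "test_fun \<Omega> \<phi>" unfolding \<phi>_def using ef sub by (intro test_fun_box_bump) auto
      then have \<phi>: "\<phi> \<in> Hs_tilde s \<Omega>" by (rule test_fun_Hs_tilde[OF s])
      have \<phi>H: "\<phi> \<in> Hs s" by (rule Hs_tildeD[OF \<phi>])
      have "(\<integral>x. P1.pot x * (w x * \<phi> x) \<partial>lborel) = (\<integral>x. P2.pot x * (w x * \<phi> x) \<partial>lborel)"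
        using w1[OF \<phi>] w2[OF \<phi>] unfolding P1.bform_def P2.bform_def P1.pot_integral P2.pot_integral by linarith
      then have "(\<integral>x. P1.pot x * (w x * \<phi> x) - P2.pot x * (w x * \<phi> x) \<partial>lborel) = 0"
        using P1.pot_integrable[OF wH \<phi>H] P2.pot_integrable[OF wH \<phi>H] by simp
      moreover have "P1.pot y * (w y * \<phi> y) - P2.pot y * (w y * \<phi> y) = \<phi> y * (k y * w y)" for y
      proof (cases "y \<in> cbox a b")
        case True then show ?thesis by (simp add: k_def algebra_simps)
      next
        case False
        then have "\<phi> y = 0" unfolding \<phi>_def using ef(2) box_subset_cbox[of e f'] by (intro box_bump_outside[OF ef(1)]) blast
        then show ?thesis by simp
      qed
      ultimately show "(\<integral>x. box_bump c e f' x * (k x * w x) \<partial>lborel) = 0" by (simp add: \<phi>_def)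
    qed
    \<comment> \<open>Subtracting the two equations, tested with bumps in the box, has removed the
      nonlocal term; the factor \<open>k\<close> can now be divided out.\<close>
    then have wz: "AE y in lborel. y \<in> box a b \<longrightarrow> w y = 0"
    proof eventually_elim
      case (elim y)
      show ?case
      proof
        assume y: "y \<in> box a b"
        then have yc: "y \<in> cbox a b" using box_subset_cbox by blast
        then have "a1 y \<noteq> a2 y" "y \<in> \<Omega>" using ab(1) by auto
        then have "k y \<noteq> 0" using yc by (simp add: k_def P1.pot_def P2.pot_def)
        then show "w y = 0" using elim y by simp
      qed
    qed
    have "AE y in lborel. w y = 0"
    proof (rule unique_continuation[OF s wH open_box _ wz])
      show "box a b \<noteq> {}" using ab(2) by blast
      fix \<phi> assume \<phi>: "test_fun (box a b) \<phi>"
      \<comment> \<open>A test function on the box is admissible in the equation for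
        \<open>a1\<close>, whose potential term vanishes together with \<open>w\<close> on the box.
        What is left is the pairing with \<open>(-Delta)^s w\<close>.\<close>
      have "test_fun \<Omega> \<phi>" using sub box_subset_cbox by (intro test_fun_mono[OF \<phi>]) blast
      then have "P1.bform w \<phi> = 0" by (intro w1 test_fun_Hs_tilde[OF s])
      moreover have "(\<integral>x. P1.pot x * (w x * \<phi> x) \<partial>lborel) = 0"
        by (rule integral_eq_zero_AE) (use wz in \<open>eventually_elim, use test_fun_outside[OF \<phi>] in auto\<close>)
      ultimately show "frac_form s w \<phi> = 0" by (simp add: P1.bform_def P1.pot_integral)
    qed
    with w_not_zero show False ..
  qed
  have "a1 x = a2 x" if "x \<in> closure \<Omega>" for x
  proof -
    have "a1 x - a2 x = 0"
      by (rule continuous_constant_on_closure[OF continuous_on_diff[OF a1(1) a2(1)] _ that]) (simp add: eq_in)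
    then show ?thesis by simp
  qed
  moreover have "F1 \<phi> = F2 \<phi>" if \<phi>: "\<phi> \<in> Hs_tilde s \<Omega>" for \<phi>
  proof -
    \<comment> \<open>Equality in \<open>\<Omega>\<close> suffices for all \<open>x\<close>, because
      both potentials are extended by 0.\<close>
    have pot: "P1.pot x = P2.pot x" for x using eq_in[of x] by (simp add: P1.pot_def P2.pot_def indicator_def)
    have "F1 \<phi> = P1.bform u1 \<phi>" using u1 \<phi> by (simp add: is_solution_def P1.bform_def)
    also have "\<dots> = P2.bform u1 \<phi>" unfolding P1.bform_def P2.bform_def P1.pot_integral P2.pot_integral pot ..
    also have "\<dots> = P2.bform u2 \<phi>" by (rule P2.bform_cong_AE[OF uu H(1,2) Hs_tildeD[OF \<phi>]])
    also have "\<dots> = F2 \<phi>" using u2 \<phi> by (simp add: is_solution_def P2.bform_def)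
    finally show ?thesis .
  qed
  ultimately show ?thesis by blast
qed

end
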